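(* Let $F$ be a field such that elements of $F$ can be efficiently represented and manipulated and such that the roots in $F[z]$ of polynomials over $F[z]$ can be found efficiently. Let $p(z)\in F[z]$ have degree $\deg_z p(z)=n>0$, and let $f(x)$ be a monic polynomial in $x$ of degree $d$ over $F[z]$, with coefficients given modulo $p(z)$. Let $0<\beta\le 1$. Then in polynomial time one can find all $w(z)\in F[z]$ such that \[ \deg_z w(z) < \beta^2 n/d \] and \[ \deg_z \gcd\big(f(w(z)),p(z)\big)\ \ge\ \beta n . \]
   Context: $F[z]$ is the ring of univariate polynomials over the field $F$. The polynomial $f(x)=\sum_{i=0}^d f_i(z)x^i$ has coefficients $f_i(z)\in F[z]$, is monic in $x$, and matters only modulo $p(z)$; $f(w(z))$ denotes substitution of $w(z)$ for $x$. "Polynomial time" means time polynomial in the size of the input (in particular in $n$ and $d$), where operations in $F$ and root finding in $F[z]$ of polynomials over $F[z]$ are assumed to be efficient. For finite fields root finding is done by a randomized algorithm, so the overall algorithm is then randomized. *)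

theory Defs
  imports
    "HOL-Probability.Probability"
    "HOL-Computational_Algebra.Computational_Algebra"
begin

section \<open>An algebraic model of computation over a field\<close>

text \<open>
  Algorithms are programs in a first-order recursive language over binary trees whose leaves may
  carry field elements. The syntax is finite and its only field constants are 0 and 1, so a single
  program has to serve all inputs of all sizes. There is no machine integer: counters are lengths
  of lists, so no large number can be handled at unit cost.
\<close>

datatype 'a val = Elem 'a | VNil | VCons "'a val" "'a val"

datatype expr =
    EVar nat                    \<comment> \<open>position in the environment\<close>
  | ELet expr expr              \<comment> \<open>the bound value becomes variable 0 of the second part\<close>
  | ECall nat "expr list"       \<comment> \<open>function of that index in the program\<close>
  | ENil
  | ECons expr expr
  | EHead expr
  | ETail expr
  | EIfNil expr expr expr
  | EZero
  | EOne
  | EAdd expr expr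
  | ESub expr expr
  | EMul expr expr
  | EDiv expr expr
  | EIfZero expr expr expr
  | EIfBeta expr expr expr expr expr
  | ERoots expr

type_synonym program = "expr list"

text \<open>A root finder maps a polynomial over \<open>F[z]\<close> to a list of roots and the time spent.\<close>

type_synonym 'a root_finder = "'a poly poly \<Rightarrow> 'a poly list \<times> nat"

fun vlist :: "'a val list \<Rightarrow> 'a val" where
  "vlist [] = VNil"
| "vlist (v # vs) = VCons v (vlist vs)"

definition enc_poly :: "'a::zero poly \<Rightarrow> 'a val" where
  "enc_poly p = vlist (map Elem (coeffs p))"

definition enc_polys :: "'a::zero poly list \<Rightarrow> 'a val" where
  "enc_polys ps = vlist (map enc_poly ps)"

text \<open>
  \<open>evaluates P \<beta> R env e v t\<close>: in environment \<open>env\<close> the expression \<open>e\<close> has value \<open>v\<close>, and computing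
  it takes time \<open>t\<close>. An expression without a derivation (division by zero, projection of a
  non-pair, non-termination, \<dots>) has no value.

  Each construct costs one unit, field operations and zero tests included, except for the two
  that call on something outside the language. \<open>ERoots\<close> is charged the time reported by the root
  finder. The real parameter \<open>\<beta>\<close> cannot be stored as a value; it is accessible only through
  \<open>EIfBeta\<close>, which compares \<open>\<beta> ^ k * j\<close> with \<open>i\<close> for natural numbers given in unary (as lengths
  of lists) and is charged \<open>k + j + i\<close>. For a rational \<open>\<beta>\<close> given by numerator and
  denominator this is an ordinary polynomial-time comparison.
\<close>

inductive
  evaluates :: "program \<Rightarrow> real \<Rightarrow> 'a::field root_finder \<Rightarrow> 'a val list \<Rightarrow> expr \<Rightarrow> 'a val \<Rightarrow> nat \<Rightarrow> bool"
and
  evaluates_list ::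
    "program \<Rightarrow> real \<Rightarrow> 'a::field root_finder \<Rightarrow> 'a val list \<Rightarrow> expr list \<Rightarrow> 'a val list \<Rightarrow> nat \<Rightarrow> bool"
for P :: program and \<beta> :: real and R :: "'a::field root_finder"
where
  ev_Var: "i < length env \<Longrightarrow> evaluates P \<beta> R env (EVar i) (env ! i) 1"
| ev_Let: "\<lbrakk>evaluates P \<beta> R env e1 u s; evaluates P \<beta> R (u # env) e2 v t\<rbrakk>
    \<Longrightarrow> evaluates P \<beta> R env (ELet e1 e2) v (s + t + 1)"
| ev_Call: "\<lbrakk>i < length P; evaluates_list P \<beta> R env es us s; evaluates P \<beta> R us (P ! i) v t\<rbrakk>
    \<Longrightarrow> evaluates P \<beta> R env (ECall i es) v (s + t + 1)"
| ev_Nil: "evaluates P \<beta> R env ENil VNil 1"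
| ev_Cons: "\<lbrakk>evaluates P \<beta> R env e1 u s; evaluates P \<beta> R env e2 v t\<rbrakk>
    \<Longrightarrow> evaluates P \<beta> R env (ECons e1 e2) (VCons u v) (s + t + 1)"
| ev_Head: "evaluates P \<beta> R env e (VCons u v) t \<Longrightarrow> evaluates P \<beta> R env (EHead e) u (t + 1)"
| ev_Tail: "evaluates P \<beta> R env e (VCons u v) t \<Longrightarrow> evaluates P \<beta> R env (ETail e) v (t + 1)"
| ev_IfNil_yes: "\<lbrakk>evaluates P \<beta> R env e VNil s; evaluates P \<beta> R env e1 v t\<rbrakk>
    \<Longrightarrow> evaluates P \<beta> R env (EIfNil e e1 e2) v (s + t + 1)"
| ev_IfNil_no: "\<lbrakk>evaluates P \<beta> R env e (VCons u u') s; evaluates P \<beta> R env e2 v t\<rbrakk>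
    \<Longrightarrow> evaluates P \<beta> R env (EIfNil e e1 e2) v (s + t + 1)"
| ev_Zero: "evaluates P \<beta> R env EZero (Elem 0) 1"
| ev_One: "evaluates P \<beta> R env EOne (Elem 1) 1"
| ev_Add: "\<lbrakk>evaluates P \<beta> R env e1 (Elem a) s; evaluates P \<beta> R env e2 (Elem b) t\<rbrakk>
    \<Longrightarrow> evaluates P \<beta> R env (EAdd e1 e2) (Elem (a + b)) (s + t + 1)"
| ev_Sub: "\<lbrakk>evaluates P \<beta> R env e1 (Elem a) s; evaluates P \<beta> R env e2 (Elem b) t\<rbrakk>
    \<Longrightarrow> evaluates P \<beta> R env (ESub e1 e2) (Elem (a - b)) (s + t + 1)"
| ev_Mul: "\<lbrakk>evaluates P \<beta> R env e1 (Elem a) s; evaluates P \<beta> R env e2 (Elem b) t\<rbrakk>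
    \<Longrightarrow> evaluates P \<beta> R env (EMul e1 e2) (Elem (a * b)) (s + t + 1)"
| ev_Div: "\<lbrakk>evaluates P \<beta> R env e1 (Elem a) s; evaluates P \<beta> R env e2 (Elem b) t; b \<noteq> 0\<rbrakk>
    \<Longrightarrow> evaluates P \<beta> R env (EDiv e1 e2) (Elem (a / b)) (s + t + 1)"
| ev_IfZero_yes: "\<lbrakk>evaluates P \<beta> R env e (Elem 0) s; evaluates P \<beta> R env e1 v t\<rbrakk>
    \<Longrightarrow> evaluates P \<beta> R env (EIfZero e e1 e2) v (s + t + 1)"
| ev_IfZero_no: "\<lbrakk>evaluates P \<beta> R env e (Elem a) s; a \<noteq> 0; evaluates P \<beta> R env e2 v t\<rbrakk>
    \<Longrightarrow> evaluates P \<beta> R env (EIfZero e e1 e2) v (s + t + 1)"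
| ev_IfBeta: "\<lbrakk>evaluates_list P \<beta> R env [a, b, c] [vlist us, vlist vs, vlist ws] s;
      evaluates P \<beta> R env
        (if \<beta> ^ length us * real (length vs) \<le> real (length ws) then e1 else e2) v t\<rbrakk>
    \<Longrightarrow> evaluates P \<beta> R env (EIfBeta a b c e1 e2) v
          (s + length us + length vs + length ws + t + 1)"
| ev_Roots: "\<lbrakk>evaluates P \<beta> R env e (enc_polys (coeffs Q)) s; Q \<noteq> 0; R Q = (ws, t)\<rbrakk>
    \<Longrightarrow> evaluates P \<beta> R env (ERoots e) (enc_polys ws) (s + t + 1)"
| evs_Nil: "evaluates_list P \<beta> R env [] [] 0"
| evs_Cons: "\<lbrakk>evaluates P \<beta> R env e v s; evaluates_list P \<beta> R env es vs t\<rbrakk>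
    \<Longrightarrow> evaluates_list P \<beta> R env (e # es) (v # vs) (s + t)"

text \<open>Execution starts with the function of index 0, applied to the inputs.\<close>

definition runs ::
  "program \<Rightarrow> real \<Rightarrow> 'a::field root_finder \<Rightarrow> 'a val list \<Rightarrow> 'a val \<Rightarrow> nat \<Rightarrow> bool" where
  "runs P \<beta> R inputs out t \<longleftrightarrow> P \<noteq> [] \<and> evaluates P \<beta> R inputs (P ! 0) out t"

lemma vlist_inject [simp]: "vlist us = vlist vs \<longleftrightarrow> us = vs"
proof (induction us arbitrary: vs)
  case Nil
  then show ?case by (cases vs) auto
next
  case (Cons u us)
  then show ?case by (cases vs) auto
qed

lemma enc_poly_inject [simp]: "enc_poly p = enc_poly q \<longleftrightarrow> p = q"
  by (auto simp: enc_poly_def coeffs_eq_iff inj_def dest!: map_injective)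

lemma enc_polys_inject [simp]: "enc_polys ps = enc_polys qs \<longleftrightarrow> ps = qs"
  by (auto simp: enc_polys_def inj_def dest!: map_injective)

text \<open>For a fixed root finder, result and running time are uniquely determined.\<close>

inductive_cases evaluates_elims:
  "evaluates P \<beta> R env (EVar i) v t"
  "evaluates P \<beta> R env (ELet e1 e2) v t"
  "evaluates P \<beta> R env (ECall i es) v t"
  "evaluates P \<beta> R env ENil v t"
  "evaluates P \<beta> R env (ECons e1 e2) v t"
  "evaluates P \<beta> R env (EHead e) v t"
  "evaluates P \<beta> R env (ETail e) v t"
  "evaluates P \<beta> R env (EIfNil e e1 e2) v t"
  "evaluates P \<beta> R env EZero v t"
  "evaluates P \<beta> R env EOne v t"
  "evaluates P \<beta> R env (EAdd e1 e2) v t"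
  "evaluates P \<beta> R env (ESub e1 e2) v t"
  "evaluates P \<beta> R env (EMul e1 e2) v t"
  "evaluates P \<beta> R env (EDiv e1 e2) v t"
  "evaluates P \<beta> R env (EIfZero e e1 e2) v t"
  "evaluates P \<beta> R env (EIfBeta a b c e1 e2) v t"
  "evaluates P \<beta> R env (ERoots e) v t"
  "evaluates_list P \<beta> R env [] vs t"
  "evaluates_list P \<beta> R env (e # es) vs t"

lemma evaluates_unique_aux:
  "(evaluates P \<beta> R env e v t \<longrightarrow> (\<forall>v' t'. evaluates P \<beta> R env e v' t' \<longrightarrow> v' = v \<and> t' = t)) \<and>
   (evaluates_list P \<beta> R env es vs s \<longrightarrow>
     (\<forall>vs' s'. evaluates_list P \<beta> R env es vs' s' \<longrightarrow> vs' = vs \<and> s' = s))"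
proof (induction rule: evaluates_evaluates_list.induct)
  case (ev_IfBeta env a b c us vs ws s e1 e2 v t)
  show ?case
  proof (intro allI impI)
    fix v' t'
    assume "evaluates P \<beta> R env (EIfBeta a b c e1 e2) v' t'"
    then show "v' = v \<and> t' = s + length us + length vs + length ws + t + 1"
    proof (rule evaluates_elims)
      fix us' vs' ws' s' t''
      assume h: "t' = Suc (s' + length us' + length vs' + length ws' + t'')"
        "evaluates_list P \<beta> R env [a, b, c] [vlist us', vlist vs', vlist ws'] s'"
        "evaluates P \<beta> R env
           (if \<beta> ^ length us' * real (length vs') \<le> real (length ws') then e1 else e2) v' t''"
      from h(2) ev_IfBeta.IH(2) have eq: "us' = us" "vs' = vs" "ws' = ws" "s' = s"
        by (metis list.inject vlist_inject)+
      from h(3)[unfolded eq] ev_IfBeta.IH(4) have "v' = v" "t'' = t" by blast+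
      with h(1) eq show ?thesis by simp
    qed
  qed
next
  case (ev_Roots env e Q s ws t)
  show ?case
  proof (intro allI impI)
    fix v' t'
    assume "evaluates P \<beta> R env (ERoots e) v' t'"
    then show "v' = enc_polys ws \<and> t' = s + t + 1"
    proof (rule evaluates_elims)
      fix Q' s' ws' t''
      assume h: "v' = enc_polys ws'" "t' = Suc (s' + t'')"
        "evaluates P \<beta> R env e (enc_polys (coeffs Q')) s'" "R Q' = (ws', t'')"
      from h(3) ev_Roots.IH(2) have "Q' = Q" "s' = s"
        by (metis coeffs_eq_iff enc_polys_inject)+
      with h \<open>R Q = (ws, t)\<close> show ?thesis by simp
    qed
  qed
next
  case ev_Var
  show ?case
    by (intro allI impI; erule evaluates_elims) (metis ev_Var val.inject val.distinct Suc_eq_plus1 One_nat_def)+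
next
  case ev_Let
  show ?case
    by (intro allI impI; erule evaluates_elims) (metis ev_Let val.inject val.distinct Suc_eq_plus1 One_nat_def)+
next
  case ev_Call
  show ?case
    by (intro allI impI; erule evaluates_elims) (metis ev_Call val.inject val.distinct Suc_eq_plus1 One_nat_def)+
next
  case ev_Nil
  show ?case
    by (intro allI impI; erule evaluates_elims) (metis ev_Nil val.inject val.distinct Suc_eq_plus1 One_nat_def)+
next
  case ev_Cons
  show ?case
    by (intro allI impI; erule evaluates_elims) (metis ev_Cons val.inject val.distinct Suc_eq_plus1 One_nat_def)+
next
  case ev_Head
  show ?case
    by (intro allI impI; erule evaluates_elims) (metis ev_Head val.inject val.distinct Suc_eq_plus1 One_nat_def)+
next
  case ev_Tail
  show ?case
    by (intro allI impI; erule evaluates_elims) (metis ev_Tail val.inject val.distinct Suc_eq_plus1 One_nat_def)+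
next
  case ev_IfNil_yes
  show ?case
    by (intro allI impI; erule evaluates_elims) (metis ev_IfNil_yes val.inject val.distinct Suc_eq_plus1 One_nat_def)+
next
  case ev_IfNil_no
  show ?case
    by (intro allI impI; erule evaluates_elims) (metis ev_IfNil_no val.inject val.distinct Suc_eq_plus1 One_nat_def)+
next
  case ev_Zero
  show ?case
    by (intro allI impI; erule evaluates_elims) (metis ev_Zero val.inject val.distinct Suc_eq_plus1 One_nat_def)+
next
  case ev_One
  show ?case
    by (intro allI impI; erule evaluates_elims) (metis ev_One val.inject val.distinct Suc_eq_plus1 One_nat_def)+
next
  case ev_Add
  show ?case
    by (intro allI impI; erule evaluates_elims) (metis ev_Add val.inject val.distinct Suc_eq_plus1 One_nat_def)+
next
  case ev_Sub
  show ?case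
    by (intro allI impI; erule evaluates_elims) (metis ev_Sub val.inject val.distinct Suc_eq_plus1 One_nat_def)+
next
  case ev_Mul
  show ?case
    by (intro allI impI; erule evaluates_elims) (metis ev_Mul val.inject val.distinct Suc_eq_plus1 One_nat_def)+
next
  case ev_Div
  show ?case
    by (intro allI impI; erule evaluates_elims) (metis ev_Div val.inject val.distinct Suc_eq_plus1 One_nat_def)+
next
  case ev_IfZero_yes
  show ?case
    by (intro allI impI; erule evaluates_elims) (metis ev_IfZero_yes val.inject val.distinct Suc_eq_plus1 One_nat_def)+
next
  case ev_IfZero_no
  show ?case
    by (intro allI impI; erule evaluates_elims) (metis ev_IfZero_no val.inject val.distinct Suc_eq_plus1 One_nat_def)+
next
  case evs_Nil
  show ?case
    by (intro allI impI; erule evaluates_elims) (metis evs_Nil val.inject val.distinct Suc_eq_plus1 One_nat_def)+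
next
  case evs_Cons
  show ?case
    by (intro allI impI; erule evaluates_elims) (metis evs_Cons val.inject val.distinct Suc_eq_plus1 One_nat_def)+
qed

lemma evaluates_unique:
  "evaluates P \<beta> R env e v t \<Longrightarrow> evaluates P \<beta> R env e v' t' \<Longrightarrow> v' = v \<and> t' = t"
  using evaluates_unique_aux[of P \<beta> R env e v t "[]" "[]" 0] by blast

section \<open>Efficient root finding\<close>

definition bipoly_size :: "'a::zero poly poly \<Rightarrow> nat" where
  "bipoly_size Q = (\<Sum>c\<leftarrow>coeffs Q. length (coeffs c) + 1)"

text \<open>
  \<open>rf \<omega>\<close> is the root finder run with random choices \<open>\<omega>\<close> drawn from \<open>M\<close>: on each nonzero input it
  almost surely lists the roots, in expected time polynomial in the size of the input. A
  deterministic root finder with polynomial worst-case running time is the case of a one-point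
  space \<open>M\<close>.
\<close>

definition efficient_root_finder ::
  "'w measure \<Rightarrow> ('w \<Rightarrow> 'a::field root_finder) \<Rightarrow> bool" where
  "efficient_root_finder M rf \<longleftrightarrow> prob_space M \<and>
     (\<exists>c k. \<forall>Q. Q \<noteq> 0 \<longrightarrow>
        (\<lambda>\<omega>. rf \<omega> Q) \<in> measurable M (count_space UNIV) \<and>
        (AE \<omega> in M. distinct (fst (rf \<omega> Q)) \<and> set (fst (rf \<omega> Q)) = {w. poly Q w = 0}) \<and>
        (\<integral>\<^sup>+ \<omega>. of_nat (snd (rf \<omega> Q)) \<partial>M) \<le> of_nat (c * bipoly_size Q ^ k))"

end

theory Submission
  imports Defs
begin

text \<open>
  The algorithm is Coppersmith's method over \<open>F[z]\<close>. Put \<open>g = \<lceil>\<beta> n\<rceil>\<close>, and let \<open>k\<close> be the largest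
  admissible degree of \<open>w\<close>. Every \<open>Q\<close> in the \<open>F[z]\<close>-span of the polynomials \<open>p ^ (m - i) * f ^ i * x ^ j\<close>
  satisfies \<open>(gcd (f(w)) p) ^ m dvd Q(w)\<close>, so \<open>Q(w) = 0\<close> as soon as \<open>deg Q(w) < m g\<close>. The bound
  \<open>deg w < \<beta>\<^sup>2 n / d\<close> gives \<open>k d n < g\<^sup>2\<close>, an inequality between integers, and so \<open>m\<close> of size
  polynomial in \<open>n\<close>, uniformly in \<open>\<beta>\<close>, is enough: counting coefficients shows that some nonzero \<open>Q\<close>
  in the span has all its monomials \<open>z ^ e * x ^ J\<close> in the region \<open>e + k J < m g\<close>.

  Instead of reducing a lattice basis, the program finds \<open>Q\<close> by Gaussian elimination over \<open>F\<close> on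
  finitely many \<open>z\<close>-shifts of the generators. Giving \<open>x\<close> the weight \<open>n\<close> makes the leading term of
  the monic \<open>f\<close> dominant, which keeps the shifts inside a region whose size exceeds their number
  by exactly the codimension of the span. After the Kronecker substitution \<open>x = z ^ E\<close> the shifts
  are univariate polynomials of distinct degrees, hence linearly independent. The roots of \<open>Q\<close> are
  finally filtered by degree and by the degree of the gcd.
\<close>

text \<open>The counting works as follows. Eliminating a coefficient costs at most one row, and
  nothing where the whole region vanishes. In the column of x^J the region has E - n J coefficients,
  of which the lowest B - k J may survive. The block of rows for J = i d + j falls short of E - n J
  by n (m - i). So a row survives if the sum of n d (m - i) over i < M is less than the sum of B - k
  J over J < N. To leading order this says n d m^2 / 2 + k N^2 / 2 < N B, where N = M d and B = m g,
  and the ratio M : m = n : g turns it into k d n < g^2. What remains is a lower order term. Since k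
  d n and g^2 are integers, they differ by at least 1, and the common factor u = n + 1 > g in m and
  M lifts this gap above that term. The value of E cancels from the count; it must be large enough
  for the subtractions from E to be genuine. Counting only shows that a row survives; linear
  independence shows that it is nonzero.\<close>

section \<open>Reasoning about programs\<close>

text \<open>
  Executions are considered simultaneously for all root finders in a set \<open>RR\<close>. For the set of root
  finders with a prescribed answer on the one polynomial the program asks about, this shows that
  the running time is a function of that answer alone, hence measurable in the random choices.
\<close>

definition evals ::
  "program \<Rightarrow> real \<Rightarrow> 'a::field root_finder set \<Rightarrow> 'a val list \<Rightarrow> expr \<Rightarrow> 'a val \<Rightarrow> nat \<Rightarrow> bool" where
  "evals P \<beta> RR env e v t \<longleftrightarrow> (\<forall>R\<in>RR. evaluates P \<beta> R env e v t)"

definition callee ::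
  "program \<Rightarrow> real \<Rightarrow> 'a::field root_finder set \<Rightarrow> nat \<Rightarrow> 'a val list \<Rightarrow> ('a val \<Rightarrow> nat \<Rightarrow> bool) \<Rightarrow> bool" where
  "callee P \<beta> RR i us \<Phi> \<longleftrightarrow> (\<exists>v t. evals P \<beta> RR us (P ! i) v t \<and> \<Phi> v t)"

text \<open>A weakest-precondition calculus, in which calls are left opaque; unfolding it evaluates a body symbolically.\<close>

primrec wp ::
    "program \<Rightarrow> real \<Rightarrow> 'a::field root_finder set \<Rightarrow> 'a val list \<Rightarrow> expr \<Rightarrow> ('a val \<Rightarrow> nat \<Rightarrow> bool) \<Rightarrow> bool"
  and wps ::
    "program \<Rightarrow> real \<Rightarrow> 'a::field root_finder set \<Rightarrow> 'a val list \<Rightarrow> expr list \<Rightarrow> ('a val list \<Rightarrow> nat \<Rightarrow> bool) \<Rightarrow> bool"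
where
  "wp P \<beta> RR env (EVar i) \<Phi> = (i < length env \<and> \<Phi> (env ! i) 1)"
| "wp P \<beta> RR env (ELet e1 e2) \<Phi> =
     wp P \<beta> RR env e1 (\<lambda>u s. wp P \<beta> RR (u # env) e2 (\<lambda>v t. \<Phi> v (s + t + 1)))"
| "wp P \<beta> RR env (ECall i es) \<Phi> = (i < length P \<and>
     wps P \<beta> RR env es (\<lambda>us s. callee P \<beta> RR i us (\<lambda>v t. \<Phi> v (s + t + 1))))"
| "wp P \<beta> RR env ENil \<Phi> = \<Phi> VNil 1"
| "wp P \<beta> RR env (ECons e1 e2) \<Phi> =
     wp P \<beta> RR env e1 (\<lambda>u s. wp P \<beta> RR env e2 (\<lambda>v t. \<Phi> (VCons u v) (s + t + 1)))"
| "wp P \<beta> RR env (EHead e) \<Phi> =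
     wp P \<beta> RR env e (\<lambda>u s. case u of VCons a b \<Rightarrow> \<Phi> a (s + 1) | _ \<Rightarrow> False)"
| "wp P \<beta> RR env (ETail e) \<Phi> =
     wp P \<beta> RR env e (\<lambda>u s. case u of VCons a b \<Rightarrow> \<Phi> b (s + 1) | _ \<Rightarrow> False)"
| "wp P \<beta> RR env (EIfNil e e1 e2) \<Phi> =
     wp P \<beta> RR env e (\<lambda>u s. case u of
        VNil \<Rightarrow> wp P \<beta> RR env e1 (\<lambda>v t. \<Phi> v (s + t + 1))
      | VCons a b \<Rightarrow> wp P \<beta> RR env e2 (\<lambda>v t. \<Phi> v (s + t + 1))
      | Elem a \<Rightarrow> False)"
| "wp P \<beta> RR env EZero \<Phi> = \<Phi> (Elem 0) 1"
| "wp P \<beta> RR env EOne \<Phi> = \<Phi> (Elem 1) 1"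
| "wp P \<beta> RR env (EAdd e1 e2) \<Phi> =
     wp P \<beta> RR env e1 (\<lambda>u s. wp P \<beta> RR env e2 (\<lambda>v t.
       \<exists>a b. u = Elem a \<and> v = Elem b \<and> \<Phi> (Elem (a + b)) (s + t + 1)))"
| "wp P \<beta> RR env (ESub e1 e2) \<Phi> =
     wp P \<beta> RR env e1 (\<lambda>u s. wp P \<beta> RR env e2 (\<lambda>v t.
       \<exists>a b. u = Elem a \<and> v = Elem b \<and> \<Phi> (Elem (a - b)) (s + t + 1)))"
| "wp P \<beta> RR env (EMul e1 e2) \<Phi> =
     wp P \<beta> RR env e1 (\<lambda>u s. wp P \<beta> RR env e2 (\<lambda>v t.
       \<exists>a b. u = Elem a \<and> v = Elem b \<and> \<Phi> (Elem (a * b)) (s + t + 1)))"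
| "wp P \<beta> RR env (EDiv e1 e2) \<Phi> =
     wp P \<beta> RR env e1 (\<lambda>u s. wp P \<beta> RR env e2 (\<lambda>v t.
       \<exists>a b. u = Elem a \<and> v = Elem b \<and> b \<noteq> 0 \<and> \<Phi> (Elem (a / b)) (s + t + 1)))"
| "wp P \<beta> RR env (EIfZero e e1 e2) \<Phi> =
     wp P \<beta> RR env e (\<lambda>u s. case u of
        Elem a \<Rightarrow> if a = 0 then wp P \<beta> RR env e1 (\<lambda>v t. \<Phi> v (s + t + 1))
          else wp P \<beta> RR env e2 (\<lambda>v t. \<Phi> v (s + t + 1))
      | _ \<Rightarrow> False)"
| "wp P \<beta> RR env (EIfBeta a b c e1 e2) \<Phi> =
     wp P \<beta> RR env a (\<lambda>x s1. wp P \<beta> RR env b (\<lambda>y s2. wp P \<beta> RR env c (\<lambda>z s3.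
       \<exists>us vs ws. x = vlist us \<and> y = vlist vs \<and> z = vlist ws \<and>
       (if \<beta> ^ length us * real (length vs) \<le> real (length ws)
        then wp P \<beta> RR env e1 (\<lambda>v t. \<Phi> v (s1 + s2 + s3 + length us + length vs + length ws + t + 1))
        else wp P \<beta> RR env e2 (\<lambda>v t. \<Phi> v (s1 + s2 + s3 + length us + length vs + length ws + t + 1))))))"
| "wp P \<beta> RR env (ERoots e) \<Phi> =
     wp P \<beta> RR env e (\<lambda>u s. \<exists>Q rs t. u = enc_polys (coeffs Q) \<and> Q \<noteq> 0 \<and>
       (\<forall>R\<in>RR. R Q = (rs, t)) \<and> \<Phi> (enc_polys rs) (s + t + 1))"
| "wps P \<beta> RR env [] \<Phi> = \<Phi> [] 0"
| "wps P \<beta> RR env (e # es) \<Phi> =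
     wp P \<beta> RR env e (\<lambda>v s. wps P \<beta> RR env es (\<lambda>vs t. \<Phi> (v # vs) (s + t)))"

lemma evals_intros:
  "evals P \<beta> RR env e1 u s \<Longrightarrow> evals P \<beta> RR (u # env) e2 v t \<Longrightarrow> evals P \<beta> RR env (ELet e1 e2) v (s + t + 1)"
  "i < length P \<Longrightarrow> \<forall>R\<in>RR. evaluates_list P \<beta> R env es us s \<Longrightarrow> evals P \<beta> RR us (P ! i) v t \<Longrightarrow>
    evals P \<beta> RR env (ECall i es) v (s + t + 1)"
  "evals P \<beta> RR env e1 u s \<Longrightarrow> evals P \<beta> RR env e2 v t \<Longrightarrow> evals P \<beta> RR env (ECons e1 e2) (VCons u v) (s + t + 1)"
  "evals P \<beta> RR env e (VCons u v) t \<Longrightarrow> evals P \<beta> RR env (EHead e) u (t + 1)"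
  "evals P \<beta> RR env e (VCons u v) t \<Longrightarrow> evals P \<beta> RR env (ETail e) v (t + 1)"
  "evals P \<beta> RR env e VNil s \<Longrightarrow> evals P \<beta> RR env e1 v t \<Longrightarrow> evals P \<beta> RR env (EIfNil e e1 e2) v (s + t + 1)"
  "evals P \<beta> RR env e (VCons u u') s \<Longrightarrow> evals P \<beta> RR env e2 v t \<Longrightarrow>
    evals P \<beta> RR env (EIfNil e e1 e2) v (s + t + 1)"
  "evals P \<beta> RR env e1 (Elem a) s \<Longrightarrow> evals P \<beta> RR env e2 (Elem b) t \<Longrightarrow>
    evals P \<beta> RR env (EAdd e1 e2) (Elem (a + b)) (s + t + 1)"
  "evals P \<beta> RR env e1 (Elem a) s \<Longrightarrow> evals P \<beta> RR env e2 (Elem b) t \<Longrightarrow>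
    evals P \<beta> RR env (ESub e1 e2) (Elem (a - b)) (s + t + 1)"
  "evals P \<beta> RR env e1 (Elem a) s \<Longrightarrow> evals P \<beta> RR env e2 (Elem b) t \<Longrightarrow>
    evals P \<beta> RR env (EMul e1 e2) (Elem (a * b)) (s + t + 1)"
  "evals P \<beta> RR env e1 (Elem a) s \<Longrightarrow> evals P \<beta> RR env e2 (Elem b) t \<Longrightarrow> b \<noteq> 0 \<Longrightarrow>
    evals P \<beta> RR env (EDiv e1 e2) (Elem (a / b)) (s + t + 1)"
  "evals P \<beta> RR env e (Elem 0) s \<Longrightarrow> evals P \<beta> RR env e1 v t \<Longrightarrow>
    evals P \<beta> RR env (EIfZero e e1 e2) v (s + t + 1)"
  "evals P \<beta> RR env e (Elem a) s \<Longrightarrow> a \<noteq> 0 \<Longrightarrow> evals P \<beta> RR env e2 v t \<Longrightarrow>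
    evals P \<beta> RR env (EIfZero e e1 e2) v (s + t + 1)"
  "evals P \<beta> RR env e (enc_polys (coeffs Q)) s \<Longrightarrow> Q \<noteq> 0 \<Longrightarrow> \<forall>R\<in>RR. R Q = (rs, t) \<Longrightarrow>
    evals P \<beta> RR env (ERoots e) (enc_polys rs) (s + t + 1)"
  unfolding evals_def by (auto intro: evaluates_evaluates_list.intros[unfolded One_nat_def add_Suc_right add_0_right])

text \<open>Soundness for single expressions is a hypothesis restricted to the members of
  \<open>es\<close>, so that the \<open>ECall\<close> case of the structural induction in
  \<open>wp_sound\<close> can supply its induction hypotheses.\<close>

lemma wps_sound:
  assumes "\<And>e env (\<Phi> :: 'a::field val \<Rightarrow> nat \<Rightarrow> bool). e \<in> set es \<Longrightarrow> wp P \<beta> RR env e \<Phi> \<Longrightarrow>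
    \<exists>v t. evals P \<beta> RR env e v t \<and> \<Phi> v t"
    and "wps P \<beta> RR env es \<Psi>"
  shows "\<exists>vs t. (\<forall>R\<in>RR. evaluates_list P \<beta> R env es vs t) \<and> \<Psi> vs t"
  using assms
proof (induction es arbitrary: \<Psi>)
  case Nil
  then show ?case by (auto intro: evs_Nil)
next
  case (Cons e es)
  from Cons.prems(1)[OF _ Cons.prems(2)[unfolded wps.simps]] obtain v s
    where 1: "evals P \<beta> RR env e v s"
      and 2: "wps P \<beta> RR env es (\<lambda>vs t. \<Psi> (v # vs) (s + t))" by auto
  from Cons.IH[OF Cons.prems(1) 2] obtain vs t
    where "\<forall>R\<in>RR. evaluates_list P \<beta> R env es vs t" "\<Psi> (v # vs) (s + t)" by auto
  moreover from this(1) 1 have "\<forall>R\<in>RR. evaluates_list P \<beta> R env (e # es) (v # vs) (s + t)"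
    unfolding evals_def by (blast intro: evs_Cons)
  ultimately show ?case by blast
qed

lemma wp_sound:
  fixes \<Phi> :: "'a::field val \<Rightarrow> nat \<Rightarrow> bool"
  shows "wp P \<beta> RR env e \<Phi> \<Longrightarrow> \<exists>v t. evals P \<beta> RR env e v t \<and> \<Phi> v t"
proof (induction e arbitrary: env \<Phi>)
  case (EVar i)
  then show ?case by (auto simp: evals_def intro!: ev_Var[unfolded One_nat_def])
next
  case (ELet e1 e2)
  from ELet.IH(1)[OF ELet.prems[unfolded wp.simps]] obtain u s where 1: "evals P \<beta> RR env e1 u s"
    and "wp P \<beta> RR (u # env) e2 (\<lambda>v t. \<Phi> v (s + t + 1))" by auto
  from ELet.IH(2)[OF this(2)] 1 show ?case by (blast intro: evals_intros(1))
next
  case (ECall i es)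
  from ECall.prems have i: "i < length P" by simp
  from wps_sound[OF ECall.IH ECall.prems[unfolded wp.simps, THEN conjunct2]] i
  show ?case unfolding callee_def by (blast intro: evals_intros(2))
next
  case (ECons e1 e2)
  from ECons.IH(1)[OF ECons.prems[unfolded wp.simps]] obtain u s where 1: "evals P \<beta> RR env e1 u s"
    and "wp P \<beta> RR env e2 (\<lambda>v t. \<Phi> (VCons u v) (s + t + 1))" by auto
  from ECons.IH(2)[OF this(2)] 1 show ?case by (blast intro: evals_intros(3))
next
  case (EHead e)
  from EHead.IH[OF EHead.prems[unfolded wp.simps]] obtain u s where 1: "evals P \<beta> RR env e u s"
    and "case u of VCons a b \<Rightarrow> \<Phi> a (s + 1) | _ \<Rightarrow> False" by blast
  then obtain a b where "u = VCons a b" "\<Phi> a (s + 1)" by (cases u) auto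
  with 1 have "evals P \<beta> RR env e (VCons a b) s" "\<Phi> a (s + 1)" by auto
  then show ?case by (blast intro: evals_intros(4))
next
  case (ETail e)
  from ETail.IH[OF ETail.prems[unfolded wp.simps]] obtain u s where 1: "evals P \<beta> RR env e u s"
    and "case u of VCons a b \<Rightarrow> \<Phi> b (s + 1) | _ \<Rightarrow> False" by blast
  then obtain a b where "u = VCons a b" "\<Phi> b (s + 1)" by (cases u) auto
  with 1 have "evals P \<beta> RR env e (VCons a b) s" "\<Phi> b (s + 1)" by auto
  then show ?case by (blast intro: evals_intros(5))
next
  case (EIfNil e e1 e2)
  from EIfNil.IH(1)[OF EIfNil.prems[unfolded wp.simps]] obtain u s where 1: "evals P \<beta> RR env e u s"
    and 2: "case u of VNil \<Rightarrow> wp P \<beta> RR env e1 (\<lambda>v t. \<Phi> v (s + t + 1))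
      | VCons a b \<Rightarrow> wp P \<beta> RR env e2 (\<lambda>v t. \<Phi> v (s + t + 1))
      | Elem a \<Rightarrow> False" by auto
  show ?case
  proof (cases u)
    case VNil
    from EIfNil.IH(2)[OF 2[unfolded VNil val.case]] 1 VNil show ?thesis
      by (blast intro: evals_intros(6))
  next
    case (VCons a b)
    from EIfNil.IH(3)[OF 2[unfolded VCons val.case]] 1 VCons show ?thesis
      by (blast intro: evals_intros(7))
  qed (use 2 in auto)
next
  case (EAdd e1 e2)
  from EAdd.IH(1)[OF EAdd.prems[unfolded wp.simps]] obtain u s where 1: "evals P \<beta> RR env e1 u s"
    and 2: "wp P \<beta> RR env e2 (\<lambda>v t.
       \<exists>a b. u = Elem a \<and> v = Elem b \<and> \<Phi> (Elem (a + b)) (s + t + 1))" by auto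
  from EAdd.IH(2)[OF 2] 1 show ?case by (blast intro: evals_intros(8))
next
  case (ESub e1 e2)
  from ESub.IH(1)[OF ESub.prems[unfolded wp.simps]] obtain u s where 1: "evals P \<beta> RR env e1 u s"
    and 2: "wp P \<beta> RR env e2 (\<lambda>v t.
       \<exists>a b. u = Elem a \<and> v = Elem b \<and> \<Phi> (Elem (a - b)) (s + t + 1))" by auto
  from ESub.IH(2)[OF 2] 1 show ?case by (blast intro: evals_intros(9))
next
  case (EMul e1 e2)
  from EMul.IH(1)[OF EMul.prems[unfolded wp.simps]] obtain u s where 1: "evals P \<beta> RR env e1 u s"
    and 2: "wp P \<beta> RR env e2 (\<lambda>v t.
       \<exists>a b. u = Elem a \<and> v = Elem b \<and> \<Phi> (Elem (a * b)) (s + t + 1))" by auto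
  from EMul.IH(2)[OF 2] 1 show ?case by (blast intro: evals_intros(10))
next
  case (EDiv e1 e2)
  from EDiv.IH(1)[OF EDiv.prems[unfolded wp.simps]] obtain u s where 1: "evals P \<beta> RR env e1 u s"
    and 2: "wp P \<beta> RR env e2 (\<lambda>v t.
       \<exists>a b. u = Elem a \<and> v = Elem b \<and> b \<noteq> 0 \<and> \<Phi> (Elem (a / b)) (s + t + 1))" by auto
  from EDiv.IH(2)[OF 2] 1 show ?case by (blast intro: evals_intros(11))
next
  case (EIfZero e e1 e2)
  from EIfZero.IH(1)[OF EIfZero.prems[unfolded wp.simps]] obtain u s
    where u: "evals P \<beta> RR env e u s"
    and "case u of Elem a \<Rightarrow> if a = 0 then wp P \<beta> RR env e1 (\<lambda>v t. \<Phi> v (s + t + 1))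
        else wp P \<beta> RR env e2 (\<lambda>v t. \<Phi> v (s + t + 1)) | _ \<Rightarrow> False" by blast
  then obtain a where "u = Elem a" and 2: "if a = 0 then wp P \<beta> RR env e1 (\<lambda>v t. \<Phi> v (s + t + 1))
        else wp P \<beta> RR env e2 (\<lambda>v t. \<Phi> v (s + t + 1))" by (cases u) auto
  with u have 1: "evals P \<beta> RR env e (Elem a) s" by simp
  show ?case
  proof (cases "a = 0")
    case True
    from EIfZero.IH(2)[OF 2[unfolded True simp_thms if_True]] 1[unfolded True] show ?thesis
      by (blast intro: evals_intros(12))
  next
    case False
    from 2 False have "wp P \<beta> RR env e2 (\<lambda>v t. \<Phi> v (s + t + 1))" by simp
    from EIfZero.IH(3)[OF this] 1 False show ?thesis
      by (blast intro: evals_intros(13))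
  qed
next
  case (EIfBeta a b c e1 e2)
  note p = EIfBeta.prems[unfolded wp.simps]
  from EIfBeta.IH(1)[OF p] obtain x s1 where 1: "evals P \<beta> RR env a x s1" and
    p: "wp P \<beta> RR env b (\<lambda>y s2. wp P \<beta> RR env c (\<lambda>z s3.
       \<exists>us vs ws. x = vlist us \<and> y = vlist vs \<and> z = vlist ws \<and>
       (if \<beta> ^ length us * real (length vs) \<le> real (length ws)
        then wp P \<beta> RR env e1 (\<lambda>v t. \<Phi> v (s1 + s2 + s3 + length us + length vs + length ws + t + 1))
        else wp P \<beta> RR env e2 (\<lambda>v t. \<Phi> v (s1 + s2 + s3 + length us + length vs + length ws + t + 1)))))"
    by auto
  from EIfBeta.IH(2)[OF p] obtain y s2 where 2: "evals P \<beta> RR env b y s2" and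
    p: "wp P \<beta> RR env c (\<lambda>z s3.
       \<exists>us vs ws. x = vlist us \<and> y = vlist vs \<and> z = vlist ws \<and>
       (if \<beta> ^ length us * real (length vs) \<le> real (length ws)
        then wp P \<beta> RR env e1 (\<lambda>v t. \<Phi> v (s1 + s2 + s3 + length us + length vs + length ws + t + 1))
        else wp P \<beta> RR env e2 (\<lambda>v t. \<Phi> v (s1 + s2 + s3 + length us + length vs + length ws + t + 1))))"
    by auto
  from EIfBeta.IH(3)[OF p] obtain us vs ws s3 where 3: "evals P \<beta> RR env c (vlist ws) s3"
    and x: "x = vlist us" "y = vlist vs"
    and p: "if \<beta> ^ length us * real (length vs) \<le> real (length ws)
        then wp P \<beta> RR env e1 (\<lambda>v t. \<Phi> v (s1 + s2 + s3 + length us + length vs + length ws + t + 1))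
        else wp P \<beta> RR env e2 (\<lambda>v t. \<Phi> v (s1 + s2 + s3 + length us + length vs + length ws + t + 1))"
    by auto
  obtain v t where e: "evals P \<beta> RR env
      (if \<beta> ^ length us * real (length vs) \<le> real (length ws) then e1 else e2) v t"
    and \<Phi>: "\<Phi> v (s1 + s2 + s3 + length us + length vs + length ws + t + 1)"
    using EIfBeta.IH(4)[of env "\<lambda>v t. \<Phi> v (s1 + s2 + s3 + length us + length vs + length ws + t + 1)"]
      EIfBeta.IH(5)[of env "\<lambda>v t. \<Phi> v (s1 + s2 + s3 + length us + length vs + length ws + t + 1)"]
      p by (auto split: if_splits)
  have "evaluates_list P \<beta> R env [a, b, c] [vlist us, vlist vs, vlist ws] (s1 + s2 + s3)"
    if "R \<in> RR" for R
    using evs_Cons[of P \<beta> R env a "vlist us" s1, OF _ evs_Cons[of P \<beta> R env b "vlist vs" s2,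
        OF _ evs_Cons[of P \<beta> R env c "vlist ws" s3, OF _ evs_Nil]]] 1 2 3 x that
    by (auto simp: evals_def add.assoc)
  with e have "evals P \<beta> RR env (EIfBeta a b c e1 e2) v
      (s1 + s2 + s3 + length us + length vs + length ws + t + 1)"
    unfolding evals_def by (intro ballI ev_IfBeta) auto
  with \<Phi> show ?case by blast
next
  case (ERoots e)
  from ERoots.IH[OF ERoots.prems[unfolded wp.simps]] obtain Q rs t s
    where "evals P \<beta> RR env e (enc_polys (coeffs Q)) s" "Q \<noteq> 0" "\<forall>R\<in>RR. R Q = (rs, t)"
      "\<Phi> (enc_polys rs) (s + t + 1)" by auto
  then show ?case by (blast intro: evals_intros(14))
qed (auto simp: evals_def intro!: exI intro: evaluates_evaluates_list.intros[unfolded One_nat_def])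

section \<open>The program\<close>

abbreviation (input) "call_pcons a p \<equiv> ECall 1 [a, p]"
abbreviation (input) "call_axpy p c q \<equiv> ECall 2 [p, c, q]"
abbreviation (input) "call_mul p q \<equiv> ECall 3 [p, q]"
abbreviation (input) "call_shift p n \<equiv> ECall 4 [p, n]"
abbreviation (input) "call_horner fs w \<equiv> ECall 5 [fs, w]"
abbreviation (input) "call_pow p n \<equiv> ECall 6 [p, n]"
abbreviation (input) "call_coeff p n \<equiv> ECall 7 [p, n]"
abbreviation (input) "call_reduce rs r i \<equiv> ECall 8 [rs, r, i]"
abbreviation (input) "call_elim rs i \<equiv> ECall 9 [rs, i]"
abbreviation (input) "call_elim_seg rs i c \<equiv> ECall 10 [rs, i, c]"
abbreviation (input) "call_elim_all rs N s l E k \<equiv> ECall 11 [rs, N, s, l, E, k]"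
abbreviation (input) "call_cutoff p n \<equiv> ECall 12 [p, n]"
abbreviation (input) "call_drop xs ys \<equiv> ECall 13 [xs, ys]"
abbreviation (input) "call_append xs ys \<equiv> ECall 14 [xs, ys]"
abbreviation (input) "call_times m n \<equiv> ECall 15 [m, n]"
abbreviation (input) "call_shifts p c \<equiv> ECall 16 [p, c]"
abbreviation (input) "call_block_rows E n a d G e \<equiv> ECall 17 [E, n, a, d, G, e]"
abbreviation (input) "call_all_rows E n d p fh m M F e \<equiv> ECall 18 [E, n, d, p, fh, m, M, F, e]"
abbreviation (input) "call_chunks p N E \<equiv> ECall 19 [p, N, E]"
abbreviation (input) "call_lcons c cs \<equiv> ECall 20 [c, cs]"
abbreviation (input) "call_ceil us n st v \<equiv> ECall 21 [us, n, st, v]"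
abbreviation (input) "call_lead p \<equiv> ECall 22 [p]"
abbreviation (input) "call_cancel p q \<equiv> ECall 23 [p, q]"
abbreviation (input) "call_gcd p q \<equiv> ECall 24 [p, q]"
abbreviation (input) "call_len xs \<equiv> ECall 25 [xs]"
abbreviation (input) "call_test w p fs n k \<equiv> ECall 26 [w, p, fs, n, k]"
abbreviation (input) "call_filter ws p fs n k \<equiv> ECall 27 [ws, p, fs, n, k]"

text \<open>\<open>enc_poly\<close> encodes \<open>coeffs\<close>, which has no trailing zeros, so a
  zero put in front of the empty list must disappear. Canonical encodings are rebuilt through this
  function.\<close>

definition "pcons_body = EIfNil (EVar 1)
  (EIfZero (EVar 0) ENil (ECons (EVar 0) ENil)) (ECons (EVar 0) (EVar 1))"

text \<open>This is p - c q. It serves as the row operation and, with c = -1, as addition. The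
  recursion stops at the end of \<open>q\<close>, so the cost is independent of
  \<open>p\<close>.\<close>

definition "axpy_body = EIfNil (EVar 2) (EVar 0) (EIfNil (EVar 0)
  (call_pcons (ESub EZero (EMul (EVar 1) (EHead (EVar 2)))) (call_axpy ENil (EVar 1) (ETail (EVar 2))))
  (call_pcons (ESub (EHead (EVar 0)) (EMul (EVar 1) (EHead (EVar 2))))
     (call_axpy (ETail (EVar 0)) (EVar 1) (ETail (EVar 2)))))"

definition "mul_body = EIfNil (EVar 0) ENil
  (call_axpy (call_pcons EZero (call_mul (ETail (EVar 0)) (EVar 1))) (ESub EZero (EHead (EVar 0))) (EVar 1))"

definition "shift_body = EIfNil (EVar 1) (EVar 0)
  (call_pcons EZero (call_shift (EVar 0) (ETail (EVar 1))))"

definition "horner_body = EIfNil (EVar 0) ENil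
  (call_axpy (EHead (EVar 0)) (ESub EZero EOne) (call_mul (EVar 1) (call_horner (ETail (EVar 0)) (EVar 1))))"

definition "pow_body = EIfNil (EVar 1) (ECons EOne ENil)
  (call_mul (EVar 0) (call_pow (EVar 0) (ETail (EVar 1))))"

definition "coeff_body = EIfNil (EVar 0) EZero (EIfNil (EVar 1) (EHead (EVar 0))
  (call_coeff (ETail (EVar 0)) (ETail (EVar 1))))"

definition "reduce_body = EIfNil (EVar 0) ENil (ECons
  (call_axpy (EHead (EVar 0))
     (EDiv (call_coeff (EHead (EVar 0)) (EVar 2)) (call_coeff (EVar 1) (EVar 2))) (EVar 1))
  (call_reduce (ETail (EVar 0)) (EVar 1) (EVar 2)))"

definition "elim_body = EIfNil (EVar 0) ENil
  (EIfZero (call_coeff (EHead (EVar 0)) (EVar 1))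
    (ECons (EHead (EVar 0)) (call_elim (ETail (EVar 0)) (EVar 1)))
    (call_reduce (ETail (EVar 0)) (EHead (EVar 0)) (EVar 1)))"

definition "elim_seg_body = EIfNil (EVar 2) (EVar 0)
  (call_elim_seg (call_elim (EVar 0) (EVar 1)) (ECons ENil (EVar 1)) (ETail (EVar 2)))"

text \<open>In round J the arguments \<open>s\<close> and \<open>l\<close> hold J E and B - k J.
  Each round clears the positions from s + l up to s + E.\<close>

definition "elim_all_body = EIfNil (EVar 1) (EVar 0)
  (call_elim_all
    (call_elim_seg (EVar 0) (call_append (EVar 2) (EVar 3)) (call_drop (EVar 4) (EVar 3)))
    (ETail (EVar 1)) (call_append (EVar 2) (EVar 4)) (call_drop (EVar 3) (EVar 5)) (EVar 4) (EVar 5))"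

definition "cutoff_body = EIfNil (EVar 1) ENil (EIfNil (EVar 0) ENil
  (call_pcons (EHead (EVar 0)) (call_cutoff (ETail (EVar 0)) (ETail (EVar 1)))))"

definition "drop_body = EIfNil (EVar 1) (EVar 0) (EIfNil (EVar 0) ENil
  (call_drop (ETail (EVar 0)) (ETail (EVar 1))))"

definition "append_body = EIfNil (EVar 0) (EVar 1)
  (ECons (EHead (EVar 0)) (call_append (ETail (EVar 0)) (EVar 1)))"

definition "times_body = EIfNil (EVar 0) ENil
  (call_append (EVar 1) (call_times (ETail (EVar 0)) (EVar 1)))"

definition "shifts_body = EIfNil (EVar 1) ENil
  (ECons (EVar 0) (call_shifts (call_pcons EZero (EVar 0)) (ETail (EVar 1))))"

definition "block_rows_body = EIfNil (EVar 3) ENil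
  (call_append (call_shifts (EVar 4) (call_drop (EVar 5) (EVar 2)))
    (call_block_rows (EVar 0) (EVar 1) (EVar 2) (ETail (EVar 3)) (call_shift (EVar 4) (EVar 0))
      (call_drop (EVar 5) (EVar 1))))"

text \<open>\<open>ETail\<close> has no value on the empty list; the inner \<open>EIfNil\<close>
  makes it the truncated predecessor of \<open>m\<close>.\<close>

definition "all_rows_body = EIfNil (EVar 6) ENil
  (call_append
    (call_block_rows (EVar 0) (EVar 1) (call_times (EVar 1) (EVar 5)) (EVar 2)
      (call_mul (call_pow (EVar 3) (EVar 5)) (EVar 7)) (EVar 8))
    (call_all_rows (EVar 0) (EVar 1) (EVar 2) (EVar 3) (EVar 4)
      (EIfNil (EVar 5) ENil (ETail (EVar 5))) (ETail (EVar 6)) (call_mul (EVar 7) (EVar 4))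
      (call_drop (EVar 8) (call_times (EVar 1) (EVar 2)))))"

definition "chunks_body = EIfNil (EVar 1) ENil
  (call_lcons (call_cutoff (EVar 0) (EVar 2))
    (call_chunks (call_drop (EVar 0) (EVar 2)) (ETail (EVar 1)) (EVar 2)))"

text \<open>The analogue of \<open>pcons_body\<close> one level up: \<open>ERoots\<close> accepts
  only \<open>enc_polys (coeffs Q)\<close>, so zero coefficients at the top in x must
  vanish.\<close>

definition "lcons_body = EIfNil (EVar 1)
  (EIfNil (EVar 0) ENil (ECons (EVar 0) ENil)) (ECons (EVar 0) (EVar 1))"

text \<open>A linear search, since \<beta> is accessible through comparisons alone. Exponent 1 with
  step 1 gives g; exponent 2 with step d gives k + 1.\<close>

definition "ceil_body = EIfBeta (EVar 0) (EVar 1) (EVar 3) ENil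
  (ECons ENil (call_ceil (EVar 0) (EVar 1) (EVar 2) (call_append (EVar 2) (EVar 3))))"

definition "lead_body = EIfNil (ETail (EVar 0)) (EHead (EVar 0)) (call_lead (ETail (EVar 0)))"

definition "cancel_body = call_axpy (EVar 0) (EDiv (call_lead (EVar 0)) (call_lead (EVar 1)))
  (call_shift (EVar 1) (call_len (call_drop (EVar 0) (EVar 1))))"

text \<open>Euclid's algorithm with one cancellation of leading terms per round in place of a full
  division. \<open>call_drop\<close> compares the lengths. The result is a gcd up to a unit, which
  suffices for reading off its degree.\<close>

definition "gcd_body = EIfNil (EVar 0) (EVar 1) (EIfNil (EVar 1) (EVar 0)
  (EIfNil (call_drop (EVar 0) (EVar 1))
    (call_gcd (call_cancel (EVar 1) (EVar 0)) (EVar 0))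
    (call_gcd (call_cancel (EVar 0) (EVar 1)) (EVar 1))))"

definition "len_body = EIfNil (EVar 0) ENil (ECons ENil (call_len (ETail (EVar 0))))"

text \<open>The empty list signals acceptance. Removing one entry from the coefficients of the gcd
  leaves a list whose length is the degree.\<close>

definition "test_body = EIfNil (call_drop (EVar 0) (EVar 4))
  (EIfBeta (ECons ENil ENil) (EVar 3) (ETail (call_gcd (call_horner (EVar 2) (EVar 0)) (EVar 1)))
    ENil (ECons ENil ENil))
  (ECons ENil ENil)"

definition "filter_body = EIfNil (EVar 0) ENil
  (EIfNil (call_test (EHead (EVar 0)) (EVar 1) (EVar 2) (EVar 3) (EVar 4))
    (ECons (EHead (EVar 0)) (call_filter (ETail (EVar 0)) (EVar 1) (EVar 2) (EVar 3) (EVar 4)))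
    (call_filter (ETail (EVar 0)) (EVar 1) (EVar 2) (EVar 3) (EVar 4)))"

text \<open>A constant \<open>f\<close> is answered by the empty list, in agreement with the value 0
  of \<beta>^2 n / 0 in HOL. Otherwise n and d are measured as lengths of tails and passed
  on.\<close>

definition "main_body = EIfNil (ETail (EVar 1)) ENil
  (ECall 28 [EVar 0, EVar 1, call_len (ETail (EVar 0)), call_len (ETail (EVar 1))])"

text \<open>Arguments: \<open>p\<close>, \<open>f\<close>, \<open>n\<close>, \<open>d\<close>.\<close>

definition "main1_body = ECall 29 [EVar 0, EVar 1, EVar 2, EVar 3,
  call_ceil (ECons ENil ENil) (EVar 2) (ECons ENil ENil) ENil,
  call_ceil (ECons ENil (ECons ENil ENil)) (EVar 2) (EVar 3) ENil]"

text \<open>Arguments: \<open>p\<close>, \<open>f\<close>, \<open>n\<close>, \<open>d\<close>, \<open>g\<close>, \<open>k + 1\<close>.\<close>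

definition "main2_body = ECall 30 [EVar 0, EVar 1, EVar 2, EVar 3, EVar 4, EVar 5,
  call_times (EVar 4) (ECons ENil (EVar 2)), call_times (EVar 2) (ECons ENil (EVar 2))]"

text \<open>Arguments: \<open>p\<close>, \<open>f\<close>, \<open>n\<close>, \<open>d\<close>, \<open>g\<close>, \<open>k + 1\<close>, \<open>m\<close>, \<open>M\<close>.\<close>

definition "main3_body = ELet (call_times (EVar 7) (EVar 3))
  (ECall 31 [EVar 1, EVar 2, EVar 3, EVar 4, EVar 6, EVar 7, EVar 8, EVar 0,
    call_times (EVar 7) (EVar 5), call_times (EVar 3) (call_append (EVar 0) (EVar 7))])"

text \<open>Arguments: \<open>p\<close>, \<open>f\<close>, \<open>n\<close>, \<open>d\<close>, \<open>k + 1\<close>, \<open>m\<close>, \<open>M\<close>, \<open>N\<close>, \<open>B\<close>, \<open>E\<close>.\<close>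

definition "main4_body = call_filter
  (ERoots (call_chunks
    (EHead (call_elim_all
      (call_all_rows (EVar 9) (EVar 2) (EVar 3) (EVar 0)
        (call_horner (EVar 1) (call_shift (ECons EOne ENil) (EVar 9)))
        (EVar 5) (EVar 6) (ECons EOne ENil) (EVar 9))
      (EVar 7) ENil (EVar 8) (EVar 9) (ETail (EVar 4))))
    (EVar 7) (EVar 9)))
  (EVar 0) (EVar 1) (EVar 2) (EVar 4)"

definition prog :: program where
  "prog = [main_body, pcons_body, axpy_body, mul_body, shift_body, horner_body, pow_body,
     coeff_body, reduce_body, elim_body, elim_seg_body, elim_all_body, cutoff_body, drop_body,
     append_body, times_body, shifts_body, block_rows_body, all_rows_body, chunks_body,
     lcons_body, ceil_body, lead_body, cancel_body, gcd_body, len_body, test_body, filter_body,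
     main1_body, main2_body, main3_body, main4_body]"

lemma length_prog [simp]: "length prog = 32"
  by (simp add: prog_def)

lemma prog_nth:
  "prog ! 0 = main_body" "prog ! Suc 0 = pcons_body" "prog ! 2 = axpy_body" "prog ! 3 = mul_body"
  "prog ! 4 = shift_body" "prog ! 5 = horner_body" "prog ! 6 = pow_body" "prog ! 7 = coeff_body"
  "prog ! 8 = reduce_body" "prog ! 9 = elim_body" "prog ! 10 = elim_seg_body"
  "prog ! 11 = elim_all_body" "prog ! 12 = cutoff_body" "prog ! 13 = drop_body"
  "prog ! 14 = append_body" "prog ! 15 = times_body" "prog ! 16 = shifts_body"
  "prog ! 17 = block_rows_body" "prog ! 18 = all_rows_body" "prog ! 19 = chunks_body"
  "prog ! 20 = lcons_body" "prog ! 21 = ceil_body" "prog ! 22 = lead_body"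
  "prog ! 23 = cancel_body" "prog ! 24 = gcd_body" "prog ! 25 = len_body" "prog ! 26 = test_body"
  "prog ! 27 = filter_body" "prog ! 28 = main1_body" "prog ! 29 = main2_body"
  "prog ! 30 = main3_body" "prog ! 31 = main4_body"
  by (simp_all add: prog_def)

section \<open>Results and costs of the functions\<close>

text \<open>A single running time serves all root finders in \<open>RR\<close>, but only an upper
  bound for it is recorded. The value is exact.\<close>

definition computes ::
  "real \<Rightarrow> 'a::field root_finder set \<Rightarrow> nat \<Rightarrow> 'a val list \<Rightarrow> 'a val \<Rightarrow> nat \<Rightarrow> bool" where
  "computes \<beta> RR i us v T \<longleftrightarrow> (\<exists>t\<le>T. evals prog \<beta> RR us (prog ! i) v t)"

lemma computesI:
  assumes "wp prog \<beta> RR us (prog ! i) (\<lambda>v' t. v' = v \<and> t \<le> T)"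
  shows "computes \<beta> RR i us v T"
  using wp_sound[OF assms] by (auto simp: computes_def)

lemma calleeI:
  assumes "computes \<beta> RR i us v T" "\<And>t. t \<le> T \<Longrightarrow> \<Phi> v t"
  shows "callee prog \<beta> RR i us \<Phi>"
  using assms by (auto simp: computes_def callee_def)

lemma computes_mono: "computes \<beta> RR i us v T \<Longrightarrow> T \<le> T' \<Longrightarrow> computes \<beta> RR i us v T'"
  unfolding computes_def by (meson le_trans)

definition unary :: "nat \<Rightarrow> 'a val" where
  "unary n = vlist (replicate n VNil)"

lemma unary_simps [simp]: "unary 0 = VNil" "unary (Suc n) = VCons VNil (unary n)"
  by (simp_all add: unary_def)

abbreviation plen :: "'a::zero poly \<Rightarrow> nat" where
  "plen p \<equiv> length (coeffs p)"

lemma enc_poly_0 [simp]: "enc_poly 0 = VNil"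
  by (simp add: enc_poly_def)

lemma enc_poly_pCons: "a \<noteq> 0 \<or> p \<noteq> 0 \<Longrightarrow> enc_poly (pCons a p) = VCons (Elem a) (enc_poly p)"
  by (auto simp: enc_poly_def cCons_def)

lemma plen_pCons: "a \<noteq> 0 \<or> p \<noteq> 0 \<Longrightarrow> plen (pCons a p) = Suc (plen p)"
  by (auto simp: cCons_def)

lemma enc_polys_simps [simp]:
  "enc_polys [] = VNil" "enc_polys (c # cs) = VCons (enc_poly c) (enc_polys cs)"
  by (simp_all add: enc_polys_def)

lemma poly_cases_pCons [case_names 0 pCons]:
  assumes "p = 0 \<Longrightarrow> thesis" "\<And>a q. p = pCons a q \<Longrightarrow> a \<noteq> 0 \<or> q \<noteq> 0 \<Longrightarrow> thesis"
  shows thesis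
  using assms by (cases p) (metis pCons_eq_0_iff)

lemma plen_le_iff: "plen p \<le> n \<longleftrightarrow> p = 0 \<or> degree p < n"
  by (cases "p = 0") (auto simp: length_coeffs_degree)

lemma enc_poly_nz_cases:
  assumes "p \<noteq> 0" obtains a q where "p = pCons a q" "a \<noteq> 0 \<or> q \<noteq> 0"
  using assms by (cases p rule: poly_cases_pCons) auto

lemma computes_pcons: "computes \<beta> RR (Suc 0) [Elem a, enc_poly p] (enc_poly (pCons a p)) 7"
  by (rule computesI, cases p rule: poly_cases_pCons; cases "a = 0")
    (auto simp: prog_nth pcons_body_def enc_poly_pCons)

lemma computes_axpy:
  "computes \<beta> RR 2 [enc_poly p, Elem c, enc_poly q] (enc_poly (p - smult c q)) (40 * plen q + 3)"
proof (induction q arbitrary: p rule: pCons_induct)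
  case 0
  show ?case by (rule computesI) (auto simp: prog_nth axpy_body_def)
next
  case (pCons b q)
  note b = enc_poly_pCons[OF pCons.hyps(1)] plen_pCons[OF pCons.hyps(1)]
  show ?case
  proof (cases p rule: poly_cases_pCons)
    case 0
    show ?thesis unfolding 0
      apply (intro computesI)
      apply (simp add: prog_nth axpy_body_def b del: coeffs_pCons_eq_cCons)
      apply (rule calleeI[OF pCons.IH[of 0, unfolded enc_poly_0]], rule calleeI[OF computes_pcons])
      apply (simp)
      done
  next
    case (pCons a p')
    note a = enc_poly_pCons[OF pCons(2)] plen_pCons[OF pCons(2)]
    show ?thesis unfolding pCons(1)
      apply (intro computesI)
      apply (simp add: prog_nth axpy_body_def a b del: coeffs_pCons_eq_cCons)
      apply (rule calleeI[OF pCons.IH], rule calleeI[OF computes_pcons])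
      apply (simp)
      done
  qed
qed

lemma computes_mul:
  "computes \<beta> RR 3 [enc_poly p, enc_poly q] (enc_poly (p * q)) (plen p * (40 * plen q + 40) + 3)"
proof (induction p rule: pCons_induct)
  case 0
  show ?case by (rule computesI) (auto simp: prog_nth mul_body_def)
next
  case (pCons a p)
  note a = enc_poly_pCons[OF pCons.hyps(1)] plen_pCons[OF pCons.hyps(1)]
  show ?case
    apply (intro computesI)
    apply (simp add: prog_nth mul_body_def a del: coeffs_pCons_eq_cCons)
    apply (rule calleeI[OF pCons.IH], rule calleeI[OF computes_pcons], rule calleeI[OF computes_axpy])
    apply (simp)
    done
qed

lemma computes_shift:
  "computes \<beta> RR 4 [enc_poly p, unary n] (enc_poly (monom 1 n * p)) (20 * n + 3)"
proof (induction n)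
  case 0
  show ?case by (rule computesI) (auto simp: prog_nth shift_body_def)
next
  case (Suc n)
  show ?case
    apply (intro computesI)
    apply (simp add: prog_nth shift_body_def)
    apply (rule calleeI[OF Suc.IH], rule calleeI[OF computes_pcons])
    apply (simp add: monom_Suc)
    done
qed

lemma computes_coeff:
  "computes \<beta> RR 7 [enc_poly p, unary n] (Elem (coeff p n)) (15 * n + 6)"
proof (induction n arbitrary: p)
  case 0
  show ?case
    by (rule computesI, cases p rule: poly_cases_pCons) (auto simp: prog_nth coeff_body_def enc_poly_pCons)
next
  case (Suc n)
  show ?case
  proof (cases p rule: poly_cases_pCons)
    case 0
    then show ?thesis by (intro computesI) (simp add: prog_nth coeff_body_def)
  next
    case (pCons a q)
    note a = enc_poly_pCons[OF pCons(2)]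
    show ?thesis unfolding pCons(1)
      apply (intro computesI)
      apply (simp add: prog_nth coeff_body_def a)
      apply (rule calleeI[OF Suc.IH])
      apply (simp)
      done
  qed
qed

lemma poly_cutoff_pCons: "poly_cutoff (Suc n) (pCons a p) = pCons a (poly_cutoff n p)"
  by (rule poly_eqI) (auto simp: coeff_poly_cutoff coeff_pCons split: nat.split)

lemma poly_cutoff_zero: "poly_cutoff 0 p = 0"
  by (rule poly_eqI) (auto simp: coeff_poly_cutoff)

lemma computes_cutoff:
  "computes \<beta> RR 12 [enc_poly p, unary n] (enc_poly (poly_cutoff n p)) (25 * n + 6)"
proof (induction n arbitrary: p)
  case 0
  show ?case by (rule computesI) (auto simp: prog_nth cutoff_body_def poly_cutoff_zero)
next
  case (Suc n)
  show ?case
  proof (cases p rule: poly_cases_pCons)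
    case 0
    then show ?thesis by (intro computesI) (simp add: prog_nth cutoff_body_def)
  next
    case (pCons a q)
    note a = enc_poly_pCons[OF pCons(2)]
    show ?thesis unfolding pCons(1) poly_cutoff_pCons
      apply (intro computesI)
      apply (simp add: prog_nth cutoff_body_def a)
      apply (rule calleeI[OF Suc.IH], rule calleeI[OF computes_pcons])
      apply (simp)
      done
  qed
qed

text \<open>Arbitrary lists are allowed because one function acts as truncated subtraction, as
  division by a power of z, and as comparison of lengths.\<close>

lemma computes_drop:
  "computes \<beta> RR 13 [vlist us, vlist vs] (vlist (drop (length vs) us)) (15 * length vs + 6)"
proof (induction vs arbitrary: us)
  case Nil
  show ?case by (rule computesI) (auto simp: prog_nth drop_body_def)
next
  case (Cons v vs)
  show ?case
  proof (cases us)
    case Nil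
    then show ?thesis by (intro computesI) (simp add: prog_nth drop_body_def)
  next
    case us: (Cons u us)
    show ?thesis unfolding us
      apply (intro computesI)
      apply (simp add: prog_nth drop_body_def)
      apply (rule calleeI[OF Cons.IH])
      apply (simp)
      done
  qed
qed

lemma computes_drop_unary:
  "computes \<beta> RR 13 [unary m, unary n] (unary (m - n)) (15 * n + 6)"
  using computes_drop[of \<beta> RR "replicate m VNil" "replicate n VNil"] by (simp add: unary_def)

lemma computes_drop_poly:
  "computes \<beta> RR 13 [enc_poly p, unary n] (enc_poly (poly_shift n p)) (15 * n + 6)"
  using computes_drop[of \<beta> RR "map Elem (coeffs p)" "replicate n VNil"]
  by (simp add: unary_def enc_poly_def coeffs_shift_poly drop_map)

lemma computes_append:
  "computes \<beta> RR 14 [vlist us, vlist vs] (vlist (us @ vs)) (15 * length us + 3)"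
proof (induction us)
  case Nil
  show ?case by (rule computesI) (auto simp: prog_nth append_body_def)
next
  case (Cons u us)
  show ?case
    apply (intro computesI)
    apply (simp add: prog_nth append_body_def)
    apply (rule calleeI[OF Cons.IH])
    apply (simp)
    done
qed

lemma computes_append_unary:
  "computes \<beta> RR 14 [unary m, unary n] (unary (m + n)) (15 * m + 3)"
  using computes_append[of \<beta> RR "replicate m VNil" "replicate n VNil"]
  by (simp add: unary_def replicate_add)

lemma computes_append_polys:
  "computes \<beta> RR 14 [enc_polys ps, enc_polys qs] (enc_polys (ps @ qs)) (15 * length ps + 3)"
  using computes_append[of \<beta> RR "map enc_poly ps" "map enc_poly qs"]
  by (simp add: enc_polys_def)

lemma computes_times:
  "computes \<beta> RR 15 [unary m, unary n] (unary (m * n)) (m * (15 * n + 20) + 3)"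
proof (induction m)
  case 0
  show ?case by (rule computesI) (auto simp: prog_nth times_body_def)
next
  case (Suc m)
  show ?case
    apply (intro computesI)
    apply (simp add: prog_nth times_body_def)
    apply (rule calleeI[OF Suc.IH], rule calleeI[OF computes_append_unary])
    apply (simp)
    done
qed

lemma computes_len:
  "computes \<beta> RR 25 [vlist us] (unary (length us)) (15 * length us + 3)"
proof (induction us)
  case Nil
  show ?case by (rule computesI) (auto simp: prog_nth len_body_def)
next
  case (Cons u us)
  show ?case
    apply (intro computesI)
    apply (simp add: prog_nth len_body_def)
    apply (rule calleeI[OF Cons.IH])
    apply (simp)
    done
qed

lemma computes_lcons:
  "computes \<beta> RR 20 [enc_poly c, enc_polys (coeffs q)] (enc_polys (coeffs (pCons c q))) 7"
proof (rule computesI, cases q rule: poly_cases_pCons)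
  case 0
  then show "wp prog \<beta> RR [enc_poly c, enc_polys (coeffs q)] (prog ! 20)
     (\<lambda>v' t. v' = enc_polys (coeffs (pCons c q)) \<and> t \<le> 7)"
    by (cases c rule: poly_cases_pCons) (auto simp: prog_nth lcons_body_def enc_poly_pCons)
next
  case (pCons a q')
  then have *: "coeffs q = a # coeffs q'" by (auto simp: cCons_def)
  then have "enc_polys (coeffs q) = VCons (enc_poly a) (enc_polys (coeffs q'))"
     "coeffs (pCons c q) = c # coeffs q" by auto
  then show "wp prog \<beta> RR [enc_poly c, enc_polys (coeffs q)] (prog ! 20)
     (\<lambda>v' t. v' = enc_polys (coeffs (pCons c q)) \<and> t \<le> 7)"
    by (simp add: prog_nth lcons_body_def del: coeffs_pCons_eq_cCons)
qed

lemma computes_lead: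
  "p \<noteq> 0 \<Longrightarrow> computes \<beta> RR 22 [enc_poly p] (Elem (lead_coeff p)) (15 * plen p)"
proof (induction p rule: pCons_induct)
  case (pCons a p)
  note a = enc_poly_pCons[OF pCons.hyps(1)] plen_pCons[OF pCons.hyps(1)]
  show ?case
  proof (cases p rule: poly_cases_pCons)
    case 0
    with pCons.prems show ?thesis
      by (intro computesI) (simp add: prog_nth lead_body_def enc_poly_pCons)
  next
    case (pCons b q)
    then have p: "p \<noteq> 0" by auto
    from pCons have e: "enc_poly p = VCons (Elem b) (enc_poly q)" by (simp add: enc_poly_pCons)
    note IH = pCons.IH[OF p]
    show ?thesis
      apply (intro computesI)
      apply (simp add: prog_nth lead_body_def a e p del: coeffs_pCons_eq_cCons)
      apply (rule calleeI[OF IH[unfolded e]])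
      apply (simp add: p)
      done
  qed
qed simp

lemma plen_add_le: "plen (p + q) \<le> max (plen p) (plen q)"
  for p q :: "'a::field poly"
  unfolding plen_le_iff
  using degree_add_le_max[of p q]
  by (cases "p = 0"; cases "q = 0") (auto simp: length_coeffs_degree less_Suc_eq_le)

lemma plen_diff_smult_le: "plen (p - smult c q) \<le> max (plen p) (plen q)"
  for p q :: "'a::field poly"
proof -
  have "plen (smult (- c) q) \<le> plen q"
    using degree_smult_le[of "-c" q] by (cases "q = 0"; cases "c = 0") (auto simp: length_coeffs_degree)
  then show ?thesis using plen_add_le[of p "smult (- c) q"] by simp
qed

lemma plen_mult_le: "plen (p * q) \<le> plen p + plen q"
  for p q :: "'a::field poly"
  using degree_mult_le[of p q] by (cases "p = 0"; cases "q = 0") (auto simp: length_coeffs_degree)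

lemma plen_monom_mult: "q \<noteq> 0 \<Longrightarrow> plen (monom 1 n * q) = n + plen q"
  for q :: "'a::field poly"
  by (auto simp: length_coeffs_degree degree_mult_eq degree_monom_eq)

lemma plen_power_le: "plen (p ^ n) \<le> n * plen p + 1"
  for p :: "'a::field poly"
proof (induction n)
  case (Suc n)
  then show ?case using plen_mult_le[of p "p ^ n"] by simp
qed simp

definition horner :: "'a::field poly list \<Rightarrow> 'a poly \<Rightarrow> 'a poly" where
  "horner cs w = foldr (\<lambda>c r. c + w * r) cs 0"

lemma horner_simps [simp]: "horner [] w = 0" "horner (c # cs) w = c + w * horner cs w"
  by (simp_all add: horner_def)

lemma plen_horner_le:
  "\<forall>c\<in>set cs. plen c \<le> A \<Longrightarrow> plen (horner cs w) \<le> A + length cs * plen w"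
proof (induction cs)
  case (Cons c cs)
  then show ?case
    using plen_add_le[of c "w * horner cs w"] plen_mult_le[of w "horner cs w"] by auto
qed simp

lemma computes_horner:
  assumes "\<forall>c\<in>set cs. plen c \<le> A" "A + length cs * plen w \<le> L"
  shows "computes \<beta> RR 5 [enc_polys cs, enc_poly w] (enc_poly (horner cs w))
    (length cs * (plen w * (40 * L + 40) + 40 * L + 40) + 3)"
  using assms
proof (induction cs)
  case Nil
  show ?case by (rule computesI) (auto simp: prog_nth horner_body_def)
next
  case (Cons c cs)
  have IH: "computes \<beta> RR 5 [enc_polys cs, enc_poly w] (enc_poly (horner cs w))
    (length cs * (plen w * (40 * L + 40) + 40 * L + 40) + 3)"
    using Cons by simp
  have h: "plen (horner cs w) \<le> L" "plen (w * horner cs w) \<le> L"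
    using plen_horner_le[of cs A w] plen_mult_le[of w "horner cs w"] Cons.prems by auto
  then have "plen w * (40 * plen (horner cs w) + 40) \<le> plen w * (40 * L + 40)" by (intro mult_left_mono) auto
  note bounds = this h
  show ?case
    apply (intro computesI)
    apply (simp add: prog_nth horner_body_def)
    apply (rule calleeI[OF IH], rule calleeI[OF computes_mul], rule calleeI[OF computes_axpy])
    apply (intro conjI, simp, use bounds in linarith)
    done
qed

lemma computes_pow:
  assumes "n * plen p + 1 \<le> L"
  shows "computes \<beta> RR 6 [enc_poly p, unary n] (enc_poly (p ^ n)) (n * (plen p * (40 * L + 40) + 20) + 5)"
  using assms
proof (induction n)
  case 0
  show ?case by (rule computesI) (auto simp: prog_nth pow_body_def enc_poly_pCons one_pCons)
next
  case (Suc n)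
  have IH: "computes \<beta> RR 6 [enc_poly p, unary n] (enc_poly (p ^ n)) (n * (plen p * (40 * L + 40) + 20) + 5)"
    using Suc by simp
  have "plen (p ^ n) \<le> L" using plen_power_le[of p n] Suc.prems by simp
  then have "plen p * (40 * plen (p ^ n) + 40) \<le> plen p * (40 * L + 40)" by (intro mult_left_mono) auto
  note bounds = this
  show ?case
    apply (intro computesI)
    apply (simp add: prog_nth pow_body_def)
    apply (rule calleeI[OF IH], rule calleeI[OF computes_mul])
    apply (intro conjI, simp, use bounds in linarith)
    done
qed

section \<open>Gaussian elimination: program and cost\<close>

definition reduce_rows :: "nat \<Rightarrow> 'a::field poly \<Rightarrow> 'a poly list \<Rightarrow> 'a poly list" where
  "reduce_rows i r rs = map (\<lambda>s. s - smult (coeff s i / coeff r i) r) rs"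

text \<open>The pivot row is discarded after use. The remaining rows have coefficient 0 at
  \<open>i\<close> and are combinations of the old ones, so this computes inside a kernel and does
  not aim at an echelon form.\<close>

fun elim_coeff :: "nat \<Rightarrow> 'a::field poly list \<Rightarrow> 'a poly list" where
  "elim_coeff i [] = []"
| "elim_coeff i (r # rs) = (if coeff r i = 0 then r # elim_coeff i rs else reduce_rows i r rs)"

lemma computes_reduce:
  assumes "coeff r i \<noteq> 0"
  shows "computes \<beta> RR 8 [enc_polys rs, enc_poly r, unary i] (enc_polys (reduce_rows i r rs))
    (length rs * (40 * plen r + 30 * i + 50) + 3)"
proof (induction rs)
  case Nil
  show ?case by (rule computesI) (auto simp: prog_nth reduce_body_def reduce_rows_def)
next
  case (Cons s rs)
  show ?case
    apply (intro computesI)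
    apply (simp add: prog_nth reduce_body_def reduce_rows_def)
    apply (rule calleeI[OF computes_coeff], rule calleeI[OF computes_coeff])
    apply (simp add: assms)
    apply (rule calleeI[OF computes_axpy], rule calleeI[OF Cons.IH])
    apply (simp add: reduce_rows_def)
    done
qed

lemma computes_elim:
  assumes "\<forall>r\<in>set rs. plen r \<le> L"
  shows "computes \<beta> RR 9 [enc_polys rs, unary i] (enc_polys (elim_coeff i rs))
    (length rs * (40 * L + 30 * i + 80) + 3)"
  using assms
proof (induction rs)
  case Nil
  show ?case by (rule computesI) (auto simp: prog_nth elim_body_def)
next
  case (Cons r rs)
  have IH: "computes \<beta> RR 9 [enc_polys rs, unary i] (enc_polys (elim_coeff i rs))
    (length rs * (40 * L + 30 * i + 80) + 3)" using Cons by simp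
  show ?case
  proof (cases "coeff r i = 0")
    case True
    then show ?thesis
      apply (intro computesI)
      apply (simp add: prog_nth elim_body_def)
      apply (rule calleeI[OF computes_coeff])
      apply simp
      apply (rule calleeI[OF IH])
      apply simp
      done
  next
    case False
    have "length rs * (40 * plen r + 30 * i + 50) \<le> length rs * (40 * L + 30 * i + 80)"
      using Cons.prems by (intro mult_left_mono) auto
    note bounds = this
    show ?thesis
      apply (intro computesI)
      apply (simp add: prog_nth elim_body_def False)
      apply (rule calleeI[OF computes_coeff])
      apply (simp add: False)
      apply (rule calleeI[OF computes_reduce[OF False]])
      apply (intro conjI, simp, use bounds in linarith)
      done
  qed
qed

lemma length_elim_coeff_le: "length (elim_coeff i rs) \<le> length rs"
  by (induction rs) (auto simp: reduce_rows_def)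

lemma plen_elim_coeff:
  "\<forall>r\<in>set rs. plen r \<le> L \<Longrightarrow> \<forall>r\<in>set (elim_coeff i rs). plen r \<le> L"
  by (induction rs) (auto simp: reduce_rows_def intro: order.trans[OF plen_diff_smult_le])

lemma length_fold_elim_le: "length (fold elim_coeff is rs) \<le> length rs"
  by (induction "is" arbitrary: rs) (auto intro: order.trans[OF _ length_elim_coeff_le])

lemma plen_fold_elim:
  "\<forall>r\<in>set rs. plen r \<le> L \<Longrightarrow> \<forall>r\<in>set (fold elim_coeff is rs). plen r \<le> L"
  proof (induction "is" arbitrary: rs)
  case (Cons i "is")
  show ?case using Cons.IH[OF plen_elim_coeff[OF Cons.prems]] by simp
qed simp

lemma computes_elim_seg:
  assumes "\<forall>r\<in>set rs. plen r \<le> L" "length rs \<le> K" "i + c \<le> L"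
  shows "computes \<beta> RR 10 [enc_polys rs, unary i, unary c] (enc_polys (fold elim_coeff [i..<i + c] rs))
    (c * (K * (70 * L + 80) + 25) + 3)"
  using assms
proof (induction c arbitrary: i rs)
  case 0
  show ?case by (rule computesI) (auto simp: prog_nth elim_seg_body_def)
next
  case (Suc c)
  have "length (elim_coeff i rs) \<le> K" using length_elim_coeff_le[of i rs] Suc.prems(2) by linarith
  then have IH: "computes \<beta> RR 10 [enc_polys (elim_coeff i rs), unary (Suc i), unary c]
      (enc_polys (fold elim_coeff [Suc i..<Suc i + c] (elim_coeff i rs)))
      (c * (K * (70 * L + 80) + 25) + 3)"
    using Suc.prems by (intro Suc.IH plen_elim_coeff) auto
  have "length rs * (40 * L + 30 * i + 80) \<le> K * (70 * L + 80)"
    using Suc.prems by (intro mult_mono) auto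
  note bounds = this
  have upt: "[i..<Suc (i + c)] = i # [Suc i..<Suc (i + c)]" by (simp add: upt_conv_Cons del: upt_Suc)
  show ?case
    apply (intro computesI)
    apply (simp add: prog_nth elim_seg_body_def upt del: upt_Suc)
    apply (rule calleeI[OF computes_elim[OF Suc.prems(1)]])
    apply (rule calleeI[OF IH[unfolded unary_simps add_Suc]])
    apply (intro conjI, simp, use bounds in linarith)
    done
qed

text \<open>With s = J E and l = B - k J, these are the positions in the Kronecker image of the
  monomials z^e x^J with e at least B - k J.\<close>

fun elim_pos :: "nat \<Rightarrow> nat \<Rightarrow> nat \<Rightarrow> nat \<Rightarrow> nat \<Rightarrow> nat list" where
  "elim_pos 0 s l E k = []"
| "elim_pos (Suc N) s l E k = [s + l..<s + l + (E - l)] @ elim_pos N (s + E) (l - k) E k"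

lemma computes_elim_all:
  assumes "\<forall>r\<in>set rs. plen r \<le> L" "length rs \<le> K" "s + N * E + l \<le> L" "E \<le> L" "k \<le> L"
  shows "computes \<beta> RR 11 [enc_polys rs, unary N, unary s, unary l, unary E, unary k]
    (enc_polys (fold elim_coeff (elim_pos N s l E k) rs))
    (N * (L * (K * (70 * L + 80) + 25) + 60 * L + 60) + 3)"
  using assms
proof (induction N arbitrary: s l rs)
  case 0
  show ?case by (rule computesI) (auto simp: prog_nth elim_all_body_def)
next
  case (Suc N)
  define rs' where "rs' = fold elim_coeff [s + l..<s + l + (E - l)] rs"
  have seg: "computes \<beta> RR 10 [enc_polys rs, unary (s + l), unary (E - l)] (enc_polys rs')
    ((E - l) * (K * (70 * L + 80) + 25) + 3)"
    unfolding rs'_def using Suc.prems by (intro computes_elim_seg) auto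
  have "length rs' \<le> K"
    using Suc.prems(2) length_fold_elim_le[of "[s + l..<s + l + (E - l)]" rs] by (simp add: rs'_def)
  then have IH: "computes \<beta> RR 11 [enc_polys rs', unary N, unary (s + E), unary (l - k), unary E, unary k]
    (enc_polys (fold elim_coeff (elim_pos N (s + E) (l - k) E k) rs'))
    (N * (L * (K * (70 * L + 80) + 25) + 60 * L + 60) + 3)"
    using Suc.prems by (intro Suc.IH) (auto simp: rs'_def plen_fold_elim)
  have "(E - l) * (K * (70 * L + 80) + 25) \<le> L * (K * (70 * L + 80) + 25)"
    using Suc.prems by (intro mult_right_mono) auto
  moreover have "s \<le> L" "l \<le> L" using Suc.prems by auto
  moreover note bounds = calculation Suc.prems(4,5)
  show ?case
    apply (intro computesI)
    apply (simp add: prog_nth elim_all_body_def del: upt_Suc)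
    apply (rule calleeI[OF computes_append_unary], rule calleeI[OF computes_drop_unary])
    apply (rule calleeI[OF seg])
    apply (rule calleeI[OF computes_append_unary], rule calleeI[OF computes_drop_unary])
    apply (rule calleeI[OF IH])
    apply (intro conjI, simp add: rs'_def, use bounds in linarith)
    done
qed

section \<open>Generating the rows\<close>

definition shifts :: "'a::field poly \<Rightarrow> nat \<Rightarrow> 'a poly list" where
  "shifts p c = map (\<lambda>l. monom 1 l * p) [0..<c]"

lemma length_shifts [simp]: "length (shifts p c) = c"
  by (simp add: shifts_def)

lemma shifts_Suc: "shifts p (Suc c) = p # shifts (pCons 0 p) c"
  unfolding shifts_def upt_conv_Cons[OF zero_less_Suc]
  by (simp add: map_Suc_upt[symmetric] monom_Suc del: upt_Suc)

lemma computes_shifts: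
  "computes \<beta> RR 16 [enc_poly p, unary c] (enc_polys (shifts p c)) (20 * c + 3)"
proof (induction c arbitrary: p)
  case 0
  show ?case by (rule computesI) (auto simp: prog_nth shifts_body_def shifts_def)
next
  case (Suc c)
  show ?case
    apply (intro computesI)
    apply (simp add: prog_nth shifts_body_def shifts_Suc)
    apply (rule calleeI[OF computes_pcons], rule calleeI[OF Suc.IH])
    apply simp
    done
qed

text \<open>Multiplication by \<open>monom 1 E\<close> stands for multiplication by x. Here
  \<open>a\<close> is the weight n (m - i) of p^(m - i), and \<open>e\<close> is what the weight n
  (d i + j) of f^i x^j leaves of E, so the shifts stop just below weighted degree E.\<close>

fun block_rows :: "nat \<Rightarrow> nat \<Rightarrow> nat \<Rightarrow> nat \<Rightarrow> 'a::field poly \<Rightarrow> nat \<Rightarrow> 'a poly list" where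
  "block_rows E n a 0 G e = []"
| "block_rows E n a (Suc j) G e = shifts G (e - a) @ block_rows E n a j (monom 1 E * G) (e - n)"

lemma length_block_rows_le: "length (block_rows E n a d G e) \<le> d * e"
proof (induction d arbitrary: G e)
  case (Suc d)
  have "d * (e - n) \<le> d * e" by (intro mult_left_mono) auto
  moreover have "length (block_rows E n a (Suc d) G e)
      = (e - a) + length (block_rows E n a d (monom 1 E * G) (e - n))" by (simp add: shifts_def)
  ultimately show ?case using Suc.IH[of "monom 1 E * G" "e - n"] unfolding mult_Suc by linarith
qed simp

lemma computes_block_rows:
  "computes \<beta> RR 17 [unary E, unary n, unary a, unary d, enc_poly G, unary e]
    (enc_polys (block_rows E n a d G e)) (d * (35 * e + 15 * a + 15 * n + 20 * E + 70) + 3)"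
proof (induction d arbitrary: G e)
  case 0
  show ?case by (rule computesI) (auto simp: prog_nth block_rows_body_def)
next
  case (Suc d)
  have "d * (35 * (e - n) + 15 * a + 15 * n + 20 * E + 70) \<le> d * (35 * e + 15 * a + 15 * n + 20 * E + 70)"
    by (intro mult_left_mono) auto
  note bounds = this
  show ?case
    apply (intro computesI)
    apply (simp add: prog_nth block_rows_body_def)
    apply (rule calleeI[OF computes_drop_unary], rule calleeI[OF computes_shifts])
    apply (rule calleeI[OF computes_shift], rule calleeI[OF computes_drop_unary])
    apply (rule calleeI[OF Suc.IH], rule calleeI[OF computes_append_polys])
    apply (intro conjI, simp, simp only: length_shifts, use bounds in linarith)
    done
qed

text \<open>\<open>F\<close> carries the power \<open>fh ^ i\<close>. Once i exceeds the initial
  \<open>m\<close>, truncated subtraction keeps the exponent of \<open>p\<close> at 0, and the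
  generators are plain powers of f times x^j.\<close>

fun all_rows :: "nat \<Rightarrow> nat \<Rightarrow> nat \<Rightarrow> 'a::field poly \<Rightarrow> 'a poly \<Rightarrow> nat \<Rightarrow> nat \<Rightarrow> 'a poly \<Rightarrow> nat \<Rightarrow> 'a poly list" where
  "all_rows E n d p fh m 0 F e = []"
| "all_rows E n d p fh m (Suc M) F e = block_rows E n (n * m) d (p ^ m * F) e @
     all_rows E n d p fh (m - 1) M (F * fh) (e - n * d)"

lemma computes_all_rows:
  assumes "plen F + M * plen fh \<le> L" "m * plen p + 1 \<le> L" "n * m \<le> L" "n * d \<le> L"
    "d \<le> L" "e \<le> L" "E \<le> L" "n \<le> L" "m \<le> L"
  shows "computes \<beta> RR 18 [unary E, unary n, unary d, enc_poly p, enc_poly fh, unary m, unary M, enc_poly F, unary e]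
    (enc_polys (all_rows E n d p fh m M F e)) (M * (500 * ((L + 1) * (L + 1))) + 3)"
  using assms
proof (induction M arbitrary: m F e)
  case 0
  show ?case by (rule computesI) (auto simp: prog_nth all_rows_body_def)
next
  case (Suc M)
  have pm: "(m - 1) * plen p \<le> m * plen p" "n * (m - 1) \<le> n * m"
    by (intro mult_right_mono mult_left_mono; simp)+
  have IH: "computes \<beta> RR 18 [unary E, unary n, unary d, enc_poly p, enc_poly fh, unary (m - 1), unary M,
      enc_poly (F * fh), unary (e - n * d)]
    (enc_polys (all_rows E n d p fh (m - 1) M (F * fh) (e - n * d))) (M * (500 * ((L + 1) * (L + 1))) + 3)"
  proof (rule Suc.IH)
    show "plen (F * fh) + M * plen fh \<le> L" using Suc.prems(1) plen_mult_le[of F fh] by simp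
  qed (use Suc.prems pm in \<open>linarith+\<close>)
  have lp: "plen (p ^ m) \<le> L" using plen_power_le[of p m] Suc.prems by linarith
  have F: "plen F \<le> L" and fh: "plen fh \<le> L" using Suc.prems(1) by auto
  have 1: "n * (15 * m + 20) \<le> 35 * L"
    using Suc.prems by (simp add: algebra_simps)
  have 2: "m * (plen p * (40 * L + 40) + 20) \<le> 40 * (L * L) + 60 * L"
  proof -
    have "(m * plen p) * (40 * L + 40) \<le> L * (40 * L + 40)"
      using Suc.prems(2) by (intro mult_right_mono) auto
    then show ?thesis using Suc.prems(9) by (simp add: algebra_simps)
  qed
  have 3: "plen (p ^ m) * (40 * plen F + 40) \<le> 40 * (L * L) + 40 * L"
    using mult_mono[of "plen (p ^ m)" L "40 * plen F + 40" "40 * L + 40"] lp F by (simp add: algebra_simps)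
  have 4: "d * (35 * e + 15 * (n * m) + 15 * n + 20 * E + 70) \<le> 85 * (L * L) + 70 * L"
    using mult_mono[of d L "35 * e + 15 * (n * m) + 15 * n + 20 * E + 70" "85 * L + 70"] Suc.prems
    by (simp add: algebra_simps)
  have 5: "length (block_rows E n (n * m) d (p ^ m * F) e) \<le> L * L"
    using length_block_rows_le[of E n "n * m" d "p ^ m * F" e] mult_mono[of d L e L] Suc.prems by linarith
  have 6: "plen F * (40 * plen fh + 40) \<le> 40 * (L * L) + 40 * L"
    using mult_mono[of "plen F" L "40 * plen fh + 40" "40 * L + 40"] F fh by (simp add: algebra_simps)
  have 7: "n * (15 * d + 20) \<le> 35 * L"
    using Suc.prems by (simp add: algebra_simps)
  have 8: "500 * ((L + 1) * (L + 1)) = 500 * (L * L) + 1000 * L + 500" by (simp add: algebra_simps)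
  note bounds = 1 2 3 4 5 6 7 8 Suc.prems(3,4)
  show ?case
  \<comment> \<open>The body branches on whether the unary \<open>m\<close> is empty, so symbolic
    evaluation needs its shape.\<close>
  proof (cases m)
    case 0
    show ?thesis
      apply (intro computesI)
      apply (simp only: prog_nth all_rows_body_def)
      apply (simp add: 0)
      apply (rule calleeI[OF computes_times[of _ _ _ 0, simplified]])
      apply (rule calleeI[OF computes_pow[OF Suc.prems(2), unfolded 0, simplified]])
      apply (rule calleeI[OF computes_mul[of _ _ 1, simplified]])
      apply (rule calleeI[OF computes_block_rows[of _ _ _ _ 0, simplified]])
      apply (rule calleeI[OF computes_mul], rule calleeI[OF computes_times], rule calleeI[OF computes_drop_unary])
      apply (rule calleeI[OF IH[unfolded 0, simplified]])
      apply (rule calleeI[OF computes_append_polys])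
      apply (intro conjI, simp add: 0, use bounds[unfolded 0] in \<open>simp\<close>)
      done
  next
    case (Suc m')
    have "n * (35 + 15 * m') \<le> 35 * L" using 1 Suc by (simp add: algebra_simps)
    note bounds' = this bounds[unfolded Suc mult_Suc_right]
    show ?thesis
      apply (intro computesI)
      apply (simp only: prog_nth all_rows_body_def)
      apply (simp add: Suc del: power_Suc)
      apply (rule calleeI[OF computes_times[of _ _ _ "Suc m'", simplified]])
      apply (rule calleeI[OF computes_pow[OF \<open>m * plen p + 1 \<le> L\<close>, unfolded Suc unary_simps]])
      apply (rule calleeI[OF computes_mul])
      apply (rule calleeI[OF computes_block_rows])
      apply (rule calleeI[OF computes_mul], rule calleeI[OF computes_times], rule calleeI[OF computes_drop_unary])
      apply (rule calleeI[OF IH[unfolded Suc, simplified]])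
      apply (rule calleeI[OF computes_append_polys])
      apply (intro conjI, simp add: Suc, use bounds' in linarith)
      done
  qed
qed

text \<open>Undoes the substitution x = z^E by cutting into N blocks of length E;
  \<open>unkron_kron\<close> states when this recovers the polynomial.\<close>

fun unkron :: "nat \<Rightarrow> nat \<Rightarrow> 'a::field poly \<Rightarrow> 'a poly poly" where
  "unkron 0 E p = 0"
| "unkron (Suc N) E p = pCons (poly_cutoff E p) (unkron N E (poly_shift E p))"

lemma computes_chunks:
  "computes \<beta> RR 19 [enc_poly p, unary N, unary E] (enc_polys (coeffs (unkron N E p))) (N * (40 * E + 60) + 3)"
proof (induction N arbitrary: p)
  case 0
  show ?case by (rule computesI) (auto simp: prog_nth chunks_body_def)
next
  case (Suc N)
  show ?case
    apply (intro computesI)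
    apply (simp add: prog_nth chunks_body_def del: coeffs_pCons_eq_cCons)
    apply (rule calleeI[OF computes_cutoff], rule calleeI[OF computes_drop_poly])
    apply (rule calleeI[OF Suc.IH], rule calleeI[OF computes_lcons])
    apply (simp del: coeffs_pCons_eq_cCons)
    done
qed

lemma unary_eq_vlist: "unary n = vlist us \<longleftrightarrow> us = replicate n VNil"
  by (auto simp: unary_def)

lemma computes_ceil:
  assumes "\<forall>j<\<kappa>. \<not> \<beta> ^ u * real n \<le> real (v + j * st)" "\<beta> ^ u * real n \<le> real (v + \<kappa> * st)"
  shows "computes \<beta> RR 21 [unary u, unary n, unary st, unary v] (unary \<kappa>)
    ((\<kappa> + 1) * (u + n + v + \<kappa> * st + 15 * st + 30))"
  using assms
proof (induction \<kappa> arbitrary: v)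
  case 0
  then show ?case
    by (intro computesI) (auto simp: prog_nth ceil_body_def unary_eq_vlist intro!: exI[of _ "replicate _ VNil"])
next
  case (Suc \<kappa>)
  have IH: "computes \<beta> RR 21 [unary u, unary n, unary st, unary (st + v)] (unary \<kappa>)
    ((\<kappa> + 1) * (u + n + (st + v) + \<kappa> * st + 15 * st + 30))"
  proof (rule Suc.IH)
    show "\<forall>j<\<kappa>. \<not> \<beta> ^ u * real n \<le> real (st + v + j * st)"
      using Suc.prems(1)[THEN spec, of "Suc _"] by (simp add: algebra_simps)
    show "\<beta> ^ u * real n \<le> real (st + v + \<kappa> * st)" using Suc.prems(2) by (simp add: algebra_simps)
  qed
  have "\<not> \<beta> ^ u * real n \<le> real v" using Suc.prems(1)[THEN spec, of 0] by simp
  then show ?case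
    apply (intro computesI)
    apply (simp add: prog_nth ceil_body_def unary_eq_vlist)
    apply (rule calleeI[OF computes_append_unary], rule calleeI[OF IH])
    apply (simp)
    done
qed

section \<open>Greatest common divisors and the final filter\<close>

definition cancel_lead :: "'a::field poly \<Rightarrow> 'a poly \<Rightarrow> 'a poly" where
  "cancel_lead p q = p - smult (lead_coeff p / lead_coeff q) (monom 1 (plen p - plen q) * q)"

lemma plen_cancel_lead:
  assumes "p \<noteq> 0" "q \<noteq> 0" "plen q \<le> plen p"
  shows "plen (cancel_lead p q) < plen p"
proof -
  let ?c = "lead_coeff p / lead_coeff q" and ?r = "monom 1 (plen p - plen q) * q"
  have d: "degree ?r = degree p"
    using assms by (simp add: degree_mult_eq degree_monom_eq length_coeffs_degree)
  have lc: "lead_coeff ?r = lead_coeff q" by (simp add: lead_coeff_mult degree_monom_eq del: degree_mult_eq)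
  have c: "coeff (cancel_lead p q) (degree p) = 0"
    using assms lc unfolding d by (simp add: cancel_lead_def)
  have "plen (cancel_lead p q) \<le> plen p"
    using plen_diff_smult_le[of p ?c ?r] assms by (simp add: cancel_lead_def plen_monom_mult)
  moreover have "plen (cancel_lead p q) \<noteq> plen p"
  proof
    assume *: "plen (cancel_lead p q) = plen p"
    then have "cancel_lead p q \<noteq> 0" using assms by auto
    moreover from this * assms have "degree (cancel_lead p q) = degree p" by (simp add: length_coeffs_degree)
    ultimately show False using c by (metis leading_coeff_0_iff)
  qed
  ultimately show ?thesis by simp
qed

lemma gcd_cancel_lead: "gcd (cancel_lead p q) q = gcd p q"
  for p q :: "'a::field_gcd poly"
proof -
  have "cancel_lead p q = p + (- (smult (lead_coeff p / lead_coeff q) (monom 1 (plen p - plen q)))) * q"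
    by (simp add: cancel_lead_def)
  then show ?thesis by (metis gcd_add_mult gcd.commute add.commute)
qed

lemma computes_cancel:
  assumes "p \<noteq> 0" "q \<noteq> 0" "plen q \<le> plen p"
  shows "computes \<beta> RR 23 [enc_poly p, enc_poly q] (enc_poly (cancel_lead p q)) (160 * plen p + 60)"
proof -
  have dr: "computes \<beta> RR 13 [enc_poly p, enc_poly q] (vlist (drop (plen q) (map Elem (coeffs p)))) (15 * plen q + 6)"
    using computes_drop[of \<beta> RR "map Elem (coeffs p)" "map Elem (coeffs q)"] by (simp add: enc_poly_def)
  have ln: "computes \<beta> RR 25 [vlist (drop (plen q) (map Elem (coeffs p)))] (unary (plen p - plen q)) (15 * plen p + 3)"
    by (rule computes_mono[OF computes_len[of \<beta> RR "drop (plen q) (map Elem (coeffs p))", simplified]]) simp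
  show ?thesis
    apply (intro computesI)
    apply (simp add: prog_nth cancel_body_def)
    apply (rule calleeI[OF computes_lead[OF assms(1)]], rule calleeI[OF computes_lead[OF assms(2)]])
    apply (simp add: assms)
    apply (rule calleeI[OF dr], rule calleeI[OF ln], rule calleeI[OF computes_shift], rule calleeI[OF computes_axpy])
    using assms
    apply (simp add: cancel_lead_def plen_monom_mult)
    done
qed

text \<open>Each cancellation shortens the longer argument and keeps the gcd, hence the induction on
  the sum of the lengths. The result is only an associate of \<open>gcd p q\<close>, since the
  program never normalizes.\<close>

lemma computes_gcd:
  fixes p q :: "'a::field_gcd poly"
  assumes "plen p \<le> L" "plen q \<le> L"
  shows "\<exists>h. normalize h = gcd p q \<and> computes \<beta> RR 24 [enc_poly p, enc_poly q] (enc_poly h)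
    ((plen p + plen q + 1) * (175 * L + 80))"
  using assms
proof (induction "plen p + plen q" arbitrary: p q rule: less_induct)
  case less
  show ?case
  proof (cases "p = 0 \<or> q = 0")
    case True
    have "computes \<beta> RR 24 [enc_poly p, enc_poly q] (enc_poly (if p = 0 then q else p)) 5"
    proof (cases p rule: poly_cases_pCons)
      case 0
      then show ?thesis by (intro computesI) (simp add: prog_nth gcd_body_def)
    next
      case (pCons a p')
      then have "p \<noteq> 0" "q = 0" using True by auto
      moreover from pCons have "enc_poly p = VCons (Elem a) (enc_poly p')" by (simp add: enc_poly_pCons)
      ultimately show ?thesis by (intro computesI) (simp add: prog_nth gcd_body_def)
    qed
    then have "computes \<beta> RR 24 [enc_poly p, enc_poly q] (enc_poly (if p = 0 then q else p))
        ((plen p + plen q + 1) * (175 * L + 80))"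
      by (rule computes_mono) simp
    moreover have "normalize (if p = 0 then q else p) = gcd p q" using True by auto
    ultimately show ?thesis by blast
  next
    case False
    then have nz: "p \<noteq> 0" "q \<noteq> 0" by auto
    then obtain a p' b q' where pq: "p = pCons a p'" "q = pCons b q'"
      and ab: "a \<noteq> 0 \<or> p' \<noteq> 0" "b \<noteq> 0 \<or> q' \<noteq> 0"
      by (metis enc_poly_nz_cases)
    note e = enc_poly_pCons[OF ab(1), folded pq(1)] enc_poly_pCons[OF ab(2), folded pq(2)]
    have dr: "computes \<beta> RR 13 [VCons (Elem a) (enc_poly p'), VCons (Elem b) (enc_poly q')]
        (vlist (drop (plen q) (map Elem (coeffs p)))) (15 * plen q + 6)"
      using computes_drop[of \<beta> RR "map Elem (coeffs p)" "map Elem (coeffs q)"]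
      unfolding e[symmetric] by (simp add: enc_poly_def)
    define p1 where "p1 = (if plen p \<le> plen q then cancel_lead q p else cancel_lead p q)"
    define q1 where "q1 = (if plen p \<le> plen q then p else q)"
    have sm: "plen p1 + plen q1 < plen p + plen q"
      using nz plen_cancel_lead[of p q] plen_cancel_lead[of q p] by (auto simp: p1_def q1_def)
    have le: "plen p1 \<le> L" "plen q1 \<le> L"
      using nz plen_cancel_lead[of p q] plen_cancel_lead[of q p] less.prems by (auto simp: p1_def q1_def)
    have g: "gcd p1 q1 = gcd p q" 
      using gcd_cancel_lead[of p q] gcd_cancel_lead[of q p] by (simp add: p1_def q1_def gcd.commute)
    from less.hyps[OF sm le] g obtain h where h: "normalize h = gcd p q"
      and c: "computes \<beta> RR 24 [enc_poly p1, enc_poly q1] (enc_poly h) ((plen p1 + plen q1 + 1) * (175 * L + 80))"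
      by auto
    have "(plen p1 + plen q1 + 1) * (175 * L + 80) \<le> (plen p + plen q) * (175 * L + 80)"
      using sm by (intro mult_right_mono) auto
    note bounds = this less.prems
    have "computes \<beta> RR 24 [enc_poly p, enc_poly q] (enc_poly h) ((plen p + plen q + 1) * (175 * L + 80))"
    proof (cases "plen p \<le> plen q")
      case True
      have d0: "drop (plen q) (map Elem (coeffs p)) = ([] :: 'a val list)" using True by simp
      note c' = c[unfolded p1_def q1_def if_P[OF True]]
      show ?thesis
        apply (intro computesI)
        apply (simp add: prog_nth gcd_body_def e distrib_right del: mult_Suc)
        apply (rule calleeI[OF dr])
        apply (simp only: d0)
        apply (simp add: distrib_right del: mult_Suc)
        apply (rule calleeI[OF computes_cancel[OF nz(2,1) True, unfolded e]])
        apply (rule calleeI[OF c'[unfolded e]])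
        apply (intro conjI, simp)
        using bounds
        apply (simp only: p1_def q1_def if_P[OF True] distrib_right distrib_left mult_Suc)
        done
    next
      case F: False
      obtain x xs where d0: "drop (plen q) (map Elem (coeffs p)) = (x # xs :: 'a val list)"
        using F by (cases "drop (plen q) (map Elem (coeffs p)) :: 'a val list") auto
      note c' = c[unfolded p1_def q1_def if_not_P[OF F]]
      have F': "plen q \<le> plen p" using F by simp
      show ?thesis
        apply (intro computesI)
        apply (simp add: prog_nth gcd_body_def e distrib_right del: mult_Suc)
        apply (rule calleeI[OF dr])
        apply (simp only: d0)
        apply (simp add: distrib_right del: mult_Suc)
        apply (rule calleeI[OF computes_cancel[OF nz F', unfolded e]])
        apply (rule calleeI[OF c'[unfolded e]])
        apply (intro conjI, simp)
        using bounds
        apply (simp only: p1_def q1_def if_not_P[OF F] distrib_right distrib_left mult_Suc)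
        done
    qed
    with h show ?thesis by blast
  qed
qed

definition test_cost :: "nat \<Rightarrow> nat" where
  "test_cost L = L * (L * (40 * L + 40) + 40 * L + 40) + (2 * L + 1) * (175 * L + 80) + 40 * L + 60"

definition admissible :: "real \<Rightarrow> 'a::field_gcd poly \<Rightarrow> 'a poly list \<Rightarrow> nat \<Rightarrow> nat \<Rightarrow> 'a poly \<Rightarrow> bool" where
  "admissible \<beta> p fs n \<kappa> w \<longleftrightarrow> plen w \<le> \<kappa> \<and> \<beta> * real n \<le> real (degree (gcd (horner fs w) p))"

lemma computes_test:
  fixes p :: "'a::field_gcd poly"
  assumes "p \<noteq> 0" "plen p \<le> L" "\<forall>c\<in>set fs. plen c \<le> A" "A + length fs * \<kappa> \<le> L"
    "length fs \<le> L" "\<kappa> \<le> L" "n \<le> L"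
  shows "computes \<beta> RR 26 [enc_poly w, enc_poly p, enc_polys fs, unary n, unary \<kappa>]
    (if admissible \<beta> p fs n \<kappa> w then VNil else VCons VNil VNil) (test_cost L)"
    (is "computes _ _ _ _ ?out _")
proof -
  define out where "out = ?out"
  have dr: "computes \<beta> RR 13 [enc_poly w, unary \<kappa>] (vlist (drop \<kappa> (map Elem (coeffs w)))) (15 * \<kappa> + 6)"
    using computes_drop[of \<beta> RR "map Elem (coeffs w)" "replicate \<kappa> VNil"] by (simp add: enc_poly_def unary_def)
  have "computes \<beta> RR 26 [enc_poly w, enc_poly p, enc_polys fs, unary n, unary \<kappa>] out (test_cost L)"
  proof (cases "plen w \<le> \<kappa>")
    case True
    have hL: "A + length fs * plen w \<le> L" using assms(4) True mult_le_mono2[OF True, of "length fs"] by linarith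
    then have "plen (horner fs w) \<le> L" using plen_horner_le[OF assms(3), of w] by linarith
    from computes_gcd[OF this assms(2)] obtain h where h: "normalize h = gcd (horner fs w) p"
      and c: "computes \<beta> RR 24 [enc_poly (horner fs w), enc_poly p] (enc_poly h)
        ((plen (horner fs w) + plen p + 1) * (175 * L + 80))" by blast
    \<comment> \<open>Nonzero because \<open>p\<close> is; otherwise \<open>ETail\<close> would have
      no value on its encoding.\<close>
    have "h \<noteq> 0" using h assms(1) by auto
    moreover obtain c0 cs where cs: "coeffs h = c0 # cs" using \<open>h \<noteq> 0\<close> by (cases "coeffs h") auto
    moreover have "degree h = degree (gcd (horner fs w) p)" 
    proof (rule antisym)
      have "h dvd gcd (horner fs w) p" "gcd (horner fs w) p dvd h" using h[symmetric] by simp_all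
      moreover have "gcd (horner fs w) p \<noteq> 0" using assms(1) by simp
      ultimately show "degree h \<le> degree (gcd (horner fs w) p)" "degree (gcd (horner fs w) p) \<le> degree h"
        using \<open>h \<noteq> 0\<close> by (auto intro: dvd_imp_degree_le)
    qed
    ultimately have len: "length cs = degree (gcd (horner fs w) p)" and eh: "enc_poly h = VCons (Elem c0) (vlist (map Elem cs))"
      using length_coeffs_degree[of h] by (auto simp: enc_poly_def)
    have "degree (gcd (horner fs w) p) \<le> degree p" using assms(1) by (simp add: dvd_imp_degree_le)
    then have b1: "length cs \<le> L" using len assms(1,2) by (simp add: length_coeffs_degree)
    have "(plen (horner fs w) + plen p + 1) * (175 * L + 80) \<le> (2 * L + 1) * (175 * L + 80)"
      using \<open>plen (horner fs w) \<le> L\<close> assms(2) by (intro mult_right_mono) auto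
    then have b2: "175 * L + 80 + (plen (horner fs w) + plen p) * (175 * L + 80) \<le> (2 * L + 1) * (175 * L + 80)"
      by simp
    have b3: "length fs * (plen w * (40 * L + 40) + 40 * L + 40) \<le> L * (L * (40 * L + 40) + 40 * L + 40)"
      using assms True by (intro mult_mono add_mono) auto
    have d0: "drop \<kappa> (map Elem (coeffs w)) = ([] :: 'a val list)" using True by simp
    have adm: "admissible \<beta> p fs n \<kappa> w \<longleftrightarrow> \<beta> * real n \<le> real (length cs)"
      using True len by (simp add: admissible_def)
    have us: "VCons VNil VNil = vlist us \<longleftrightarrow> us = [VNil]" for us :: "'a val list"
      by (metis vlist.simps vlist_inject)
    show ?thesis
      apply (intro computesI)
      apply (simp add: prog_nth test_body_def)
      apply (rule calleeI[OF dr])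
      apply (simp only: d0)
      apply simp
      apply (rule calleeI[OF computes_horner[OF assms(3) hL]])
      apply (rule calleeI[OF c])
      apply (simp add: eh unary_eq_vlist adm us out_def)
      using b1 b2 b3 assms(6,7)
      apply (simp only: test_cost_def)
      apply (intro conjI impI)
      apply (rule exI[of _ "map Elem cs"], simp (no_asm) only: length_map,
        intro conjI impI; (rule refl TrueI | assumption | linarith))
      apply (rule exI[of _ "map Elem cs"], simp (no_asm) only: length_map,
        intro conjI impI; (rule refl TrueI | assumption | linarith))
      done
  next
    case False
    obtain x xs where d0: "drop \<kappa> (map Elem (coeffs w)) = (x # xs :: 'a val list)"
      using False by (cases "drop \<kappa> (map Elem (coeffs w)) :: 'a val list") auto
    have adm: "\<not> admissible \<beta> p fs n \<kappa> w"
      using False by (simp add: admissible_def)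
    show ?thesis
      apply (intro computesI)
      apply (simp add: prog_nth test_body_def)
      apply (rule calleeI[OF dr])
      apply (simp only: d0)
      using assms(6) apply (simp add: adm out_def test_cost_def)
      done
  qed
  then show ?thesis by (simp add: out_def)
qed

lemma computes_filter:
  fixes p :: "'a::field_gcd poly"
  assumes "p \<noteq> 0" "plen p \<le> L" "\<forall>c\<in>set fs. plen c \<le> A" "A + length fs * \<kappa> \<le> L"
    "length fs \<le> L" "\<kappa> \<le> L" "n \<le> L"
  shows "computes \<beta> RR 27 [enc_polys ws, enc_poly p, enc_polys fs, unary n, unary \<kappa>]
    (enc_polys (filter (admissible \<beta> p fs n \<kappa>) ws)) (length ws * (test_cost L + 40) + 3)"
proof (induction ws)
  case Nil
  show ?case by (rule computesI) (auto simp: prog_nth filter_body_def)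
next
  case (Cons w ws)
  note t = computes_test[OF assms, of \<beta> RR w]
  show ?case
  proof (cases "admissible \<beta> p fs n \<kappa> w")
    case True
    then show ?thesis
      apply (intro computesI)
      apply (simp add: prog_nth filter_body_def)
      apply (rule calleeI[OF t[unfolded if_P[OF True]]])
      apply simp
      apply (rule calleeI[OF Cons.IH])
      apply simp
      done
  next
    case False
    then show ?thesis
      apply (intro computesI)
      apply (simp add: prog_nth filter_body_def)
      apply (rule calleeI[OF t[unfolded if_not_P[OF False]]])
      apply simp
      apply (rule calleeI[OF Cons.IH])
      apply simp
      done
  qed
qed

section \<open>The complete run\<close>

definition solve_cost :: "nat \<Rightarrow> nat" where
  "solve_cost L = 20 * L + L * (L * (40 * L + 40) + 40 * L + 40) + L * (500 * ((L + 1) * (L + 1))) +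
     L * (L * (L * (70 * L + 80) + 25) + 60 * L + 60) + L * (40 * L + 60) + L * (test_cost L + 40) + 100"

definition candidate_poly :: "nat \<Rightarrow> nat \<Rightarrow> nat \<Rightarrow> nat \<Rightarrow> nat \<Rightarrow> nat \<Rightarrow> nat \<Rightarrow> nat \<Rightarrow> 'a::field poly \<Rightarrow> 'a poly list \<Rightarrow> 'a poly poly" where
  "candidate_poly n d k m M N B E p fs = unkron N E (hd (fold elim_coeff (elim_pos N 0 B E k)
     (all_rows E n d p (horner fs (monom 1 E)) m M 1 E)))"

lemma enc_poly_1: "enc_poly 1 = VCons (Elem 1) VNil"
  by (simp add: one_pCons enc_poly_pCons)

text \<open>All sizes are bounded by one number \<open>L\<close>, which makes the cost a polynomial
  in a single variable. The root finder is consulted once, about \<open>Q\<close>, so its reported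
  time \<open>t\<close> enters as a summand.\<close>

lemma computes_main4:
  fixes p :: "'a::field_gcd poly" and fs :: "'a poly list" and n d k m M N B E :: nat
  defines "rs \<equiv> all_rows E n d p (horner fs (monom 1 E)) m M 1 E"
  defines "Q \<equiv> candidate_poly n d k m M N B E p fs"
  assumes p: "p \<noteq> 0" "plen p \<le> L" and fs: "\<forall>c\<in>set fs. plen c \<le> A" "A + length fs * Suc k \<le> L"
    "A + length fs * Suc E \<le> L" "length fs \<le> L"
    and sizes: "Suc k \<le> L" "n \<le> L" "d \<le> L" "E \<le> L" "m \<le> L" "M \<le> L" "N \<le> L"
    "1 + M * plen (horner fs (monom 1 E)) \<le> L" "m * plen p + 1 \<le> L" "n * m \<le> L" "n * d \<le> L"
    "N * E + B \<le> L" "length rs \<le> L" "\<forall>r\<in>set rs. plen r \<le> L"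
    and ne: "fold elim_coeff (elim_pos N 0 B E k) rs \<noteq> []" and Q: "Q \<noteq> 0"
    and RR: "\<forall>R\<in>RR. R Q = (ws, t)" and ws: "length ws \<le> L"
  shows "computes \<beta> RR 31 [enc_poly p, enc_polys fs, unary n, unary d, unary (Suc k), unary m, unary M,
      unary N, unary B, unary E]
    (enc_polys (filter (admissible \<beta> p fs n (Suc k)) ws)) (t + solve_cost L)"
proof -
  let ?fh = "horner fs (monom 1 E)"
  have sh: "computes \<beta> RR 4 [VCons (Elem 1) VNil, unary E] (enc_poly (monom 1 E)) (20 * E + 3)"
    using computes_shift[of \<beta> RR 1 E] by (simp add: enc_poly_1)
  have pl: "plen (monom (1::'a) E) = Suc E" by (simp add: length_coeffs_degree degree_monom_eq)
  have ho: "computes \<beta> RR 5 [enc_polys fs, enc_poly (monom 1 E)] (enc_poly ?fh)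
     (length fs * (plen (monom (1::'a) E) * (40 * L + 40) + 40 * L + 40) + 3)"
    using fs by (intro computes_horner) (auto simp: pl)
  have ar: "computes \<beta> RR 18 [unary E, unary n, unary d, enc_poly p, enc_poly ?fh, unary m, unary M,
      VCons (Elem 1) VNil, unary E] (enc_polys rs) (M * (500 * ((L + 1) * (L + 1))) + 3)"
    unfolding rs_def enc_poly_1[symmetric] using sizes by (intro computes_all_rows) auto
  have el: "computes \<beta> RR 11 [enc_polys rs, unary N, VNil, unary B, unary E, unary k]
    (enc_polys (fold elim_coeff (elim_pos N 0 B E k) rs))
    (N * (L * (L * (70 * L + 80) + 25) + 60 * L + 60) + 3)"
    using computes_elim_all[of rs L L 0 N E B k \<beta> RR] sizes by simp
  obtain r rs' where r: "fold elim_coeff (elim_pos N 0 B E k) rs = r # rs'"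
    using ne by (cases "fold elim_coeff (elim_pos N 0 B E k) rs") auto
  have ch: "computes \<beta> RR 19 [enc_poly r, unary N, unary E] (enc_polys (coeffs Q)) (N * (40 * E + 60) + 3)"
    using computes_chunks[of \<beta> RR r N E] r by (simp add: Q_def candidate_poly_def rs_def)
  note fi = computes_filter[OF p fs(1,2,4) sizes(1,2), of \<beta> RR ws, unfolded unary_simps]
  \<comment> \<open>The form in which symbolic evaluation leaves the \<open>ERoots\<close> goal,
    prepared with the witness \<open>Q\<close>.\<close>
  have roots: "\<exists>Q'. enc_polys (coeffs Q) = enc_polys (coeffs Q') \<and> Q' \<noteq> 0 \<and>
      (\<exists>rs t. (\<forall>R\<in>RR. R Q' = (rs, t)) \<and> \<Phi> rs t)" if "\<Phi> ws t" for \<Phi>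
    using Q RR that by blast
  have "length fs * (plen (monom (1::'a) E) * (40 * L + 40) + 40 * L + 40) \<le> L * (L * (40 * L + 40) + 40 * L + 40)"
  proof (cases fs)
    case (Cons a list)
    then show ?thesis using fs(3,4) by (intro mult_mono add_mono) (auto simp: pl)
  qed simp
  moreover have "M * (500 + (1000 * L + 500 * (L * L))) \<le> L * (500 * ((L + 1) * (L + 1)))"
    using sizes by (intro mult_mono) (auto simp: algebra_simps)
  moreover have "N * (L * (L * (70 * L + 80) + 25) + 60 * L + 60) \<le> L * (L * (L * (70 * L + 80) + 25) + 60 * L + 60)"
    using sizes by (intro mult_right_mono) auto
  moreover have "N * (40 * E + 60) \<le> L * (40 * L + 60)"
    using sizes by (intro mult_mono) auto
  moreover have "length ws * (test_cost L + 40) \<le> L * (test_cost L + 40)"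
    using ws by (intro mult_right_mono) auto
  moreover note bounds = calculation \<open>E \<le> L\<close>
  show ?thesis
    apply (intro computesI)
    apply (simp add: prog_nth main4_body_def)
    apply (rule calleeI[OF sh], rule calleeI[OF ho], rule calleeI[OF ar], rule calleeI[OF el])
    apply (simp only: r enc_polys_simps val.case)
    apply (simp del: enc_polys_inject)
    apply (rule calleeI[OF ch])
    apply (rule roots)
    apply (rule calleeI[OF fi])
    apply (rule conjI, simp)
    using bounds unfolding solve_cost_def 
    apply linarith
    done
qed

definition main_cost :: "nat \<Rightarrow> nat" where
  "main_cost L = solve_cost L + 2 * ((L + 1) * (32 * L + 46)) + 5 * (L * (15 * L + 20)) + 300 * L + 300"

text \<open>The conditions on \<open>g\<close> and \<open>k\<close> are those under which the two
  searches by \<open>ceil_body\<close> end with g and k + 1. The last stage is assumed here, so that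
  only parameter arithmetic remains.\<close>

lemma computes_main:
  fixes p :: "'a::field_gcd poly"
  assumes p: "plen p = Suc n" and fs: "length fs = Suc d" "d > 0"
  assumes g: "\<forall>j<g. \<not> \<beta> * real n \<le> real j" "\<beta> * real n \<le> real g"
    and k: "\<forall>j<Suc k. \<not> \<beta>\<^sup>2 * real n \<le> real (j * d)" "\<beta>\<^sup>2 * real n \<le> real (Suc k * d)"
  assumes m: "m = g * Suc n" and M: "M = n * Suc n" and N: "N = M * d" and B: "B = m * g" and E: "E = n * (N + m)"
  assumes L: "n < L" "d < L" "g \<le> L" "Suc k \<le> L" "Suc k * d \<le> L" "m \<le> L" "N \<le> L" "M \<le> L" "N + m \<le> L"
    and main4: "computes \<beta> RR 31 [enc_poly p, enc_polys fs, unary n, unary d, unary (Suc k), unary m, unary M,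
      unary N, unary B, unary E] out (t + solve_cost L)"
  shows "computes \<beta> RR 0 [enc_poly p, enc_polys fs] out (t + main_cost L)"
proof -
  have t3: "computes \<beta> RR 30 [enc_poly p, enc_polys fs, unary n, unary d, unary g, unary (Suc k), unary m, unary M]
      out (t + solve_cost L + 3 * (L * (15 * L + 20)) + 15 * L + 50)"
  proof -
    have "M * (15 * d + 20) \<le> L * (15 * L + 20)" "m * (15 * g + 20) \<le> L * (15 * L + 20)"
      "n * (15 * (N + m) + 20) \<le> L * (15 * L + 20)" using L by (intro mult_mono; simp)+
    note bounds = this L(7)
    show ?thesis
      apply (intro computesI)
      apply (simp add: prog_nth main3_body_def)
      apply (rule calleeI[OF computes_times])
      apply (simp add: N[symmetric])
      apply (rule calleeI[OF computes_times], rule calleeI[OF computes_append_unary], rule calleeI[OF computes_times])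
      apply (rule calleeI[OF main4[unfolded B E unary_simps]])
      apply (rule conjI, simp)
      using bounds
      apply linarith
      done
  qed
  have t2: "computes \<beta> RR 29 [enc_poly p, enc_polys fs, unary n, unary d, unary g, unary (Suc k)]
      out (t + solve_cost L + 5 * (L * (15 * L + 20)) + 15 * L + 90)"
  proof -
    have "g * (15 * Suc n + 20) \<le> L * (15 * L + 20)" "n * (15 * Suc n + 20) \<le> L * (15 * L + 20)"
      using L by (intro mult_mono; simp)+
    note bounds = this
    show ?thesis
      apply (intro computesI)
      apply (simp add: prog_nth main2_body_def)
      apply (rule calleeI[OF computes_times[of _ _ _ "Suc n", unfolded unary_simps]])
      apply (rule calleeI[OF computes_times[of _ _ _ "Suc n", unfolded unary_simps]])
      apply (rule calleeI[OF t3[unfolded m M unary_simps]])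
      apply (rule conjI, simp)
      using bounds
      apply linarith
      done
  qed
  have c1: "computes \<beta> RR 21 [VCons VNil VNil, unary n, VCons VNil VNil, VNil] (unary g)
      ((g + 1) * (1 + n + 0 + g * 1 + 15 * 1 + 30))"
    using computes_ceil[of g \<beta> 1 n 0 1 RR] g by simp
  have c2: "computes \<beta> RR 21 [VCons VNil (VCons VNil VNil), unary n, unary d, VNil] (VCons VNil (unary k))
      ((Suc k + 1) * (2 + n + 0 + Suc k * d + 15 * d + 30))"
    using computes_ceil[of "Suc k" \<beta> 2 n 0 d RR] k by (simp add: numeral_2_eq_2 del: mult_Suc)
  have t1: "computes \<beta> RR 28 [enc_poly p, enc_polys fs, unary n, unary d]
      out (t + solve_cost L + 2 * ((L + 1) * (32 * L + 46)) + 5 * (L * (15 * L + 20)) + 15 * L + 150)"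
  proof -
    have "(g + 1) * (1 + n + 0 + g * 1 + 15 * 1 + 30) \<le> (L + 1) * (32 * L + 46)"
      using L by (intro mult_mono) auto
    moreover have "(Suc k + 1) * (2 + n + 0 + Suc k * d + 15 * d + 30) \<le> (L + 1) * (32 * L + 46)"
    proof (intro mult_mono)
      show "2 + n + 0 + Suc k * d + 15 * d + 30 \<le> 32 * L + 46" using L by linarith
    qed (use L in auto)
    moreover have "(L + 1) * (32 * L + 46) = L * (32 * L + 46) + 32 * L + 46" by simp
    moreover note bounds = calculation
    show ?thesis
      apply (intro computesI)
      apply (simp add: prog_nth main1_body_def)
      apply (rule calleeI[OF c1], rule calleeI[OF c2])
      apply (rule calleeI[OF t2[unfolded unary_simps]])
      apply (rule conjI, simp)
      using bounds
      apply linarith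
      done
  qed
  obtain c0 cs where cs: "coeffs p = c0 # cs" "length cs = n" using p by (cases "coeffs p") auto
  have ep: "enc_poly p = VCons (Elem c0) (vlist (map Elem cs))" using cs by (simp add: enc_poly_def)
  \<comment> \<open>Since d > 0 there are at least two coefficients, and the branch for constant
    \<open>f\<close> is not taken.\<close>
  obtain f0 f1 fs' where f: "fs = f0 # f1 # fs'" "length fs' = d - 1"
    using fs by (metis length_Suc_conv gr0_implies_Suc diff_Suc_1)
  have ef: "VCons (enc_poly f1) (enc_polys fs') = vlist (map enc_poly (f1 # fs'))" by (simp add: enc_polys_def)
  have l1: "computes \<beta> RR 25 [vlist (map Elem cs)] (unary n) (15 * n + 3)"
    using computes_len[of \<beta> RR "map Elem cs"] cs by simp
  have l2: "computes \<beta> RR 25 [VCons (enc_poly f1) (enc_polys fs')] (unary d) (15 * d + 3)"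
    using computes_len[of \<beta> RR "map enc_poly (f1 # fs')"] f fs(2) unfolding ef by (simp del: unary_simps)
  show ?thesis
    apply (intro computesI)
    apply (simp add: prog_nth main_body_def ep f(1))
    apply (rule calleeI[OF l1], rule calleeI[OF l2], rule calleeI[OF t1[unfolded ep f(1) enc_polys_simps]])
    apply (rule conjI, simp)
    using L(1,2) unfolding main_cost_def
    apply linarith
    done
qed

lemma computes_main_const:
  "computes \<beta> RR 0 [v, enc_polys [c]] (enc_polys []) 10"
  by (rule computesI) (simp add: prog_nth main_body_def)

section \<open>Elimination\<close>

definition lincomb :: "'a::field list \<Rightarrow> 'a poly list \<Rightarrow> 'a poly" where
  "lincomb cs rs = sum_list (map2 smult cs rs)"

lemma lincomb_simps [simp]:
  "lincomb [] rs = 0" "lincomb cs [] = 0" "lincomb (c # cs) (r # rs) = smult c r + lincomb cs rs"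
  by (simp_all add: lincomb_def)

text \<open>The length condition matters because \<open>map2\<close> truncates silently. As a notion
  for lists it makes repeated rows dependent.\<close>

definition indep :: "'a::field poly list \<Rightarrow> bool" where
  "indep rs \<longleftrightarrow> (\<forall>cs. length cs = length rs \<longrightarrow> lincomb cs rs = 0 \<longrightarrow> (\<forall>c\<in>set cs. c = 0))"

lemma lincomb_reduce_rows:
  "length cs = length rs \<Longrightarrow> \<exists>a. lincomb cs (reduce_rows i r rs) = smult a r + lincomb cs rs"
proof (induction cs rs rule: list_induct2)
  case Nil
  show ?case by (rule exI[of _ 0]) simp
next
  case (Cons c cs s rs)
  then obtain a where "lincomb cs (reduce_rows i r rs) = smult a r + lincomb cs rs" by blast
  then have "lincomb (c # cs) (reduce_rows i r (s # rs))
      = smult (a - c * (coeff s i / coeff r i)) r + lincomb (c # cs) (s # rs)"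
    by (simp add: reduce_rows_def smult_diff_right smult_diff_left)
  then show ?case by blast
qed

text \<open>The list \<open>cs'\<close> is \<open>cs\<close> with one entry inserted at the pivot,
  collecting what the reductions subtracted. Hence \<open>cs'\<close> vanishes only if
  \<open>cs\<close> does, which transports independence.\<close>

lemma lincomb_elim_coeff:
  "length cs = length (elim_coeff i rs) \<Longrightarrow>
    \<exists>cs'. length cs' = length rs \<and> lincomb cs' rs = lincomb cs (elim_coeff i rs) \<and>
      ((\<forall>c\<in>set cs'. c = 0) \<longrightarrow> (\<forall>c\<in>set cs. c = 0))"
proof (induction rs arbitrary: cs)
  case (Cons r rs)
  show ?case
  proof (cases "coeff r i = 0")
    case True
    with Cons.prems obtain c cs1 where cs: "cs = c # cs1" "length cs1 = length (elim_coeff i rs)"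
      by (cases cs) auto
    from Cons.IH[OF cs(2)] obtain cs' where "length cs' = length rs"
      "lincomb cs' rs = lincomb cs1 (elim_coeff i rs)" "(\<forall>c\<in>set cs'. c = 0) \<longrightarrow> (\<forall>c\<in>set cs1. c = 0)"
      by blast
    with True cs show ?thesis by (intro exI[of _ "c # cs'"]) auto
  next
    case False
    with Cons.prems have l: "length cs = length rs" by (simp add: reduce_rows_def)
    from lincomb_reduce_rows[OF l, of i r] obtain a
      where "lincomb cs (reduce_rows i r rs) = smult a r + lincomb cs rs" by blast
    with False l show ?thesis by (intro exI[of _ "a # cs"]) auto
  qed
qed simp

lemma indep_elim_coeff: "indep rs \<Longrightarrow> indep (elim_coeff i rs)"
  unfolding indep_def using lincomb_elim_coeff by metis

lemma indep_nonzero: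
  assumes "indep (r # rs)" shows "r \<noteq> 0"
proof
  assume "r = 0"
  moreover have "lincomb (replicate (length rs) 0) rs = 0" by (induction rs) auto
  ultimately have "lincomb (1 # replicate (length rs) 0) (r # rs) = 0" by simp
  then show False using assms unfolding indep_def by (metis length_Cons length_replicate list.set_intros(1) zero_neq_one)
qed

text \<open>The row with the last nonzero coefficient outranks all earlier ones and determines the
  degree. The claim on the degree is what carries the induction.\<close>

lemma lincomb_degrees_increasing:
  "length cs = length rs \<Longrightarrow> sorted_wrt (\<lambda>r s. degree r < degree s) rs \<Longrightarrow> 0 \<notin> set rs \<Longrightarrow>
    (\<exists>c\<in>set cs. c \<noteq> 0) \<Longrightarrow>
    lincomb cs rs \<noteq> 0 \<and> (\<exists>r\<in>set rs. degree (lincomb cs rs) = degree r)"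
proof (induction cs rs rule: list_induct2)
  case (Cons c cs r rs)
  show ?case
  proof (cases "\<exists>c\<in>set cs. c \<noteq> 0")
    case True
    with Cons obtain s where s: "s \<in> set rs" "degree (lincomb cs rs) = degree s" and nz: "lincomb cs rs \<noteq> 0"
      by auto
    have "degree (smult c r) \<le> degree r" by (rule degree_smult_le)
    also have "\<dots> < degree s" using s Cons.prems by simp
    finally have "degree (smult c r + lincomb cs rs) = degree s"
      using degree_add_eq_right[of "smult c r" "lincomb cs rs"] s by simp
    moreover from this have "smult c r + lincomb cs rs \<noteq> 0"
      using \<open>degree r < degree s\<close> by (metis degree_0 not_less0)
    ultimately show ?thesis using s by auto
  next
    case False
    then have "c \<noteq> 0" using Cons.prems by auto
    moreover have "lincomb cs rs = 0"
      using Cons.hyps False by (induction cs rs rule: list_induct2) auto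
    ultimately show ?thesis using Cons.prems by auto
  qed
qed simp

lemma indep_if_degrees_increasing:
  "sorted_wrt (\<lambda>r s. degree r < degree s) rs \<Longrightarrow> 0 \<notin> set rs \<Longrightarrow> indep rs"
  unfolding indep_def using lincomb_degrees_increasing by blast

text \<open>The only property of a subspace that row operations rely on.\<close>

definition axpy_closed :: "'a::field poly set \<Rightarrow> bool" where
  "axpy_closed V \<longleftrightarrow> (\<forall>a\<in>V. \<forall>b\<in>V. \<forall>c. a - smult c b \<in> V)"

lemma elim_coeff_closed: "axpy_closed V \<Longrightarrow> set rs \<subseteq> V \<Longrightarrow> set (elim_coeff i rs) \<subseteq> V"
  by (induction rs) (auto simp: reduce_rows_def axpy_closed_def)

lemma fold_elim_closed: "axpy_closed V \<Longrightarrow> set rs \<subseteq> V \<Longrightarrow> set (fold elim_coeff is rs) \<subseteq> V"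
  by (induction "is" arbitrary: rs) (auto simp del: subsetI simp: elim_coeff_closed)

lemma elim_coeff_zero: "r \<in> set (elim_coeff i rs) \<Longrightarrow> coeff r i = 0"
  by (induction rs) (auto simp: reduce_rows_def split: if_splits)

lemma elim_coeff_id: "\<forall>r\<in>set rs. coeff r i = 0 \<Longrightarrow> elim_coeff i rs = rs"
  by (induction rs) auto

lemma length_elim_coeff_ge: "length rs \<le> Suc (length (elim_coeff i rs))"
  by (induction rs) (auto simp: reduce_rows_def)

text \<open>Once position \<open>i\<close> has been treated, all rows lie in the subspace where this
  coefficient is 0, and later row operations do not leave it.\<close>

lemma fold_elim_zero:
  "i \<in> set is \<Longrightarrow> r \<in> set (fold elim_coeff is rs) \<Longrightarrow> coeff r i = 0"
proof (induction "is" arbitrary: rs)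
  case (Cons j "is")
  show ?case
  proof (cases "i = j")
    case True
    have "axpy_closed {r. coeff r i = 0}" by (auto simp: axpy_closed_def)
    moreover have "set (elim_coeff j rs) \<subseteq> {r. coeff r i = 0}" using True elim_coeff_zero by auto
    ultimately show ?thesis using Cons.prems fold_elim_closed[of "{r. coeff r i = 0}"] by auto
  qed (use Cons in auto)
qed simp

lemma indep_fold_elim: "indep rs \<Longrightarrow> indep (fold elim_coeff is rs)"
  by (induction "is" arbitrary: rs) (auto simp: indep_elim_coeff)

text \<open>A step loses at most the pivot row, and loses nothing at a position where all of
  \<open>V\<close> vanishes, because the rows stay in \<open>V\<close>. The filter keeps positions
  outside the weighted region from being counted.\<close>

lemma length_fold_elim_ge:
  assumes "axpy_closed V" "set rs \<subseteq> V"
  shows "length rs \<le> length (fold elim_coeff is rs) + length (filter (\<lambda>i. \<exists>v\<in>V. coeff v i \<noteq> 0) is)"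
  using assms(2)
proof (induction "is" arbitrary: rs)
  case (Cons i "is")
  note IH = Cons.IH[OF elim_coeff_closed[OF assms(1) Cons.prems], of i]
  show ?case
  proof (cases "\<exists>v\<in>V. coeff v i \<noteq> 0")
    case True
    then show ?thesis using IH length_elim_coeff_ge[of rs i] by simp
  next
    case False
    then have "elim_coeff i rs = rs" using Cons.prems by (intro elim_coeff_id) auto
    then show ?thesis using IH False by simp
  qed
qed simp

section \<open>Kronecker substitution\<close>

lemma horner_eq_poly: "horner cs w = poly (Poly cs) w"
  by (induction cs) auto

text \<open>The coefficients in x have degree below E, so their images occupy disjoint intervals of
  length E.\<close>

lemma coeff_kron:
  fixes Q :: "'a::field poly poly"
  assumes "\<forall>J e. coeff (coeff Q J) e \<noteq> 0 \<longrightarrow> e < E" "e < E"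
  shows "coeff (poly Q (monom 1 E)) (J * E + e) = coeff (coeff Q J) e"
  using assms(1)
proof (induction Q arbitrary: J rule: pCons_induct)
  case (pCons a Q)
  have a: "\<forall>e. coeff a e \<noteq> 0 \<longrightarrow> e < E" using pCons.prems[THEN spec, of 0] by simp
  have Q: "\<forall>J e. coeff (coeff Q J) e \<noteq> 0 \<longrightarrow> e < E"
    using pCons.prems[THEN spec, of "Suc _"] by simp
  show ?case
  proof (cases J)
    case 0
    then show ?thesis using assms(2) by (simp add: coeff_monom_mult)
  next
    case (Suc J')
    have "coeff a (J * E + e) = 0" using a[THEN spec, of "J * E + e"] Suc by auto
    then show ?thesis using pCons.IH[OF Q, of J'] Suc by (simp add: coeff_monom_mult)
  qed
qed simp

lemma unkron_kron:
  fixes Q :: "'a::field poly poly"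
  assumes "\<forall>J e. coeff (coeff Q J) e \<noteq> 0 \<longrightarrow> J < N \<and> e < E"
  shows "unkron N E (poly Q (monom 1 E)) = Q"
  using assms
proof (induction N arbitrary: Q)
  case 0
  then have "Q = 0" by (intro poly_eqI) auto
  then show ?case by simp
next
  case (Suc N)
  obtain a Q' where Q: "Q = pCons a Q'" by (cases Q)
  have a: "coeff a e = 0" if "e \<ge> E" for e
    using Suc.prems[THEN spec, of 0, THEN spec, of e] that by (auto simp: Q)
  have Q': "\<forall>J e. coeff (coeff Q' J) e \<noteq> 0 \<longrightarrow> J < N \<and> e < E"
    using Suc.prems[THEN spec, of "Suc _"] by (simp add: Q)
  have "poly_cutoff E (poly Q (monom 1 E)) = a"
    using a by (intro poly_eqI) (auto simp: Q coeff_poly_cutoff coeff_monom_mult)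
  moreover have "poly_shift E (poly Q (monom 1 E)) = poly Q' (monom 1 E)"
    using a by (intro poly_eqI) (auto simp: Q coeff_poly_shift coeff_monom_mult)
  ultimately show ?case using Suc.IH[OF Q'] by (simp add: Q)
qed

lemma degree_kron:
  fixes Q :: "'a::field poly poly"
  assumes "\<forall>J. degree (coeff Q J) < E" "Q \<noteq> 0"
  shows "poly Q (monom 1 E) \<noteq> 0 \<and> degree (poly Q (monom 1 E)) = degree (lead_coeff Q) + degree Q * E"
  using assms
proof (induction Q rule: pCons_induct)
  case (pCons a Q)
  show ?case
  proof (cases "Q = 0")
    case False
    have Q: "\<forall>J. degree (coeff Q J) < E" using pCons.prems(1)[THEN spec, of "Suc _"] by simp
    have a: "degree a < E" using pCons.prems(1)[THEN spec, of 0] by simp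
    note IH = pCons.IH[OF Q False]
    then have d: "degree (monom 1 E * poly Q (monom 1 E)) = E + degree (lead_coeff Q) + degree Q * E"
      by (simp add: degree_mult_eq degree_monom_eq)
    then have "degree (a + monom 1 E * poly Q (monom 1 E)) = E + degree (lead_coeff Q) + degree Q * E"
      using a degree_add_eq_right[of a "monom 1 E * poly Q (monom 1 E)"] by simp
    moreover from this have "a + monom 1 E * poly Q (monom 1 E) \<noteq> 0" using a by (metis add_is_0 degree_0 not_less0)
    ultimately show ?thesis using False by simp
  qed (use pCons in auto)
qed simp

section \<open>Weighted degrees\<close>

text \<open>Weighted degree with weight 1 for z and n for x. Quantifying over nonzero coefficients
  lets the zero polynomial satisfy every bound.\<close>

definition wdeg_le :: "nat \<Rightarrow> nat \<Rightarrow> 'a::field poly poly \<Rightarrow> bool" where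
  "wdeg_le n D Q \<longleftrightarrow> (\<forall>J e. coeff (coeff Q J) e \<noteq> 0 \<longrightarrow> e + n * J \<le> D)"

lemma wdeg_le_mult:
  assumes "wdeg_le n D Q" "wdeg_le n D' Q'"
  shows "wdeg_le n (D + D') (Q * Q')"
  unfolding wdeg_le_def
proof (intro allI impI)
  fix J e assume "coeff (coeff (Q * Q') J) e \<noteq> 0"
  then have "(\<Sum>i\<le>J. coeff (coeff Q i * coeff Q' (J - i)) e) \<noteq> 0" by (simp add: coeff_mult coeff_sum)
  then obtain i where i: "i \<le> J" "coeff (coeff Q i * coeff Q' (J - i)) e \<noteq> 0"
    by (metis (no_types, lifting) atMost_iff sum.neutral)
  from i(2) have "(\<Sum>j\<le>e. coeff (coeff Q i) j * coeff (coeff Q' (J - i)) (e - j)) \<noteq> 0" by (simp add: coeff_mult)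
  then obtain j where j: "j \<le> e" "coeff (coeff Q i) j * coeff (coeff Q' (J - i)) (e - j) \<noteq> 0"
    by (metis (no_types, lifting) atMost_iff sum.neutral)
  then have "coeff (coeff Q i) j \<noteq> 0" "coeff (coeff Q' (J - i)) (e - j) \<noteq> 0" by auto
  then have "j + n * i \<le> D" "e - j + n * (J - i) \<le> D'"
    using assms unfolding wdeg_le_def by blast+
  moreover have "n * J = n * i + n * (J - i)" using i(1) by (simp flip: distrib_left)
  ultimately show "e + n * J \<le> D + D'" using j(1) by linarith
qed

lemma wdeg_le_1: "wdeg_le n 0 1"
  by (auto simp: wdeg_le_def coeff_1 split: if_splits)

lemma wdeg_le_power: "wdeg_le n D Q \<Longrightarrow> wdeg_le n (i * D) (Q ^ i)"
  by (induction i) (auto simp: wdeg_le_1 wdeg_le_mult)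

lemma wdeg_le_const: "wdeg_le n (degree c) [:c:]"
  by (auto simp: wdeg_le_def coeff_pCons le_degree split: nat.splits)

lemma wdeg_le_monom: "wdeg_le n (n * j) (monom 1 j)"
  by (auto simp: wdeg_le_def coeff_1 split: if_splits)

lemma degree_poly_less:
  fixes Q :: "'a::field poly poly"
  assumes "\<forall>J e. coeff (coeff Q J) e \<noteq> 0 \<longrightarrow> e + k * J < B" "degree w \<le> k" "0 < B"
  shows "degree (poly Q w) < B"
proof -
  have "degree (coeff Q J * w ^ J) \<le> B - 1" for J
  proof (cases "coeff Q J = 0")
    case False
    then have "degree (coeff Q J) + k * J < B" using assms(1) by (metis leading_coeff_0_iff)
    moreover have "degree (w ^ J) \<le> k * J" using degree_power_le[of w J] assms(2)
      by (meson le_trans mult_le_mono1)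
    ultimately show ?thesis using degree_mult_le[of "coeff Q J" "w ^ J"] by linarith
  qed simp
  then have "degree (poly Q w) \<le> B - 1"
    unfolding poly_altdef by (intro degree_sum_le) auto
  then show ?thesis using assms(3) by simp
qed

section \<open>The auxiliary polynomial\<close>

text \<open>The keys of block i lie in the interval from \<open>c i\<close> to
  \<open>c (Suc i)\<close>. It is used at two levels, for the index i of the rows and for j inside
  it.\<close>

lemma sorted_wrt_concat_upt:
  fixes key :: "'b \<Rightarrow> nat" and c :: "nat \<Rightarrow> nat"
  assumes "\<And>i. i < hi \<Longrightarrow> sorted_wrt (\<lambda>x y. key x < key y) (g i)"
    and "\<And>i x. i < hi \<Longrightarrow> x \<in> set (g i) \<Longrightarrow> c i \<le> key x \<and> key x < c (Suc i)"
    and "mono c"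
  shows "sorted_wrt (\<lambda>x y. key x < key y) (concat (map g [0..<hi]))"
  using assms(1,2)
proof (induction hi)
  case (Suc hi)
  have "key x < key y" if "i < hi" "x \<in> set (g i)" "y \<in> set (g hi)" for i x y
  proof -
    have "key x < c (Suc i)" using Suc.prems(2)[of i x] that by simp
    also have "\<dots> \<le> c hi" using that assms(3) by (simp add: monoD)
    also have "\<dots> \<le> key y" using Suc.prems(2)[of hi y] that by simp
    finally show ?thesis .
  qed
  then show ?case using Suc by (auto simp: sorted_wrt_append)
qed simp

lemma block_rows_eq:
  "block_rows E n a d G e = concat (map (\<lambda>j. shifts (monom 1 (E * j) * G) (e - n * j - a)) [0..<d])"
proof (induction d arbitrary: G e)
  case (Suc d)
  have "concat (map (\<lambda>j. shifts (monom 1 (E * j) * G) (e - n * j - a)) [0..<Suc d])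
    = shifts G (e - a) @ concat (map (\<lambda>j. shifts (monom 1 (E * Suc j) * G) (e - n * Suc j - a)) [0..<d])"
    by (simp add: upt_conv_Cons map_Suc_upt[symmetric] comp_def del: upt_Suc)
  also have "(\<lambda>j. shifts (monom 1 (E * Suc j) * G) (e - n * Suc j - a))
     = (\<lambda>j. shifts (monom 1 (E * j) * (monom 1 E * G)) (e - n - n * j - a))"
    by (auto simp: fun_eq_iff mult.assoc[symmetric] mult_monom add.commute)
  finally show ?case by (simp add: Suc.IH)
qed simp

text \<open>An arbitrary start \<open>i\<close> is needed for the induction. Iterated truncated
  subtraction equals one truncated subtraction of the sum, so no size conditions arise.\<close>

lemma all_rows_eq:
  "all_rows E n d p fh (m - i) M (fh ^ i) (E' - n * d * i) =
    concat (map (\<lambda>i. block_rows E n (n * (m - i)) d (p ^ (m - i) * fh ^ i) (E' - n * d * i)) [i..<i + M])"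
proof (induction M arbitrary: i)
  case (Suc M)
  have "[i..<i + Suc M] = i # [Suc i..<Suc i + M]" by (simp add: upt_conv_Cons del: upt_Suc)
  moreover have "fh ^ i * fh = fh ^ Suc i" by simp
  moreover have "E' - n * d * i - n * d = E' - n * d * Suc i" by simp
  moreover have "m - i - 1 = m - Suc i" by simp
  ultimately show ?case using Suc.IH[of "Suc i"] by (simp only: all_rows.simps list.map concat.simps)
qed simp

lemma elim_pos_eq:
  "elim_pos N s l E k =
    concat (map (\<lambda>J. [s + J * E + (l - k * J)..<s + J * E + (l - k * J) + (E - (l - k * J))]) [0..<N])"
proof (induction N arbitrary: s l)
  case (Suc N)
  have "concat (map (\<lambda>J. [s + J * E + (l - k * J)..<s + J * E + (l - k * J) + (E - (l - k * J))]) [0..<Suc N])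
     = [s + l..<s + l + (E - l)] @ concat (map (\<lambda>J. [s + Suc J * E + (l - k * Suc J)..<s + Suc J * E + (l - k * Suc J) + (E - (l - k * Suc J))]) [0..<N])"
    by (simp add: upt_conv_Cons map_Suc_upt[symmetric] comp_def del: upt_Suc mult_Suc mult_Suc_right)
  also have "(\<lambda>J. [s + Suc J * E + (l - k * Suc J)..<s + Suc J * E + (l - k * Suc J) + (E - (l - k * Suc J))])
     = (\<lambda>J. [s + E + J * E + (l - k - k * J)..<s + E + J * E + (l - k - k * J) + (E - (l - k - k * J))])"
    by (auto simp: fun_eq_iff add.assoc)
  finally show ?case by (simp add: Suc.IH del: upt_Suc)
qed simp

lemma length_filter_upt_le:
  assumes "\<And>x. x \<in> {a..<b} \<Longrightarrow> P x \<Longrightarrow> x < c"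
  shows "length (filter P [a..<b]) \<le> c - a"
proof -
  have "length (filter P [a..<b]) = card (set (filter P [a..<b]))"
    by (rule distinct_card[symmetric]) simp
  also have "\<dots> \<le> card {a..<c}" using assms by (intro card_mono) auto
  finally show ?thesis by simp
qed

lemma length_filter_concat: "length (filter P (concat xss)) = (\<Sum>xs\<leftarrow>xss. length (filter P xs))"
  by (induction xss) auto

lemma sum_diff_upto: "m \<le> M \<Longrightarrow> 2 * (\<Sum>i<M. m - i) = m * (m + 1)" for m M :: nat
proof -
  assume "m \<le> M"
  have "(\<Sum>i<M. m - i) = (\<Sum>i<m. m - i)"
    using \<open>m \<le> M\<close> by (intro sum.mono_neutral_right) auto
  moreover have "2 * (\<Sum>i<m. m - i) = m * (m + 1)"
  proof (induction m)
    case (Suc m)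
    have "(\<Sum>i<Suc m. Suc m - i) = Suc m + (\<Sum>i<m. m - i)"
      by (subst sum.lessThan_Suc_shift) simp
    then show ?case using Suc by simp
  qed simp
  ultimately show ?thesis by simp
qed

text \<open>The parameter \<beta> survives only in \<open>g\<close> and \<open>k\<close>, through
  \<open>kdn\<close>. The bound \<open>coeff_f\<close> is what reduction modulo \<open>p\<close>
  provides.\<close>

locale congruence_problem =
  fixes p :: "'a::field_gcd poly" and f :: "'a poly poly" and n d g k :: nat
  assumes degree_p: "degree p = n" and n_pos: "n > 0"
    and monic: "lead_coeff f = 1" and degree_f: "degree f = d" and d_pos: "d > 0"
    and coeff_f: "\<And>J. degree (coeff f J) < n"
    and g: "0 < g" "g \<le> n" and kdn: "k * d * n < g\<^sup>2"
begin

text \<open>The ratio n : g of \<open>M\<close> to \<open>m\<close> is about 1 / \<beta>; it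
  maximizes N B - k N^2 / 2 for given m in the limiting case k d n = g^2. The factor n + 1 exceeds
  g, which absorbs the lower order term in \<open>weight_count\<close>.\<close>

definition m :: nat where "m = g * Suc n"
definition M :: nat where "M = n * Suc n"
definition N :: nat where "N = M * d"
definition B :: nat where "B = m * g"
text \<open>For J < N this leaves E - n J at least n m, hence at least B and at least n (m -
  i).\<close>

definition E :: nat where "E = n * (N + m)"

abbreviation "fh \<equiv> poly f (monom 1 E)"

definition rows :: "'a poly list" where "rows = all_rows E n d p fh m M 1 E"

definition reduced :: "'a poly list" where "reduced = fold elim_coeff (elim_pos N 0 B E k) rows"

text \<open>Defined by the divisibility that the roots require and not as a span, so that closure
  under row operations is immediate. The bounds on J and e + n J describe the finite region in which
  elimination takes place.\<close>

definition lattice :: "'a poly poly set" where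
  "lattice = {Q. (\<forall>J e. coeff (coeff Q J) e \<noteq> 0 \<longrightarrow> J < N \<and> e + n * J < E) \<and>
     (\<forall>w h. h dvd poly f w \<longrightarrow> h dvd p \<longrightarrow> h ^ m dvd poly Q w)}"

lemma m_pos: "m > 0" and M_pos: "M > 0" and N_pos: "N > 0" and B_pos: "B > 0"
  using g n_pos d_pos by (auto simp: m_def M_def N_def B_def)

lemma m_le_M: "m \<le> M"
  using g unfolding m_def M_def by (intro mult_right_mono) auto

lemma n_le_E: "n \<le> E"
  using m_pos by (simp add: E_def)

lemma p_nz: "p \<noteq> 0" using degree_p n_pos by auto

lemma f_nz: "f \<noteq> 0" using monic by auto

lemma coeff_less_E: "Q \<in> lattice \<Longrightarrow> \<forall>J e. coeff (coeff Q J) e \<noteq> 0 \<longrightarrow> e < E"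
  unfolding lattice_def by fastforce

lemma lattice_axpy:
  assumes "Q \<in> lattice" "Q' \<in> lattice" shows "Q - smult [:c:] Q' \<in> lattice"
  unfolding lattice_def mem_Collect_eq
proof (intro conjI allI impI)
  fix J e assume "coeff (coeff (Q - smult [:c:] Q') J) e \<noteq> 0"
  then have "coeff (coeff Q J) e \<noteq> 0 \<or> coeff (coeff Q' J) e \<noteq> 0" by auto
  then show "J < N" "e + n * J < E" using assms unfolding lattice_def by blast+
next
  fix w h assume "h dvd poly f w" "h dvd p"
  then show "h ^ m dvd poly (Q - smult [:c:] Q') w"
    using assms unfolding lattice_def by (auto intro!: dvd_diff dvd_smult)
qed

lemma axpy_closed_lattice: "axpy_closed ((\<lambda>Q. poly Q (monom 1 E)) ` lattice)"
  unfolding axpy_closed_def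
proof (intro ballI allI)
  fix a b c assume "a \<in> (\<lambda>Q. poly Q (monom 1 E)) ` lattice" "b \<in> (\<lambda>Q. poly Q (monom 1 E)) ` lattice"
  then obtain Q Q' where "Q \<in> lattice" "a = poly Q (monom 1 E)" "Q' \<in> lattice" "b = poly Q' (monom 1 E)" by auto
  then show "a - smult c b \<in> (\<lambda>Q. poly Q (monom 1 E)) ` lattice"
    by (intro image_eqI[of _ _ "Q - smult [:c:] Q'"] lattice_axpy) auto
qed

text \<open>The leading term x^d has weight exactly n d. Every other term has J < d and e < n, hence
  weight below n d; this is where reduced coefficients and monicity enter.\<close>

lemma wdeg_f: "wdeg_le n (n * d) f"
  unfolding wdeg_le_def
proof (intro allI impI)
  fix J e assume nz: "coeff (coeff f J) e \<noteq> 0"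
  then have "coeff f J \<noteq> 0" by auto
  then have "J \<le> d" using degree_f le_degree by blast
  show "e + n * J \<le> n * d"
  proof (cases "J = d")
    case True
    with nz monic degree_f show ?thesis by (auto simp: coeff_1 split: if_splits)
  next
    case False
    have "e < n" using nz coeff_f[of J] le_degree[of "coeff f J" e] by linarith
    moreover have "n * Suc J \<le> n * d" using False \<open>J \<le> d\<close> by (intro mult_left_mono) auto
    ultimately show ?thesis by simp
  qed
qed

lemma degree_fh: "fh \<noteq> 0" "degree fh = d * E"
  using degree_kron[of f E] coeff_f n_le_E f_nz monic degree_f
  by (auto intro: less_le_trans)

definition basis_row :: "nat \<Rightarrow> nat \<Rightarrow> nat \<Rightarrow> 'a poly" where
  "basis_row i j l = monom 1 l * (monom 1 (E * j) * (p ^ (m - i) * fh ^ i))"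

lemma basis_row_nz: "basis_row i j l \<noteq> 0"
  using degree_fh p_nz by (simp add: basis_row_def)

lemma degree_basis_row: "degree (basis_row i j l) = l + E * j + n * (m - i) + i * (d * E)"
  using degree_fh p_nz by (simp add: basis_row_def degree_mult_eq degree_monom_eq degree_power_eq degree_p)

lemma rows_eq:
  "rows = concat (map (\<lambda>i. concat (map (\<lambda>j. map (basis_row i j) [0..<E - n * d * i - n * j - n * (m - i)]) [0..<d])) [0..<M])"
  using all_rows_eq[of E n d p fh m 0 M E]
  by (simp add: rows_def block_rows_eq shifts_def basis_row_def[abs_def])

lemma set_rows:
  "set rows = (\<Union>i<M. \<Union>j<d. basis_row i j ` {..<E - n * d * i - n * j - n * (m - i)})"
  unfolding rows_eq by (simp add: lessThan_atLeast0 del: diff_diff_left)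

lemma index_less: "i < M \<Longrightarrow> j < d \<Longrightarrow> i * d + j < N"
proof -
  assume "i < M" "j < d"
  then have "i * d + j < Suc i * d" by simp
  also have "\<dots> \<le> M * d" using \<open>i < M\<close> by (intro mult_right_mono) auto
  finally show ?thesis by (simp add: N_def)
qed

lemma basis_row_in_lattice:
  assumes "i < M" "j < d" "l < E - n * d * i - n * j - n * (m - i)"
  shows "basis_row i j l \<in> (\<lambda>Q. poly Q (monom 1 E)) ` lattice"
proof -
  \<comment> \<open>The row before the Kronecker substitution: z^l p^(m - i) f^i x^j.\<close>
  let ?Q = "[:monom 1 l * p ^ (m - i):] * (f ^ i * monom 1 j)"
  have "poly ?Q (monom 1 E) = basis_row i j l"
    by (simp add: basis_row_def poly_monom monom_power mult_ac)
  moreover have "?Q \<in> lattice"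
    unfolding lattice_def mem_Collect_eq
  proof (intro conjI allI impI)
    fix J e assume nz: "coeff (coeff ?Q J) e \<noteq> 0"
    have "wdeg_le n (degree (monom 1 l * p ^ (m - i)) + (i * (n * d) + n * j)) ?Q"
      by (intro wdeg_le_mult wdeg_le_const wdeg_le_power wdeg_f wdeg_le_monom)
    then have "e + n * J \<le> degree (monom 1 l * p ^ (m - i)) + (i * (n * d) + n * j)"
      using nz unfolding wdeg_le_def by blast
    also have "degree (monom 1 l * p ^ (m - i)) = l + n * (m - i)"
      using p_nz by (simp add: degree_mult_eq degree_monom_eq degree_power_eq degree_p)
    finally show "e + n * J < E" using assms(3) by (simp add: mult_ac)
    have "J \<le> degree ?Q" using nz by (intro le_degree) (metis coeff_0)
    also have "degree ?Q \<le> degree [:monom 1 l * p ^ (m - i):] + (degree (f ^ i) + degree (monom (1::'a poly) j))"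
      by (intro order.trans[OF degree_mult_le] add_left_mono degree_mult_le)
    also have "\<dots> \<le> i * d + j"
      using degree_power_le[of f i] degree_monom_le[of "1::'a poly" j] by (simp add: degree_f mult_ac)
    also have "\<dots> < N" using index_less assms by simp
    finally show "J < N" .
  next
    fix w h assume h: "h dvd poly f w" "h dvd p"
    have "h ^ (m - i) * h ^ i dvd p ^ (m - i) * poly f w ^ i"
      using h by (intro mult_dvd_mono dvd_power_same)
    \<comment> \<open>Equality if i is at most m; for larger i the truncated exponent is 0 and h^i
      is a higher power than required.\<close>
    moreover have "h ^ m dvd h ^ (m - i) * h ^ i"
      by (simp flip: power_add add: le_imp_power_dvd)
    ultimately have "h ^ m dvd p ^ (m - i) * poly f w ^ i" by (rule dvd_trans[rotated])
    then show "h ^ m dvd poly ?Q w"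
      by (auto simp: poly_monom mult.assoc mult.left_commute[of _ "monom 1 l"] intro!: dvd_mult[of _ _ "monom 1 l"]
          dvd_mult2[of _ "p ^ (m - i) * poly f w ^ i", unfolded mult.assoc])
  qed
  ultimately show ?thesis by (metis image_eqI)
qed

lemma rows_in_lattice: "set rows \<subseteq> (\<lambda>Q. poly Q (monom 1 E)) ` lattice"
  unfolding set_rows by (auto simp del: image_iff diff_diff_left intro!: basis_row_in_lattice)

text \<open>Since l + n (m - i) < E, the degrees of the rows for (i, j) lie in the interval of
  length E starting at (i d + j) E, and inside it they increase with l.\<close>

lemma indep_rows: "indep rows"
proof (rule indep_if_degrees_increasing)
  show "0 \<notin> set rows" using basis_row_nz unfolding set_rows by (auto dest!: sym[of 0])
  show "sorted_wrt (\<lambda>r s. degree r < degree s) rows"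
    unfolding rows_eq
  proof (rule sorted_wrt_concat_upt[where c = "\<lambda>i. i * (d * E)"])
    fix i
    show "sorted_wrt (\<lambda>r s. degree r < degree s)
      (concat (map (\<lambda>j. map (basis_row i j) [0..<E - n * d * i - n * j - n * (m - i)]) [0..<d]))"
    proof (rule sorted_wrt_concat_upt[where c = "\<lambda>j. i * (d * E) + j * E"])
      show "sorted_wrt (\<lambda>r s. degree r < degree s) (map (basis_row i j) [0..<E - n * d * i - n * j - n * (m - i)])" for j
        by (simp add: sorted_wrt_map degree_basis_row)
      show "i * (d * E) + j * E \<le> degree x \<and> degree x < i * (d * E) + Suc j * E"
        if "x \<in> set (map (basis_row i j) [0..<E - n * d * i - n * j - n * (m - i)])" for j x
        using that by (auto simp: degree_basis_row)
      show "mono (\<lambda>j. i * (d * E) + j * E)" by (auto intro: monoI)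
    qed
    show "i * (d * E) \<le> degree x \<and> degree x < Suc i * (d * E)"
      if "x \<in> set (concat (map (\<lambda>j. map (basis_row i j) [0..<E - n * d * i - n * j - n * (m - i)]) [0..<d]))" for x
    proof -
      from that obtain j l where jl: "j < d" "l < E - n * d * i - n * j - n * (m - i)" "x = basis_row i j l" by auto
      then have "l + E * j + n * (m - i) < E * Suc j" by simp
      also have "\<dots> \<le> E * d" using jl by (intro mult_left_mono) auto
      finally show ?thesis using jl by (simp add: degree_basis_row mult_ac distrib_left)
    qed
    show "mono (\<lambda>i. i * (d * E))" by (auto intro: monoI)
  qed
qed

section \<open>Counting rows against eliminated coefficients\<close>

lemma length_rows: "length rows = (\<Sum>i<M. \<Sum>j<d. E - n * d * i - n * j - n * (m - i))"
  unfolding rows_eq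
  by (simp add: length_concat comp_def interv_sum_list_conv_sum_set_nat atLeast0LessThan del: diff_diff_left)

lemma kN_less_B: "k * N < B"
proof -
  have "k * N = (k * d * n) * Suc n" by (simp add: N_def M_def algebra_simps)
  also have "\<dots> < g\<^sup>2 * Suc n" using kdn by (intro mult_strict_right_mono) auto
  also have "\<dots> = B" by (simp add: B_def m_def power2_eq_square algebra_simps)
  finally show ?thesis .
qed

lemma kJ_less_B: "J < N \<Longrightarrow> k * J < B"
  using kN_less_B by (meson le_less_trans less_imp_le mult_le_mono2)

lemma B_le: "B \<le> n * m"
  using g by (simp add: B_def)

lemma E_ge: "J < N \<Longrightarrow> n * J + n * m \<le> E"
  by (simp add: E_def flip: distrib_left)

text \<open>After doubling, bounding the sum of all J < N by N^2 / 2 and cancelling n d u, the claim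
  becomes g (g u + 1) + k d n u < 2 g^2 u.\<close>

lemma weight_count: "n * d * (\<Sum>i<M. m - i) < (\<Sum>J<N. B - k * J)"
proof -
  have "(\<Sum>J<N. B - k * J) + (\<Sum>J<N. k * J) = (\<Sum>J<N. B)"
    unfolding sum.distrib[symmetric] using kJ_less_B by (intro sum.cong) (auto simp: less_imp_le)
  then have 1: "(\<Sum>J<N. B - k * J) + k * (\<Sum>J<N. J) = N * B" by (simp add: sum_distrib_left)
  have 2: "2 * (\<Sum>J<x. J) \<le> x * x" for x :: nat
    by (induction x) auto
  have 3: "2 * (k * (\<Sum>J<N. J)) \<le> k * (N * N)" using mult_left_mono[OF 2[of N], of k] by simp
  have 4: "2 * (n * d * (\<Sum>i<M. m - i)) = n * d * (m * (m + 1))"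
    using sum_diff_upto[OF m_le_M] by (metis mult.left_commute)
  define u where "u = Suc n"
  \<comment> \<open>Integrality gives k d n + 1 at most g^2. Multiplied by u this leaves room for u,
    and u = n + 1 > g.\<close>
  have "g + k * d * n * u < g\<^sup>2 * u"
  proof -
    have "Suc (k * d * n) * u \<le> g\<^sup>2 * u" using kdn by (intro mult_right_mono) auto
    moreover have "g < u" using g by (simp add: u_def)
    ultimately show ?thesis by simp
  qed
  then have "(n * d * u) * (g * (g * u + 1) + k * (d * n * u)) < (n * d * u) * (2 * (g\<^sup>2 * u))"
    using n_pos d_pos by (intro mult_strict_left_mono) (auto simp: u_def power2_eq_square algebra_simps)
  moreover have "(n * d * u) * (g * (g * u + 1) + k * (d * n * u)) = n * d * (m * (m + 1)) + k * (N * N)"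
    by (simp add: m_def N_def M_def u_def[symmetric] algebra_simps)
  moreover have "(n * d * u) * (2 * (g\<^sup>2 * u)) = 2 * (N * B)"
    by (simp add: B_def m_def N_def M_def u_def[symmetric] power2_eq_square algebra_simps)
  ultimately have "n * d * (m * (m + 1)) + k * (N * N) < 2 * (N * B)" by simp
  with 1 3 4 show ?thesis by linarith
qed

text \<open>Grouping J as i d + j matches column J of the region with one block of rows, which is
  shorter by n (m - i). The total deficit is less than the number of coefficients allowed to
  survive, by \<open>weight_count\<close>.\<close>

lemma count_less: "(\<Sum>J<N. (E - n * J) - (B - k * J)) < length rows"
proof -
  have "(\<Sum>J<N. E - n * J) = (\<Sum>i<M. \<Sum>J=i * d..<i * d + d. E - n * J)"
    unfolding N_def by (rule sum.nat_group[symmetric])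
  also have "\<dots> = (\<Sum>i<M. \<Sum>j<d. E - n * (i * d + j))"
  proof (rule sum.cong[OF refl])
    fix i
    show "(\<Sum>J=i * d..<i * d + d. E - n * J) = (\<Sum>j<d. E - n * (i * d + j))"
      using sum.shift_bounds_nat_ivl[of "\<lambda>J. E - n * J" 0 "i * d" d]
      by (simp add: atLeast0LessThan add.commute)
  qed
  also have "\<dots> = (\<Sum>i<M. \<Sum>j<d. (E - n * d * i - n * j - n * (m - i)) + n * (m - i))"
  proof (intro sum.cong refl)
    fix i j assume "i \<in> {..<M}" "j \<in> {..<d}"
    then have "n * (i * d + j) + n * m \<le> E" using index_less E_ge by simp
    moreover have "n * (m - i) \<le> n * m" by (intro mult_left_mono) auto
    ultimately have "n * (m - i) + n * (i * d + j) \<le> E" by linarith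
    then have "n * (m - i) \<le> E - n * (i * d + j)" by (rule add_le_imp_le_diff)
    moreover have "E - n * (i * d + j) = E - n * d * i - n * j" by (simp add: algebra_simps)
    ultimately show "E - n * (i * d + j) = (E - n * d * i - n * j - n * (m - i)) + n * (m - i)"
      by (metis le_add_diff_inverse2)
  qed
  also have "\<dots> = length rows + n * d * (\<Sum>i<M. m - i)"
    by (simp add: length_rows sum.distrib sum_distrib_left mult_ac del: diff_diff_left)
  finally have "(\<Sum>J<N. E - n * J) = length rows + n * d * (\<Sum>i<M. m - i)" .
  moreover have "(\<Sum>J<N. E - n * J) = (\<Sum>J<N. (E - n * J) - (B - k * J)) + (\<Sum>J<N. B - k * J)"
    unfolding sum.distrib[symmetric]
  proof (intro sum.cong refl)
    fix J assume "J \<in> {..<N}"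
    then have "n * J + n * m \<le> E" using E_ge by simp
    then show "E - n * J = (E - n * J) - (B - k * J) + (B - k * J)" using B_le by linarith
  qed
  ultimately show ?thesis using weight_count by linarith
qed

lemma elim_positions: "elim_pos N 0 B E k = concat (map (\<lambda>J. [J * E + (B - k * J)..<J * E + E]) [0..<N])"
proof -
  have "B - k * J + (E - (B - k * J)) = E" for J
    using B_le by (simp add: E_def distrib_left)
  then show ?thesis unfolding elim_pos_eq by (simp add: add.assoc)
qed

text \<open>In segment J a member of the lattice can be nonzero only below J E + (E - n J); the
  positions above are free.\<close>

lemma eliminated_count:
  "length (filter (\<lambda>i. \<exists>v\<in>(\<lambda>Q. poly Q (monom 1 E)) ` lattice. coeff v i \<noteq> 0) (elim_pos N 0 B E k))
    \<le> (\<Sum>J<N. (E - n * J) - (B - k * J))"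
    (is "length (filter ?P _) \<le> _")
proof -
  have "length (filter ?P (elim_pos N 0 B E k)) = (\<Sum>J<N. length (filter ?P [J * E + (B - k * J)..<J * E + E]))"
    unfolding elim_positions
    by (simp add: length_filter_concat comp_def interv_sum_list_conv_sum_set_nat atLeast0LessThan)
  also have "\<dots> \<le> (\<Sum>J<N. (E - n * J) - (B - k * J))"
  proof (rule sum_mono)
    fix J
    have "length (filter ?P [J * E + (B - k * J)..<J * E + E]) \<le> J * E + (E - n * J) - (J * E + (B - k * J))"
    proof (rule length_filter_upt_le)
      fix x assume x: "x \<in> {J * E + (B - k * J)..<J * E + E}" and "?P x"
      then obtain Q where Q: "Q \<in> lattice" "coeff (poly Q (monom 1 E)) x \<noteq> 0" by auto
      define e where "e = x - J * E"
      have e: "x = J * E + e" "e < E" using x by (auto simp: e_def)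
      then have "coeff (coeff Q J) e \<noteq> 0" using Q coeff_kron[OF coeff_less_E[OF Q(1)]] by simp
      then have "e + n * J < E" using Q(1) unfolding lattice_def by blast
      then show "x < J * E + (E - n * J)" using e by simp
    qed
    then show "length (filter ?P [J * E + (B - k * J)..<J * E + E]) \<le> (E - n * J) - (B - k * J)" by simp
  qed
  finally show ?thesis .
qed

lemma reduced_nonempty: "reduced \<noteq> []"
proof -
  have "length rows \<le> length reduced + (\<Sum>J<N. (E - n * J) - (B - k * J))"
    unfolding reduced_def
    by (rule order.trans[OF length_fold_elim_ge[OF axpy_closed_lattice rows_in_lattice]
        add_left_mono[OF eliminated_count]])
  then have "length reduced > 0" using count_less by linarith
  then show ?thesis by simp
qed

section \<open>Properties of the auxiliary polynomial\<close>

definition aux :: "'a poly poly" where "aux = unkron N E (hd reduced)"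

lemma aux_props:
  shows aux_in_lattice: "aux \<in> lattice" and aux_nz: "aux \<noteq> 0"
    and aux_low: "coeff (coeff aux J) e \<noteq> 0 \<Longrightarrow> e + k * J < B"
proof -
  obtain r rs where r: "reduced = r # rs" using reduced_nonempty by (cases reduced) auto
  have "r \<in> (\<lambda>Q. poly Q (monom 1 E)) ` lattice"
    using fold_elim_closed[OF axpy_closed_lattice rows_in_lattice, of "elim_pos N 0 B E k"] r
    unfolding reduced_def by auto
  then obtain Q where Q: "Q \<in> lattice" "r = poly Q (monom 1 E)" by auto
  have "\<forall>J e. coeff (coeff Q J) e \<noteq> 0 \<longrightarrow> J < N \<and> e < E"
    using Q(1) unfolding lattice_def by fastforce
  then have aux: "aux = Q" unfolding aux_def r by (simp add: Q unkron_kron)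
  \<comment> \<open>Survival of a row would not exclude that it has become 0; independence
    does.\<close>
  have "indep reduced" unfolding reduced_def by (intro indep_fold_elim indep_rows)
  then have "r \<noteq> 0" using r indep_nonzero by metis
  then show "aux \<in> lattice" "aux \<noteq> 0" using Q aux by auto
  assume nz: "coeff (coeff aux J) e \<noteq> 0"
  then have J: "J < N" and e: "e < E" using Q aux unfolding lattice_def by fastforce+
  have c: "coeff r (J * E + e) \<noteq> 0"
    using nz aux e coeff_kron[OF coeff_less_E[OF Q(1)] e] by (simp add: Q)
  have "J * E + e \<notin> set (elim_pos N 0 B E k)"
    using fold_elim_zero[of "J * E + e" "elim_pos N 0 B E k" r rows] c r unfolding reduced_def by auto
  moreover have "J * E + e \<in> set (elim_pos N 0 B E k)" if "B - k * J \<le> e"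
    unfolding elim_positions using J e that by (auto intro!: bexI[of _ J])
  ultimately have "\<not> B - k * J \<le> e" by blast
  then show "e + k * J < B" by linarith
qed

text \<open>The m-th power of the gcd divides the value at \<open>w\<close> and has degree at least
  m g = B, while the value has degree below B.\<close>

lemma aux_root:
  assumes "degree w \<le> k" "g \<le> degree (gcd (poly f w) p)"
  shows "poly aux w = 0"
proof (rule ccontr)
  assume nz: "poly aux w \<noteq> 0"
  let ?h = "gcd (poly f w) p"
  have "?h ^ m dvd poly aux w" using aux_in_lattice unfolding lattice_def by auto
  then have "degree (?h ^ m) \<le> degree (poly aux w)" using nz by (rule dvd_imp_degree_le)
  moreover have "degree (poly aux w) < B" using aux_low assms(1) B_pos by (intro degree_poly_less) auto
  moreover have "degree (?h ^ m) = m * degree ?h" using p_nz by (simp add: degree_power_eq)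
  moreover have "B \<le> m * degree ?h" using assms(2) by (simp add: B_def)
  ultimately show False by linarith
qed

lemma degree_aux: "degree aux < N"
proof -
  have "coeff (coeff aux (degree aux)) (degree (coeff aux (degree aux))) \<noteq> 0" using aux_nz by simp
  then show ?thesis using aux_in_lattice unfolding lattice_def by blast
qed

lemma plen_coeff_aux: "plen (coeff aux J) \<le> E"
proof (cases "coeff aux J = 0")
  case False
  then have "coeff (coeff aux J) (degree (coeff aux J)) \<noteq> 0" by simp
  then have "degree (coeff aux J) < E" using coeff_less_E[OF aux_in_lattice] by blast
  then show ?thesis by (simp add: plen_le_iff)
qed simp

lemma length_rows_le: "length rows \<le> N * E"
proof -
  have "length rows \<le> (\<Sum>i<M. \<Sum>j<d. E)" unfolding length_rows by (intro sum_mono) simp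
  then show ?thesis by (simp add: N_def)
qed

lemma plen_rows: "r \<in> set rows \<Longrightarrow> plen r \<le> N * E"
proof -
  assume "r \<in> set rows"
  then obtain i j l where r: "i < M" "j < d" "l < E - n * d * i - n * j - n * (m - i)" "r = basis_row i j l"
    unfolding set_rows by auto
  then have "l + n * (m - i) < E" by simp
  then have "degree r < (i * d + j + 1) * E" using r by (simp add: degree_basis_row algebra_simps)
  also have "\<dots> \<le> N * E" using index_less[OF r(1,2)] by (intro mult_right_mono) auto
  finally show ?thesis by (simp add: plen_le_iff)
qed

end

section \<open>Polynomial bounds\<close>

text \<open>Restricting to s at least 1 allows exponents to be raised, so bounds with different
  exponents can be added.\<close>

definition poly_bounded :: "(nat \<Rightarrow> nat) \<Rightarrow> bool" where
  "poly_bounded F \<longleftrightarrow> (\<exists>C K. \<forall>s\<ge>1. F s \<le> C * s ^ K)"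

lemma poly_bounded_const: "poly_bounded (\<lambda>s. c)"
  unfolding poly_bounded_def by (rule exI[of _ c], rule exI[of _ 0]) simp

lemma poly_bounded_id: "poly_bounded (\<lambda>s. s)"
  unfolding poly_bounded_def by (rule exI[of _ 1], rule exI[of _ 1]) simp

lemma poly_bounded_add:
  assumes "poly_bounded F" "poly_bounded G" shows "poly_bounded (\<lambda>s. F s + G s)"
proof -
  from assms obtain C K C' K' where *: "\<And>s. s \<ge> 1 \<Longrightarrow> F s \<le> C * s ^ K" "\<And>s. s \<ge> 1 \<Longrightarrow> G s \<le> C' * s ^ K'"
    unfolding poly_bounded_def by blast
  have "F s + G s \<le> (C + C') * s ^ (K + K')" if "s \<ge> 1" for s
  proof -
    have "C * s ^ K \<le> C * s ^ (K + K')" "C' * s ^ K' \<le> C' * s ^ (K + K')"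
      using that by (intro mult_left_mono power_increasing; simp)+
    then show ?thesis using *[OF that] unfolding distrib_right by linarith
  qed
  then show ?thesis unfolding poly_bounded_def by blast
qed

lemma poly_bounded_mult:
  assumes "poly_bounded F" "poly_bounded G" shows "poly_bounded (\<lambda>s. F s * G s)"
proof -
  from assms obtain C K C' K' where *: "\<And>s. s \<ge> 1 \<Longrightarrow> F s \<le> C * s ^ K" "\<And>s. s \<ge> 1 \<Longrightarrow> G s \<le> C' * s ^ K'"
    unfolding poly_bounded_def by blast
  have "F s * G s \<le> (C * C') * s ^ (K + K')" if "s \<ge> 1" for s
    using mult_mono[OF *(1)[OF that] *(2)[OF that]] by (simp add: power_add mult_ac)
  then show ?thesis unfolding poly_bounded_def by blast
qed

lemma poly_bounded_power: "poly_bounded F \<Longrightarrow> poly_bounded (\<lambda>s. F s ^ k)"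
  by (induction k) (auto intro: poly_bounded_const poly_bounded_mult)

lemmas poly_bounded_intros =
  poly_bounded_const poly_bounded_id poly_bounded_add poly_bounded_mult poly_bounded_power

text \<open>With s = n + d, the terms s (s + 1) s and s (s + 1) bound N and both m and M, and s
  times their sum bounds E. The product of the two padded sums dominates all sizes, including N
  E.\<close>

definition size_bound :: "nat \<Rightarrow> nat" where
  "size_bound s = (s * (s + 1) * s + s * (s + 1) + s + 3) * (s * (s * (s + 1) * s + s * (s + 1)) + s + 3)"

text \<open>The three summands cover the root finder, the rest of the program, and the case d = 0,
  which costs at most 10.\<close>

definition time_bound :: "nat \<Rightarrow> nat \<Rightarrow> nat \<Rightarrow> nat" where
  "time_bound c k s = c * size_bound s ^ k + main_cost (size_bound s) + 10"

lemma poly_bounded_time: "poly_bounded (time_bound c k)"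
proof -
  have L: "poly_bounded size_bound"
    unfolding size_bound_def by (intro poly_bounded_intros)
  have "poly_bounded (\<lambda>s. time_bound c k s)"
    unfolding time_bound_def main_cost_def solve_cost_def test_cost_def by (intro poly_bounded_intros L)
  then show ?thesis by simp
qed

lemma sum_list_le_length_mult: "(\<And>x. x \<in> set xs \<Longrightarrow> h x \<le> c) \<Longrightarrow> (\<Sum>x\<leftarrow>xs. h x) \<le> length xs * c"
  for h :: "'b \<Rightarrow> nat"
proof (induction xs)
  case (Cons x xs)
  then show ?case using Cons.prems[of x] by (simp add: add_mono)
qed simp

context congruence_problem
begin

text \<open>Otherwise k d n would be at least n^2, hence at least g^2. This bounds \<open>k\<close>
  by the size of the input.\<close>

lemma k_less: "k < n"
proof (rule ccontr)
  assume "\<not> k < n"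
  then have "n * 1 \<le> k * d" using d_pos by (intro mult_mono) auto
  then have "n * n \<le> k * d * n" by (intro mult_right_mono) auto
  moreover have "g * g \<le> n * n" using g by (intro mult_mono) auto
  ultimately show False using kdn unfolding power2_eq_square by linarith
qed

lemma size_bounds:
  defines "L \<equiv> size_bound (n + d)"
  shows "n < L" "d < L" "Suc k * d \<le> L" "m \<le> L" "N + m \<le> L" "M \<le> L" "E \<le> L"
    "n + Suc d * Suc k \<le> L" "n + Suc d * Suc E \<le> L" "1 + (N * E + M) \<le> L" "m * Suc n + 1 \<le> L"
    "n * m \<le> L" "n * d \<le> L" "N * E + B \<le> L" "N * Suc E \<le> L"
proof -
  define s where "s = n + d"
  define m' where "m' = s * (s + 1)"
  define N' where "N' = s * (s + 1) * s"
  define E' where "E' = s * (N' + m')"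
  have ns: "n \<le> s" and ds: "d \<le> s" and ks: "Suc k \<le> s" and gs: "g \<le> s" using k_less g by (auto simp: s_def)
  have mm: "m \<le> m'" and MM: "M \<le> m'"
    unfolding m_def M_def m'_def using ns gs by (intro mult_mono; simp)+
  have NN: "N \<le> N'" unfolding N_def N'_def m'_def[symmetric] using MM ds by (intro mult_mono) auto
  have EE: "E \<le> E'" unfolding E_def E'_def using ns mm NN by (intro mult_mono add_mono) auto
  have prods: "N * E \<le> N' * E'" "m * n \<le> m' * s" "m * g \<le> m' * s" "n * d \<le> s * s" "d * E \<le> s * E'" "d * k \<le> s * s"
    using ns ds ks gs mm NN EE by (intro mult_mono; simp)+
  have "L = (N' + m' + s + 3) * (E' + s + 3)"
    by (simp only: L_def size_bound_def s_def[symmetric] E'_def N'_def m'_def)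
  then have L: "L = N' * E' + N' * s + 3 * N' + m' * E' + m' * s + 3 * m' + s * E' + s * s + 3 * s + 3 * E' + 3 * s + 9"
    by (simp add: algebra_simps)
  note bounds = ns ds ks gs mm MM NN EE prods L
  show "n < L" "d < L" "m \<le> L" "N + m \<le> L" "M \<le> L" "E \<le> L" using bounds by linarith+
  show "1 + (N * E + M) \<le> L" "n * d \<le> L" using bounds by linarith+
  have eqs: "Suc k * d = d * k + d" "Suc d * Suc k = d * k + d + k + 1" "Suc d * Suc E = d * E + d + E + 1"
    "m * Suc n = m * n + m" "B = m * g" "N * Suc E = N * E + N"
    by (simp_all add: B_def)
  show "Suc k * d \<le> L" unfolding eqs using bounds by linarith
  show "n + Suc d * Suc k \<le> L" unfolding eqs using bounds by linarith
  show "n + Suc d * Suc E \<le> L" unfolding eqs using bounds by linarith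
  show "m * Suc n + 1 \<le> L" unfolding eqs using bounds by linarith
  show "n * m \<le> L" unfolding mult.commute[of n m] using bounds by linarith
  show "N * E + B \<le> L" unfolding eqs using bounds by linarith
  show "N * Suc E \<le> L" unfolding eqs using bounds by linarith
qed

lemma length_coeffs_f: "length (coeffs f) = Suc d"
  using f_nz degree_f by (simp add: length_coeffs_degree)

lemma plen_p: "plen p = Suc n"
  using p_nz degree_p by (simp add: length_coeffs_degree)

lemma horner_coeffs_f: "horner (coeffs f) w = poly f w"
  by (simp add: horner_eq_poly)

lemma aux_eq: "candidate_poly n d k m M N B E p (coeffs f) = aux"
  by (simp add: candidate_poly_def aux_def reduced_def rows_def horner_coeffs_f)

lemma bipoly_size_aux: "bipoly_size aux \<le> size_bound (n + d)"
proof -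
  have "plen c + 1 \<le> Suc E" if "c \<in> set (coeffs aux)" for c
    using that plen_coeff_aux by (auto simp: in_set_conv_nth coeffs_nth[OF aux_nz] length_coeffs_degree aux_nz)
  then have "bipoly_size aux \<le> length (coeffs aux) * Suc E"
    unfolding bipoly_size_def by (rule sum_list_le_length_mult)
  also have "\<dots> \<le> N * Suc E"
    using degree_aux aux_nz by (intro mult_right_mono) (simp_all add: length_coeffs_degree)
  also have "\<dots> \<le> size_bound (n + d)" by (rule size_bounds)
  finally show ?thesis .
qed

text \<open>Taking all root finders with the answer \<open>(ws, t)\<close> on \<open>aux\<close>
  gives one running time for all of them, hence a function of the answer.\<close>

lemma computes_solutions:
  assumes "\<forall>j<g. \<not> \<beta> * real n \<le> real j" "\<beta> * real n \<le> real g"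
    and "\<forall>j<Suc k. \<not> \<beta>\<^sup>2 * real n \<le> real (j * d)" "\<beta>\<^sup>2 * real n \<le> real (Suc k * d)"
    and ws: "distinct ws" "set ws = {w. poly aux w = 0}"
  shows "computes \<beta> {R. R aux = (ws, t)} 0 [enc_poly p, enc_polys (coeffs f)]
    (enc_polys (filter (admissible \<beta> p (coeffs f) n (Suc k)) ws)) (t + main_cost (size_bound (n + d)))"
proof -
  let ?L = "size_bound (n + d)"
  \<comment> \<open>Distinctness turns the bound on the number of roots into a bound on the length
    of the list to be filtered.\<close>
  have "length ws = card (set ws)" using ws(1) by (simp add: distinct_card)
  also have "\<dots> \<le> degree aux" unfolding ws(2) by (rule card_poly_roots_bound[OF aux_nz])
  finally have lws: "length ws \<le> ?L" using degree_aux size_bounds(5) by linarith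
  have plen_fh: "plen fh = Suc (d * E)" using degree_fh by (simp add: length_coeffs_degree)
  have cf: "\<forall>c\<in>set (coeffs f). plen c \<le> n"
    using coeff_f f_nz by (auto simp: in_set_conv_nth coeffs_nth length_coeffs_degree plen_le_iff)
  have "M * plen fh = N * E + M" by (simp add: plen_fh N_def algebra_simps)
  then have Mfh: "1 + M * plen (horner (coeffs f) (monom 1 E)) \<le> ?L" using size_bounds(10) by (simp add: horner_coeffs_f)
  have NL: "N \<le> ?L" and kL: "Suc k \<le> ?L" and gL: "g \<le> ?L" and NE: "N * E \<le> ?L"
    using size_bounds(1,5,14) k_less g by linarith+
  have rows': "all_rows E n d p (horner (coeffs f) (monom 1 E)) m M 1 E = rows"
    by (simp add: rows_def horner_coeffs_f)
  have lr: "length rows \<le> ?L" using length_rows_le NE by linarith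
  have pr: "\<forall>r\<in>set rows. plen r \<le> ?L" using plen_rows NE by (meson order.trans)
  have "computes \<beta> {R. R aux = (ws, t)} 31 [enc_poly p, enc_polys (coeffs f), unary n, unary d, unary (Suc k),
      unary m, unary M, unary N, unary B, unary E]
    (enc_polys (filter (admissible \<beta> p (coeffs f) n (Suc k)) ws)) (t + solve_cost ?L)"
  proof (rule computes_main4[where A = n], unfold rows' aux_eq length_coeffs_f plen_p)
    show "Suc d \<le> ?L" "Suc n \<le> ?L" "n \<le> ?L" "d \<le> ?L" using size_bounds(1,2) by auto
    show "fold elim_coeff (elim_pos N 0 B E k) rows \<noteq> []"
      using reduced_nonempty by (simp add: reduced_def)
  qed (use size_bounds p_nz aux_nz cf lws Mfh kL NL lr pr in auto)
  then show ?thesis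
    by (intro computes_main[where m = m and M = M and N = N and B = B and E = E and g = g and k = k])
      (use assms plen_p length_coeffs_f d_pos size_bounds gL kL NL in \<open>simp_all add: m_def M_def N_def B_def E_def\<close>)
qed

end

section \<open>Correctness\<close>

text \<open>The two values at \<open>w\<close> are congruent modulo \<open>p\<close>.\<close>

lemma gcd_poly_mod:
  fixes p :: "'a::field_gcd poly"
  assumes "f' = Poly (map (\<lambda>c. c mod p) (coeffs f))"
  shows "gcd (poly f' w) p = gcd (poly f w) p"
proof -
  have "p dvd poly (Poly cs) w - poly (Poly (map (\<lambda>c. c mod p) cs)) w" for cs
  proof (induction cs)
    case (Cons c cs)
    have "p dvd c - c mod p" by (simp add: minus_mod_eq_mult_div)
    moreover from Cons have "p dvd w * (poly (Poly cs) w - poly (Poly (map (\<lambda>c. c mod p) cs)) w)" by simp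
    ultimately have "p dvd (c - c mod p) + w * (poly (Poly cs) w - poly (Poly (map (\<lambda>c. c mod p) cs)) w)"
      by (rule dvd_add)
    then show ?case by (simp add: algebra_simps)
  qed simp
  from this[of "coeffs f"] assms have "p dvd poly f w - poly f' w" by simp
  then obtain q where "poly f w = poly f' w + p * q" by (metis dvd_def diff_add_cancel add.commute)
  then show ?thesis by (metis gcd.commute gcd_add_mult mult.commute add.commute)
qed

text \<open>Since \<open>p\<close> is not constant, the leading coefficient 1 survives reduction. So
  the reduced list has no trailing zero, and the input is the encoding of a genuine monic polynomial
  of the same degree.\<close>

lemma Poly_mod_monic:
  fixes p :: "'a::field_gcd poly" and f :: "'a poly poly"
  assumes "degree p > 0" "lead_coeff f = 1"
  defines "f' \<equiv> Poly (map (\<lambda>c. c mod p) (coeffs f))"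
  shows "coeffs f' = map (\<lambda>c. c mod p) (coeffs f)" "degree f' = degree f" "lead_coeff f' = 1"
    "degree (coeff f' J) < degree p"
proof -
  have nz: "f \<noteq> 0" "p \<noteq> 0" using assms by auto
  have one: "1 mod p = (1 :: 'a poly)" using assms(1) by (simp add: mod_poly_less)
  have "last (map (\<lambda>c. c mod p) (coeffs f)) = 1"
    using nz assms(2) one by (simp add: last_map last_coeffs_eq_coeff_degree)
  moreover have "map (\<lambda>c. c mod p) (coeffs f) \<noteq> []" using nz by simp
  ultimately show c: "coeffs f' = map (\<lambda>c. c mod p) (coeffs f)"
    unfolding f'_def coeffs_Poly by (intro strip_while_idem) (simp add: no_trailing_unfold)
  show d: "degree f' = degree f" by (simp add: degree_eq_length_coeffs c)
  have f': "coeff f' J = coeff f J mod p" for J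
    unfolding f'_def coeff_Poly_eq nth_default_coeffs_eq[symmetric] by (simp add: nth_default_def)
  show "lead_coeff f' = 1" using assms(2) one by (simp add: d f')
  show "degree (coeff f' J) < degree p"
    using degree_mod_less'[of p "coeff f J"] nz assms(1) by (cases "coeff f J mod p = 0") (auto simp: f')
qed

text \<open>\<open>g\<close> and \<open>Suc k\<close> are the least numbers passing the two
  comparisons. Minimality gives k d < \<beta>^2 n; multiplying by n gives k d n < (\<beta> n)^2,
  which is at most g^2.\<close>

lemma integer_thresholds:
  fixes \<beta> :: real and n d :: nat
  assumes "0 < \<beta>" "\<beta> \<le> 1" "n > 0" "d > 0"
  obtains g k where "\<forall>j<g. \<not> \<beta> * real n \<le> real j" "\<beta> * real n \<le> real g"
    "\<forall>j<Suc k. \<not> \<beta>\<^sup>2 * real n \<le> real (j * d)" "\<beta>\<^sup>2 * real n \<le> real (Suc k * d)"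
    "0 < g" "g \<le> n" "k * d * n < g\<^sup>2"
proof -
  define g where "g = (LEAST j. \<beta> * real n \<le> real j)"
  have ex: "\<exists>j. \<beta> * real n \<le> real j" by (rule real_arch_simple)
  have g: "\<beta> * real n \<le> real g" unfolding g_def using ex by (rule LeastI_ex)
  have g1: "\<forall>j<g. \<not> \<beta> * real n \<le> real j" unfolding g_def using not_less_Least by blast
  have "\<beta> * real n \<le> real n" using assms by (simp add: mult_le_cancel_right1)
  then have gn: "g \<le> n" unfolding g_def by (rule Least_le)
  have bn: "0 < \<beta> * real n" using assms by simp
  then have g0: "0 < g" using g by (metis not_less of_nat_le_0_iff of_nat_0_less_iff less_le_trans)
  define \<kappa> where "\<kappa> = (LEAST j. \<beta>\<^sup>2 * real n \<le> real (j * d))"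
  obtain j where "\<beta>\<^sup>2 * real n \<le> real j" using real_arch_simple by blast
  moreover have "real j \<le> real (j * d)" using assms(4) by (intro of_nat_mono) simp
  ultimately have "\<exists>j. \<beta>\<^sup>2 * real n \<le> real (j * d)" by (meson order.trans)
  then have k: "\<beta>\<^sup>2 * real n \<le> real (\<kappa> * d)" unfolding \<kappa>_def by (rule LeastI_ex)
  have k1: "\<forall>j<\<kappa>. \<not> \<beta>\<^sup>2 * real n \<le> real (j * d)" unfolding \<kappa>_def using not_less_Least by blast
  have "0 < \<beta>\<^sup>2 * real n" using assms by simp
  with k have "\<kappa> \<noteq> 0" by (intro notI) simp
  then obtain k' where k': "\<kappa> = Suc k'" by (cases \<kappa>) auto
  have "real (k' * d) < \<beta>\<^sup>2 * real n" using k1 k' by (metis lessI not_le)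
  then have "real (k' * d) * real n < \<beta>\<^sup>2 * real n * real n" using assms(3) by (intro mult_strict_right_mono) auto
  also have "\<dots> = (\<beta> * real n)\<^sup>2" by (simp add: power2_eq_square mult_ac)
  also have "\<dots> \<le> (real g)\<^sup>2" using g bn by (intro power_mono) auto
  finally have "real (k' * d * n) < real (g\<^sup>2)" by simp
  then have "k' * d * n < g\<^sup>2" by (simp only: of_nat_less_iff)
  with g g1 gn g0 k k1 k' that show ?thesis by blast
qed

context congruence_problem
begin

text \<open>Being a root of \<open>aux\<close> imposes nothing extra: \<open>aux_root\<close>
  derives it from the two conditions that the filter checks.\<close>

lemma solutions_eq:
  fixes \<beta> :: real
  assumes "\<beta> * real n \<le> real g" "\<forall>j<g. \<not> \<beta> * real n \<le> real j"
    and k: "\<forall>j<Suc k. \<not> \<beta>\<^sup>2 * real n \<le> real (j * d)" "\<beta>\<^sup>2 * real n \<le> real (Suc k * d)"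
  shows "{w. poly aux w = 0 \<and> admissible \<beta> p (coeffs f) n (Suc k) w} =
    {w. real (degree w) < \<beta>\<^sup>2 * real n / real d \<and> \<beta> * real n \<le> real (degree (gcd (poly f w) p))}"
proof -
  have deg: "plen w \<le> Suc k \<longleftrightarrow> real (degree w) < \<beta>\<^sup>2 * real n / real d" for w :: "'a poly"
  proof -
    have "real (degree w) < \<beta>\<^sup>2 * real n / real d \<longleftrightarrow> \<not> \<beta>\<^sup>2 * real n \<le> real (degree w * d)"
      using d_pos by (simp add: pos_less_divide_eq not_le)
    also have "\<dots> \<longleftrightarrow> degree w < Suc k"
    proof
      assume a: "\<not> \<beta>\<^sup>2 * real n \<le> real (degree w * d)"
      show "degree w < Suc k"
      proof (rule ccontr)
        assume "\<not> degree w < Suc k"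
        then have "Suc k * d \<le> degree w * d" by (intro mult_right_mono) auto
        then have "real (Suc k * d) \<le> real (degree w * d)" by (simp only: of_nat_le_iff)
        with k(2) a show False by linarith
      qed
    qed (use k(1) in blast)
    also have "\<dots> \<longleftrightarrow> plen w \<le> Suc k" unfolding plen_le_iff by auto
    finally show ?thesis by simp
  qed
  have root: "poly aux w = 0" if "plen w \<le> Suc k" "\<beta> * real n \<le> real (degree (gcd (poly f w) p))" for w
  proof (rule aux_root)
    show "degree w \<le> k" using that(1) unfolding plen_le_iff by auto
    show "g \<le> degree (gcd (poly f w) p)" using that(2) assms(2) by (meson not_le)
  qed
  show ?thesis using root by (auto simp: admissible_def horner_coeffs_f deg)
qed

end

theorem theorem1p2:
  fixes M :: "'w measure" and rf :: "'w \<Rightarrow> 'a::field_gcd root_finder"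
  assumes "efficient_root_finder M rf"
  shows "\<exists>(P :: program) (C :: nat) (K :: nat).
    \<forall>(\<beta> :: real) (p :: 'a poly) (f :: 'a poly poly) (n :: nat) (d :: nat).
      degree p = n \<and> n > 0 \<and> lead_coeff f = 1 \<and> degree f = d \<and> 0 < \<beta> \<and> \<beta> \<le> 1 \<longrightarrow>
      (\<exists>(ws :: 'w \<Rightarrow> 'a poly list) (T :: 'w \<Rightarrow> nat).
        (AE \<omega> in M.
          runs P \<beta> (rf \<omega>) [enc_poly p, enc_polys (map (\<lambda>c. c mod p) (coeffs f))]
            (enc_polys (ws \<omega>)) (T \<omega>) \<and>
          distinct (ws \<omega>) \<and>
          set (ws \<omega>) = {w. real (degree w) < \<beta>\<^sup>2 * real n / real d \<and>
                           real (degree (gcd (poly f w) p)) \<ge> \<beta> * real n}) \<and>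
        T \<in> measurable M (count_space UNIV) \<and>
        (\<integral>\<^sup>+ \<omega>. of_nat (T \<omega>) \<partial>M) \<le> of_nat (C * (n + d) ^ K))"
proof -
  from assms obtain c0 k0 where "prob_space M" and rf: "\<And>Q. Q \<noteq> 0 \<Longrightarrow>
      (\<lambda>\<omega>. rf \<omega> Q) \<in> measurable M (count_space UNIV) \<and>
      (AE \<omega> in M. distinct (fst (rf \<omega> Q)) \<and> set (fst (rf \<omega> Q)) = {w. poly Q w = 0}) \<and>
      (\<integral>\<^sup>+ \<omega>. of_nat (snd (rf \<omega> Q)) \<partial>M) \<le> of_nat (c0 * bipoly_size Q ^ k0)"
    unfolding efficient_root_finder_def by blast
  interpret prob_space M by fact
  obtain C K where CK: "\<And>s. s \<ge> 1 \<Longrightarrow> time_bound c0 k0 s \<le> C * s ^ K"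
    using poly_bounded_time[of c0 k0] unfolding poly_bounded_def by blast
  show ?thesis
  proof (rule exI[of _ prog], rule exI[of _ C], rule exI[of _ K], intro allI impI, elim conjE)
    fix \<beta> :: real and p :: "'a poly" and f :: "'a poly poly" and n d :: nat
    assume p: "degree p = n" "n > 0" and f: "lead_coeff f = 1" "degree f = d" and \<beta>: "0 < \<beta>" "\<beta> \<le> 1"
    let ?fs = "map (\<lambda>c. c mod p) (coeffs f)"
    let ?sol = "{w. real (degree w) < \<beta>\<^sup>2 * real n / real d \<and> real (degree (gcd (poly f w) p)) \<ge> \<beta> * real n}"
    have tb: "time_bound c0 k0 (n + d) \<le> C * (n + d) ^ K" using p by (intro CK) simp
    show "\<exists>ws T. (AE \<omega> in M. runs prog \<beta> (rf \<omega>) [enc_poly p, enc_polys ?fs] (enc_polys (ws \<omega>)) (T \<omega>) \<and>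
          distinct (ws \<omega>) \<and> set (ws \<omega>) = ?sol) \<and>
        T \<in> measurable M (count_space UNIV) \<and> (\<integral>\<^sup>+ \<omega>. of_nat (T \<omega>) \<partial>M) \<le> of_nat (C * (n + d) ^ K)"
    proof (cases "d = 0")
      case True
      then have "length (coeffs f) = Suc 0" 
        using f leading_coeff_0_iff[of f] by (simp add: length_coeffs_degree)
      then obtain c where c: "coeffs f = [c]" by (auto simp: length_Suc_conv)
      from computes_main_const[of \<beta> UNIV "enc_poly p" "c mod p"] obtain t where t: "t \<le> 10"
        "evals prog \<beta> UNIV [enc_poly p, enc_polys ?fs] (prog ! 0) (enc_polys []) t"
        unfolding computes_def c by auto
      have "runs prog \<beta> (rf \<omega>) [enc_poly p, enc_polys ?fs] (enc_polys []) t" for \<omega>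
        using t(2) unfolding runs_def evals_def by (auto simp: prog_def)
      \<comment> \<open>Division by \<open>real 0\<close> yields 0, so the degree bound reads degree
        < 0.\<close>
      moreover have "?sol = {}" using True by simp
      moreover have "t \<le> C * (n + d) ^ K" using t(1) tb unfolding time_bound_def by linarith
      then have "(\<integral>\<^sup>+ \<omega>. of_nat t \<partial>M) \<le> of_nat (C * (n + d) ^ K)"
        by (simp only: nn_integral_const emeasure_space_1 mult_1_right of_nat_le_iff)
      ultimately show ?thesis by (intro exI[of _ "\<lambda>_. []"] exI[of _ "\<lambda>_. t"]) simp
    next
      case False
      then have d: "d > 0" by simp
      define f' where "f' = Poly ?fs"
      have dp: "degree p > 0" using p by simp
      note f' = Poly_mod_monic[OF dp f(1), folded f'_def]
      from integer_thresholds[OF \<beta> p(2) d] obtain g k where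
        gk: "\<forall>j<g. \<not> \<beta> * real n \<le> real j" "\<beta> * real n \<le> real g"
          "\<forall>j<Suc k. \<not> \<beta>\<^sup>2 * real n \<le> real (j * d)" "\<beta>\<^sup>2 * real n \<le> real (Suc k * d)"
        and gk': "0 < g" "g \<le> n" "k * d * n < g\<^sup>2" by blast
      interpret cp: congruence_problem p f' n d g k
        using p f f' d gk' by unfold_locales auto
      let ?ins = "[enc_poly p, enc_polys ?fs]"
      let ?adm = "admissible \<beta> p ?fs n (Suc k)"
      let ?L = "size_bound (n + d)"
      define good where "good x \<longleftrightarrow> distinct (fst x) \<and> set (fst x) = {w. poly cp.aux w = 0}"
        for x :: "'a poly list \<times> nat"
      have ex: "\<exists>t. t \<le> snd x + main_cost ?L \<and>
          evals prog \<beta> {R. R cp.aux = x} ?ins (prog ! 0) (enc_polys (filter ?adm (fst x))) t" if "good x" for x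
        using cp.computes_solutions[OF gk, of "fst x" "snd x"] that unfolding good_def computes_def f'(1) by auto
      \<comment> \<open>The running time as a function of the root finder's answer \<open>x\<close>,
        hence measurable, as the answers carry the discrete sigma-algebra.\<close>
      define h where "h x = (if good x then SOME t. t \<le> snd x + main_cost ?L \<and>
          evals prog \<beta> {R. R cp.aux = x} ?ins (prog ! 0) (enc_polys (filter ?adm (fst x))) t else 0)"
        for x :: "'a poly list \<times> nat"
      have h: "h x \<le> snd x + main_cost ?L"
        "evals prog \<beta> {R. R cp.aux = x} ?ins (prog ! 0) (enc_polys (filter ?adm (fst x))) (h x)" if "good x" for x
        using someI_ex[OF ex[OF that]] that by (auto simp: h_def)
      \<comment> \<open>The default 0 makes the bound hold for wrong answers too, so the expectation
        is estimated pointwise.\<close>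
      have h_le: "h x \<le> snd x + main_cost ?L" for x
        using h(1)[of x] by (cases "good x") (auto simp: h_def)
      define ws where "ws \<omega> = filter ?adm (fst (rf \<omega> cp.aux))" for \<omega>
      define T where "T \<omega> = h (rf \<omega> cp.aux)" for \<omega>
      note rf_aux = rf[OF cp.aux_nz]
      have sol: "{w. poly cp.aux w = 0 \<and> ?adm w} = ?sol"
        using cp.solutions_eq[OF gk(2,1,3,4)] unfolding f'(1) gcd_poly_mod[OF f'_def] .
      have "AE \<omega> in M. runs prog \<beta> (rf \<omega>) ?ins (enc_polys (ws \<omega>)) (T \<omega>) \<and> distinct (ws \<omega>) \<and> set (ws \<omega>) = ?sol"
        using rf_aux[THEN conjunct2, THEN conjunct1]
      proof eventually_elim
        case (elim \<omega>)
        then have "good (rf \<omega> cp.aux)" by (simp add: good_def)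
        from h(2)[OF this] have "evaluates prog \<beta> (rf \<omega>) ?ins (prog ! 0) (enc_polys (ws \<omega>)) (T \<omega>)"
          unfolding evals_def ws_def T_def by blast
        moreover have "prog \<noteq> []" by (simp add: prog_def)
        moreover have "set (ws \<omega>) = ?sol" using elim unfolding sol[symmetric] by (auto simp: ws_def)
        ultimately show ?case using elim by (simp add: runs_def ws_def)
      qed
      moreover have "T \<in> measurable M (count_space UNIV)"
        unfolding T_def using measurable_compose[OF rf_aux[THEN conjunct1], of h "count_space UNIV"] by simp
      moreover have "(\<integral>\<^sup>+ \<omega>. of_nat (T \<omega>) \<partial>M) \<le> of_nat (C * (n + d) ^ K)"
      proof -
        have meas: "(\<lambda>\<omega>. of_nat (snd (rf \<omega> cp.aux)) :: ennreal) \<in> borel_measurable M"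
          using measurable_compose[OF rf_aux[THEN conjunct1], of "\<lambda>x. of_nat (snd x) :: ennreal" borel] by simp
        have "(\<integral>\<^sup>+ \<omega>. of_nat (T \<omega>) \<partial>M) \<le> (\<integral>\<^sup>+ \<omega>. of_nat (snd (rf \<omega> cp.aux)) + of_nat (main_cost ?L) \<partial>M)"
          unfolding T_def of_nat_add[symmetric] by (intro nn_integral_mono) (simp only: of_nat_le_iff h_le)
        also have "\<dots> = (\<integral>\<^sup>+ \<omega>. of_nat (snd (rf \<omega> cp.aux)) \<partial>M) + of_nat (main_cost ?L)"
          using meas by (simp add: nn_integral_add emeasure_space_1)
        also have "\<dots> \<le> of_nat (c0 * bipoly_size cp.aux ^ k0) + of_nat (main_cost ?L)"
          using rf_aux by (intro add_right_mono) blast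
        also have "\<dots> = of_nat (c0 * bipoly_size cp.aux ^ k0 + main_cost ?L)" by simp
        also have "\<dots> \<le> of_nat (C * (n + d) ^ K)"
        proof -
          have "c0 * bipoly_size cp.aux ^ k0 \<le> c0 * ?L ^ k0"
            using cp.bipoly_size_aux by (intro mult_left_mono power_mono) auto
          then have "c0 * bipoly_size cp.aux ^ k0 + main_cost ?L \<le> C * (n + d) ^ K"
            using tb unfolding time_bound_def by linarith
          then show ?thesis by (simp only: of_nat_le_iff)
        qed
        finally show ?thesis .
      qed
      ultimately show ?thesis by blast
    qed
  qed
qed

end
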